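(* Let $\mathbb{K}$ be a field of characteristic zero and let $n\ge 1$. Then $A_s(n,\mathbb{K})$, with its canonical coaction $\alpha:\mathbb{K}^n\to\mathbb{K}^n\otimes A_s(n,\mathbb{K})$, $\alpha(e_i)=\sum_{k=1}^n e_k\otimes u_{ki}$, is the universal cosemisimple Hopf algebra coacting on the algebra $\mathbb{K}^n$; that is, $A_s(n,\mathbb{K})$ is cosemisimple, and for every cosemisimple Hopf algebra $H$ over $\mathbb{K}$ and every coaction $\beta:\mathbb{K}^n\to\mathbb{K}^n\otimes H$ on the algebra $\mathbb{K}^n$ there exists a unique bialgebra map $f:A_s(n,\mathbb{K})\to H$ such that $(\mathrm{id}_{\mathbb{K}^n}\otimes f)\circ\alpha=\beta$.
   Context: $\mathbb{K}^n$ is the diagonal algebra with canonical basis $e_1,\dots,e_n$, $e_ie_j=\delta_{ij}e_i$, $1=\sum_i e_i$. A coaction of a Hopf algebra $H$ on an algebra $A$ is a unital algebra map $\beta:A\to A\otimes H$ that makes $A$ a right $H$-comodule. A Hopf algebra is cosemisimple if its category of comodules is semisimple. $A_s(n,\mathbb{K})$ is the $\mathbb{K}$-algebra presented by generators $u_{ij}$, $1\le i,j\le n$, and relations, for all $i,j,k$: $u_{ki}u_{kj}=\delta_{ij}u_{ki}$, $\sum_{l=1}^n u_{il}=1$, $u_{ik}u_{jk}=\delta_{ij}u_{ik}$, $\sum_{l=1}^n u_{li}=1$. It is a Hopf algebra with $\Delta(u_{ij})=\sum_k u_{ik}\otimes u_{kj}$, $\varepsilon(u_{ij})=\delta_{ij}$,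 $S(u_{ij})=u_{ji}$. *)

theory Defs
  imports "HOL-Analysis.Cartesian_Space" "HOL-Library.Function_Algebras" "HOL-Library.Poly_Mapping"
begin

section \<open>Vector spaces and tensor products\<close>

text \<open>
  A vector space is a subspace of an ambient type carrying a scalar multiplication, so that
  subspaces and tensor products are again objects of the same kind.
\<close>

record ('k, 'v) vspace =
  carr :: "'v set"
  smul :: "'k \<Rightarrow> 'v \<Rightarrow> 'v"

definition is_space :: "('k::field, 'v::ab_group_add, 'm) vspace_scheme \<Rightarrow> bool" where
  "is_space V \<longleftrightarrow> vector_space (smul V) \<and> module.subspace (smul V) (carr V)"

definition linear_map ::
  "('k::field, 'v::ab_group_add, 'm) vspace_scheme \<Rightarrow> ('k, 'w::ab_group_add, 'l) vspace_scheme
     \<Rightarrow> ('v \<Rightarrow> 'w) \<Rightarrow> bool" where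
  "linear_map V W f \<longleftrightarrow>
     (\<forall>x\<in>carr V. f x \<in> carr W) \<and>
     (\<forall>x\<in>carr V. \<forall>y\<in>carr V. f (x + y) = f x + f y) \<and>
     (\<forall>c. \<forall>x\<in>carr V. f (smul V c x) = smul W c (f x))"

definition bilinear_map ::
  "('k::field, 'v::ab_group_add, 'm) vspace_scheme \<Rightarrow> ('k, 'w::ab_group_add, 'l) vspace_scheme
     \<Rightarrow> ('k, 'u::ab_group_add, 'p) vspace_scheme \<Rightarrow> ('v \<Rightarrow> 'w \<Rightarrow> 'u) \<Rightarrow> bool" where
  "bilinear_map V W U \<phi> \<longleftrightarrow>
     (\<forall>v\<in>carr V. linear_map W U (\<lambda>w. \<phi> v w)) \<and>
     (\<forall>w\<in>carr W. linear_map V U (\<lambda>v. \<phi> v w))"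

definition base_field :: "('k::field, 'k) vspace" where
  "base_field = \<lparr>carr = UNIV, smul = (*)\<rparr>"

text \<open>
  The tensor product is realised inside the dual of the space of bilinear forms: the pure tensor
  of \<open>v\<close> and \<open>w\<close> is evaluation at \<open>(v, w)\<close>, and the tensor product is the span of
  the pure tensors. Over a field this has the universal property of the tensor product, see
  \<open>tensor_lift_linear\<close> and \<open>tensor_lift_tens\<close> below. The case distinction
  makes the value independent of how forms behave outside the carriers.
\<close>

type_synonym ('k, 'v, 'w) tensors = "('v \<Rightarrow> 'w \<Rightarrow> 'k) \<Rightarrow> 'k"

definition tens ::
  "('k::field, 'v::ab_group_add, 'm) vspace_scheme \<Rightarrow> ('k, 'w::ab_group_add, 'l) vspace_scheme
     \<Rightarrow> 'v \<Rightarrow> 'w \<Rightarrow> ('k, 'v, 'w) tensors" where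
  "tens V W v w = (\<lambda>B. if bilinear_map V W base_field B then B v w else 0)"

definition tscale :: "'k::field \<Rightarrow> ('k, 'v, 'w) tensors \<Rightarrow> ('k, 'v, 'w) tensors" where
  "tscale c t = (\<lambda>B. c * t B)"

definition tensor ::
  "('k::field, 'v::ab_group_add, 'm) vspace_scheme \<Rightarrow> ('k, 'w::ab_group_add, 'l) vspace_scheme
     \<Rightarrow> ('k, ('k, 'v, 'w) tensors) vspace" where
  "tensor V W = \<lparr>carr = module.span tscale {tens V W v w | v w. v \<in> carr V \<and> w \<in> carr W},
                 smul = tscale\<rparr>"

text \<open>The linear map on a tensor product induced by a bilinear map \<open>\<phi>\<close>.\<close>

definition tensor_lift ::
  "('k::field, 'v::ab_group_add, 'm) vspace_scheme \<Rightarrow> ('k, 'w::ab_group_add, 'l) vspace_scheme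
     \<Rightarrow> ('v \<Rightarrow> 'w \<Rightarrow> 'u::ab_group_add) \<Rightarrow> ('k, 'v, 'w) tensors \<Rightarrow> 'u" where
  "tensor_lift V W \<phi> t =
     (THE u. \<exists>ps. set ps \<subseteq> carr V \<times> carr W \<and> t = (\<Sum>(v, w)\<leftarrow>ps. tens V W v w)
                \<and> u = (\<Sum>(v, w)\<leftarrow>ps. \<phi> v w))"

definition tensor_map ::
  "('k::field, 'v::ab_group_add, 'm) vspace_scheme \<Rightarrow> ('k, 'w::ab_group_add, 'l) vspace_scheme
     \<Rightarrow> ('k, 'v1::ab_group_add, 'm1) vspace_scheme \<Rightarrow> ('k, 'w1::ab_group_add, 'l1) vspace_scheme
     \<Rightarrow> ('v \<Rightarrow> 'v1) \<Rightarrow> ('w \<Rightarrow> 'w1) \<Rightarrow> ('k, 'v, 'w) tensors \<Rightarrow> ('k, 'v1, 'w1) tensors" where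
  "tensor_map V W V1 W1 f g = tensor_lift V W (\<lambda>v w. tens V1 W1 (f v) (g w))"

definition tensor_assoc ::
  "('k::field, 'u::ab_group_add, 'm) vspace_scheme \<Rightarrow> ('k, 'v::ab_group_add, 'l) vspace_scheme
     \<Rightarrow> ('k, 'w::ab_group_add, 'p) vspace_scheme
     \<Rightarrow> ('k, ('k, 'u, 'v) tensors, 'w) tensors \<Rightarrow> ('k, 'u, ('k, 'v, 'w) tensors) tensors" where
  "tensor_assoc U V W =
     tensor_lift (tensor U V) W
       (\<lambda>t w. tensor_lift U V (\<lambda>u v. tens U (tensor V W) u (tens V W v w)) t)"

subsection \<open>Universal property\<close>


lemma vector_space_tscale: "vector_space (tscale :: 'k::field \<Rightarrow> ('k, 'v, 'w) tensors \<Rightarrow> _)"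
  by unfold_locales (auto simp: tscale_def fun_eq_iff algebra_simps)

lemma is_space_tensor: "is_space (tensor V W)"
  unfolding is_space_def tensor_def vspace.simps
proof (intro conjI)
  show "vector_space tscale" by (rule vector_space_tscale)
  then have "module tscale" by (simp only: module_iff_vector_space)
  then show "module.subspace tscale (module.span tscale
      {tens V W v w | v w. v \<in> carr V \<and> w \<in> carr W})"
    by (rule module.subspace_span)
qed

lemma bilinear_tens:
  fixes V :: "('k::field, 'v::ab_group_add, 'm) vspace_scheme"
    and W :: "('k, 'w::ab_group_add, 'l) vspace_scheme"
  assumes "is_space V" "is_space W"
  shows "bilinear_map V W (tensor V W) (tens V W)"
proof -
  interpret T: vector_space "tscale :: 'k \<Rightarrow> ('k, 'v, 'w) tensors \<Rightarrow> _"
    by (rule vector_space_tscale)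
  have "tens V W v w \<in> carr (tensor V W)" if "v \<in> carr V" "w \<in> carr W" for v w
    using that by (auto simp: tensor_def intro!: T.span_base)
  then show ?thesis
    unfolding bilinear_map_def linear_map_def
    by (auto simp: tens_def tensor_def tscale_def base_field_def fun_eq_iff
        bilinear_map_def linear_map_def)
qed

lemma tensor_list_sum:
  fixes V :: "('k::field, 'v::ab_group_add, 'm) vspace_scheme"
    and W :: "('k, 'w::ab_group_add, 'l) vspace_scheme"
  assumes V: "is_space V" and t: "t \<in> carr (tensor V W)"
  obtains ps where "set ps \<subseteq> carr V \<times> carr W" "t = (\<Sum>(v, w)\<leftarrow>ps. tens V W v w)"
proof -
  interpret T: vector_space "tscale :: 'k \<Rightarrow> ('k, 'v, 'w) tensors \<Rightarrow> _"
    by (rule vector_space_tscale)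
  interpret V: vector_space "smul V" using V by (simp add: is_space_def)
  let ?S = "{tens V W v w | v w. v \<in> carr V \<and> w \<in> carr W}"
  have sV: "V.subspace (carr V)" using V by (simp add: is_space_def)
  have "\<exists>ps. set ps \<subseteq> carr V \<times> carr W \<and> t = (\<Sum>(v, w)\<leftarrow>ps. tens V W v w)"
    using t unfolding tensor_def vspace.simps
  proof (induction t rule: T.span_induct_alt)
    case base
    show ?case by (rule exI[of _ "[]"]) simp
  next
    case (step c x y)
    then obtain v w ps where *: "x = tens V W v w" "v \<in> carr V" "w \<in> carr W"
      "set ps \<subseteq> carr V \<times> carr W" "y = (\<Sum>(v, w)\<leftarrow>ps. tens V W v w)" by auto
    have "tscale c x = tens V W (smul V c v) w"
      using * by (auto simp: tens_def tscale_def base_field_def fun_eq_iff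
          bilinear_map_def linear_map_def)
    moreover have "smul V c v \<in> carr V" using sV * by (simp add: V.subspace_scale)
    ultimately show ?case
      using * by (intro exI[of _ "(smul V c v, w) # ps"]) auto
  qed
  then show thesis using that by blast
qed

lemma linear_functional_separates:
  assumes "vector_space s" and "x \<noteq> (0 :: 'u::ab_group_add)"
  obtains g where "Vector_Spaces.linear s ((*) :: 'k::field \<Rightarrow> _) g" "g x \<noteq> 0"
proof -
  interpret P: vector_space_pair s "(*) :: 'k \<Rightarrow> _"
    using assms(1) by (simp add: vector_space_pair_def vector_space_over_itself.vector_space_axioms)
  have ind: "P.vs1.independent {x}" using assms(2) by (simp add: P.vs1.dependent_single)
  show thesis
  proof (rule that)
    show "Vector_Spaces.linear s (*) (P.construct {x} (\<lambda>_. 1))"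
      using ind by (rule P.linear_construct)
    show "P.construct {x} (\<lambda>_. 1) x \<noteq> 0"
      using P.construct_basis[OF ind, of x "\<lambda>_. 1"] by simp
  qed
qed

lemma tensor_lift_wd:
  assumes U: "is_space U" and bil: "bilinear_map V W U \<phi>"
    and ps: "set ps \<subseteq> carr V \<times> carr W" and qs: "set qs \<subseteq> carr V \<times> carr W"
    and eq: "(\<Sum>(v, w)\<leftarrow>ps. tens V W v w) = (\<Sum>(v, w)\<leftarrow>qs. tens V W v w)"
  shows "(\<Sum>(v, w)\<leftarrow>ps. \<phi> v w) = (\<Sum>(v, w)\<leftarrow>qs. \<phi> v w)"
proof (rule ccontr)
  assume "\<not> ?thesis"
  then have ne: "(\<Sum>(v, w)\<leftarrow>ps. \<phi> v w) - (\<Sum>(v, w)\<leftarrow>qs. \<phi> v w) \<noteq> 0" by simp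
  obtain g where g: "Vector_Spaces.linear (smul U) (*) g"
    "g ((\<Sum>(v, w)\<leftarrow>ps. \<phi> v w) - (\<Sum>(v, w)\<leftarrow>qs. \<phi> v w)) \<noteq> 0"
    using linear_functional_separates[OF _ ne, of "smul U"] U by (auto simp: is_space_def)
  interpret g: Vector_Spaces.linear "smul U" "(*)" g by (rule g(1))
  define B where "B = (\<lambda>v w. g (\<phi> v w))"
  have B: "bilinear_map V W base_field B"
    using bil by (auto simp: B_def bilinear_map_def linear_map_def base_field_def g.add g.scale)
  have ev: "(\<Sum>(v, w)\<leftarrow>rs. tens V W v w) B = g (\<Sum>(v, w)\<leftarrow>rs. \<phi> v w)" for rs
  proof (induction rs)
    case (Cons r rs)
    then show ?case by (cases r) (simp add: tens_def B g.add, simp add: B_def)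
  qed simp
  have "g (\<Sum>(v, w)\<leftarrow>ps. \<phi> v w) = g (\<Sum>(v, w)\<leftarrow>qs. \<phi> v w)"
    using arg_cong[OF eq, of "\<lambda>t. t B"] by (simp only: ev)
  with g(2) show False by (simp add: g.diff)
qed

lemma tensor_lift_eq:
  assumes "is_space U" "bilinear_map V W U \<phi>" "set ps \<subseteq> carr V \<times> carr W"
  shows "tensor_lift V W \<phi> (\<Sum>(v, w)\<leftarrow>ps. tens V W v w) = (\<Sum>(v, w)\<leftarrow>ps. \<phi> v w)"
  unfolding tensor_lift_def
proof (rule the_equality)
  show "\<exists>qs. set qs \<subseteq> carr V \<times> carr W \<and>
      (\<Sum>(v, w)\<leftarrow>ps. tens V W v w) = (\<Sum>(v, w)\<leftarrow>qs. tens V W v w) \<and>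
      (\<Sum>(v, w)\<leftarrow>ps. \<phi> v w) = (\<Sum>(v, w)\<leftarrow>qs. \<phi> v w)"
    using assms(3) by blast
next
  fix u
  assume "\<exists>qs. set qs \<subseteq> carr V \<times> carr W \<and>
      (\<Sum>(v, w)\<leftarrow>ps. tens V W v w) = (\<Sum>(v, w)\<leftarrow>qs. tens V W v w) \<and>
      u = (\<Sum>(v, w)\<leftarrow>qs. \<phi> v w)"
  then show "u = (\<Sum>(v, w)\<leftarrow>ps. \<phi> v w)"
    using tensor_lift_wd[OF assms(1,2,3)] by metis
qed

lemma tensor_lift_tens:
  assumes "is_space U" "bilinear_map V W U \<phi>" "v \<in> carr V" "w \<in> carr W"
  shows "tensor_lift V W \<phi> (tens V W v w) = \<phi> v w"
  using tensor_lift_eq[OF assms(1,2), of "[(v, w)]"] assms(3,4) by simp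

lemma tensor_lift_linear:
  fixes V :: "('k::field, 'v::ab_group_add, 'm) vspace_scheme"
    and W :: "('k, 'w::ab_group_add, 'l) vspace_scheme"
  assumes V: "is_space V" and U: "is_space U" and bil: "bilinear_map V W U \<phi>"
  shows "linear_map (tensor V W) U (tensor_lift V W \<phi>)"
proof -
  interpret V: vector_space "smul V" using V by (simp add: is_space_def)
  interpret U: vector_space "smul U" using U by (simp add: is_space_def)
  have sV: "V.subspace (carr V)" using V by (simp add: is_space_def)
  have sU: "U.subspace (carr U)" using U by (simp add: is_space_def)
  note lift = tensor_lift_eq[OF U bil]
  have carr: "(\<Sum>(v, w)\<leftarrow>ps. \<phi> v w) \<in> carr U" if "set ps \<subseteq> carr V \<times> carr W" for ps
    using that bil by (induction ps)
      (auto simp: U.subspace_0[OF sU] bilinear_map_def linear_map_def intro!: U.subspace_add[OF sU])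
  have scale: "\<exists>qs. set qs \<subseteq> carr V \<times> carr W \<and>
      tscale c (\<Sum>(v, w)\<leftarrow>ps. tens V W v w) = (\<Sum>(v, w)\<leftarrow>qs. tens V W v w) \<and>
      smul U c (\<Sum>(v, w)\<leftarrow>ps. \<phi> v w) = (\<Sum>(v, w)\<leftarrow>qs. \<phi> v w)"
    if "set ps \<subseteq> carr V \<times> carr W" for c ps
    using that
  proof (induction ps)
    case Nil
    show ?case by (rule exI[of _ "[]"]) (simp add: tscale_def fun_eq_iff)
  next
    case (Cons p ps)
    obtain v w where p: "p = (v, w)" by (cases p)
    obtain qs where qs: "set qs \<subseteq> carr V \<times> carr W"
      "tscale c (\<Sum>(v, w)\<leftarrow>ps. tens V W v w) = (\<Sum>(v, w)\<leftarrow>qs. tens V W v w)"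
      "smul U c (\<Sum>(v, w)\<leftarrow>ps. \<phi> v w) = (\<Sum>(v, w)\<leftarrow>qs. \<phi> v w)"
      using Cons by auto
    have vw: "v \<in> carr V" "w \<in> carr W" using Cons.prems p by auto
    have 1: "tscale c (tens V W v w) = tens V W (smul V c v) w"
      using vw by (auto simp: tens_def tscale_def base_field_def fun_eq_iff
          bilinear_map_def linear_map_def)
    have 2: "smul U c (\<phi> v w) = \<phi> (smul V c v) w"
      using vw bil by (simp add: bilinear_map_def linear_map_def)
    have 3: "tscale c (s + t) = tscale c s + tscale c t" for s t :: "('k, 'v, 'w) tensors"
      by (simp add: tscale_def fun_eq_iff distrib_left)
    have 4: "smul V c v \<in> carr V" using vw sV by (simp add: V.subspace_scale)
    have 5: "tscale c (\<Sum>(v, w)\<leftarrow>p # ps. tens V W v w)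
        = (\<Sum>(v, w)\<leftarrow>(smul V c v, w) # qs. tens V W v w)"
      unfolding p list.map sum_list.Cons prod.case 3 1 qs(2) ..
    show ?case
      using qs vw 4 5 by (intro exI[of _ "(smul V c v, w) # qs"])
        (simp del: plus_fun_apply add: p 2 U.scale_right_distrib)
  qed
  show ?thesis
    unfolding linear_map_def
  proof (intro conjI ballI allI)
    fix t assume "t \<in> carr (tensor V W)"
    then obtain ps where "set ps \<subseteq> carr V \<times> carr W" "t = (\<Sum>(v, w)\<leftarrow>ps. tens V W v w)"
      using tensor_list_sum[OF V] by blast
    then show "tensor_lift V W \<phi> t \<in> carr U" by (simp add: lift carr)
  next
    fix s t assume "s \<in> carr (tensor V W)" "t \<in> carr (tensor V W)"
    then obtain ps qs where
      ps: "set ps \<subseteq> carr V \<times> carr W" "s = (\<Sum>(v, w)\<leftarrow>ps. tens V W v w)" and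
      qs: "set qs \<subseteq> carr V \<times> carr W" "t = (\<Sum>(v, w)\<leftarrow>qs. tens V W v w)"
      using tensor_list_sum[OF V] by metis
    have st: "s + t = (\<Sum>(v, w)\<leftarrow>ps @ qs. tens V W v w)" by (simp add: ps qs)
    have "tensor_lift V W \<phi> (s + t) = (\<Sum>(v, w)\<leftarrow>ps @ qs. \<phi> v w)"
      unfolding st using ps(1) qs(1) by (intro lift) auto
    also have "\<dots> = tensor_lift V W \<phi> s + tensor_lift V W \<phi> t"
      unfolding ps(2) qs(2) by (simp add: lift[OF ps(1)] lift[OF qs(1)])
    finally show "tensor_lift V W \<phi> (s + t) = tensor_lift V W \<phi> s + tensor_lift V W \<phi> t" .
  next
    fix c t assume "t \<in> carr (tensor V W)"
    then obtain ps where ps: "set ps \<subseteq> carr V \<times> carr W" "t = (\<Sum>(v, w)\<leftarrow>ps. tens V W v w)"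
      using tensor_list_sum[OF V] by blast
    obtain qs where "set qs \<subseteq> carr V \<times> carr W"
      "tscale c t = (\<Sum>(v, w)\<leftarrow>qs. tens V W v w)"
      "smul U c (\<Sum>(v, w)\<leftarrow>ps. \<phi> v w) = (\<Sum>(v, w)\<leftarrow>qs. \<phi> v w)"
      using scale[OF ps(1)] ps(2) by blast
    then show "tensor_lift V W \<phi> (smul (tensor V W) c t) = smul U c (tensor_lift V W \<phi> t)"
      using ps by (simp add: tensor_def lift)
  qed
qed

section \<open>Algebras, Hopf algebras, comodules\<close>

definition is_algebra :: "('k::field, 'a::ring_1, 'm) vspace_scheme \<Rightarrow> bool" where
  "is_algebra A \<longleftrightarrow> is_space A \<and> carr A = UNIV \<and>
     (\<forall>c x y. smul A c x * y = smul A c (x * y) \<and> x * smul A c y = smul A c (x * y))"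

definition algebra_map ::
  "('k::field, 'a::ring_1, 'm) vspace_scheme \<Rightarrow> ('k, 'b::ring_1, 'l) vspace_scheme
     \<Rightarrow> ('a \<Rightarrow> 'b) \<Rightarrow> bool" where
  "algebra_map A B f \<longleftrightarrow> linear_map A B f \<and> f 1 = 1 \<and> (\<forall>x y. f (x * y) = f x * f y)"

definition tensor_mult ::
  "('k::field, 'a::ring_1, 'm) vspace_scheme \<Rightarrow> ('k, 'b::ring_1, 'l) vspace_scheme
     \<Rightarrow> ('k, 'a, 'b) tensors \<Rightarrow> ('k, 'a, 'b) tensors \<Rightarrow> ('k, 'a, 'b) tensors" where
  "tensor_mult A B s t =
     tensor_lift A B (\<lambda>a b. tensor_lift A B (\<lambda>a' b'. tens A B (a * a') (b * b')) t) s"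

text \<open>
  Unital algebra maps into the algebra \<open>tensor B C\<close>. Its product is \<open>tensor_mult\<close>; the
  pointwise product that the ambient function type inherits plays no role.
\<close>

definition algebra_map_tensor ::
  "('k::field, 'a::ring_1, 'm) vspace_scheme \<Rightarrow> ('k, 'b::ring_1, 'l) vspace_scheme
     \<Rightarrow> ('k, 'c::ring_1, 'p) vspace_scheme \<Rightarrow> ('a \<Rightarrow> ('k, 'b, 'c) tensors) \<Rightarrow> bool" where
  "algebra_map_tensor A B C f \<longleftrightarrow>
     linear_map A (tensor B C) f \<and> f 1 = tens B C 1 1 \<and>
     (\<forall>x y. f (x * y) = tensor_mult B C (f x) (f y))"

record ('k, 'a) hopf = "('k, 'a) vspace" +
  comult :: "'a \<Rightarrow> ('k, 'a, 'a) tensors"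
  counit :: "'a \<Rightarrow> 'k"
  antipode :: "'a \<Rightarrow> 'a"

definition bialgebra :: "('k::field, 'a::ring_1) hopf \<Rightarrow> bool" where
  "bialgebra H \<longleftrightarrow> is_algebra H \<and>
     algebra_map_tensor H H H (comult H) \<and>
     algebra_map H base_field (counit H) \<and>
     (\<forall>x. tensor_assoc H H H (tensor_map H H (tensor H H) H (comult H) id (comult H x))
          = tensor_map H H H (tensor H H) id (comult H) (comult H x)) \<and>
     (\<forall>x. tensor_lift H H (\<lambda>a b. smul H (counit H a) b) (comult H x) = x) \<and>
     (\<forall>x. tensor_lift H H (\<lambda>a b. smul H (counit H b) a) (comult H x) = x)"

definition hopf_algebra :: "('k::field, 'a::ring_1) hopf \<Rightarrow> bool" where
  "hopf_algebra H \<longleftrightarrow> bialgebra H \<and> linear_map H H (antipode H) \<and>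
     (\<forall>x. tensor_lift H H (\<lambda>a b. antipode H a * b) (comult H x) = smul H (counit H x) 1) \<and>
     (\<forall>x. tensor_lift H H (\<lambda>a b. a * antipode H b) (comult H x) = smul H (counit H x) 1)"

definition bialgebra_map ::
  "('k::field, 'a::ring_1) hopf \<Rightarrow> ('k, 'b::ring_1) hopf \<Rightarrow> ('a \<Rightarrow> 'b) \<Rightarrow> bool" where
  "bialgebra_map H L f \<longleftrightarrow> algebra_map H L f \<and>
     (\<forall>x. comult L (f x) = tensor_map H H L L f f (comult H x)) \<and>
     (\<forall>x. counit L (f x) = counit H x)"

definition comodule ::
  "('k::field, 'h::ring_1) hopf \<Rightarrow> ('k, 'v::ab_group_add, 'm) vspace_scheme
     \<Rightarrow> ('v \<Rightarrow> ('k, 'v, 'h) tensors) \<Rightarrow> bool" where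
  "comodule H V \<rho> \<longleftrightarrow> is_space V \<and> linear_map V (tensor V H) \<rho> \<and>
     (\<forall>x\<in>carr V. tensor_assoc V H H (tensor_map V H (tensor V H) H \<rho> id (\<rho> x))
                = tensor_map V H V (tensor H H) id (comult H) (\<rho> x)) \<and>
     (\<forall>x\<in>carr V. tensor_lift V H (\<lambda>v h. smul V (counit H h) v) (\<rho> x) = x)"

text \<open>A subcomodule \<open>N\<close> of \<open>(V, \<rho>)\<close>: \<open>\<rho>\<close> maps it into the image of
  the tensor product of \<open>N\<close> and \<open>H\<close> in \<open>tensor V H\<close>.\<close>

definition subcomodule ::
  "('k::field, 'h::ring_1) hopf \<Rightarrow> ('k, 'v::ab_group_add, 'm) vspace_scheme
     \<Rightarrow> ('v \<Rightarrow> ('k, 'v, 'h) tensors) \<Rightarrow> 'v set \<Rightarrow> bool" where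
  "subcomodule H V \<rho> N \<longleftrightarrow> module.subspace (smul V) N \<and> N \<subseteq> carr V \<and>
     (\<forall>x\<in>N. \<rho> x \<in> module.span tscale {tens V H v h | v h. v \<in> N \<and> h \<in> carr H})"

definition simple_subcomodule ::
  "('k::field, 'h::ring_1) hopf \<Rightarrow> ('k, 'v::ab_group_add, 'm) vspace_scheme
     \<Rightarrow> ('v \<Rightarrow> ('k, 'v, 'h) tensors) \<Rightarrow> 'v set \<Rightarrow> bool" where
  "simple_subcomodule H V \<rho> N \<longleftrightarrow> subcomodule H V \<rho> N \<and> N \<noteq> {0} \<and>
     (\<forall>N'. subcomodule H V \<rho> N' \<and> N' \<subseteq> N \<longrightarrow> N' = {0} \<or> N' = N)"

text \<open>The internal direct sum of a family of simple subcomodules.\<close>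

definition semisimple_comodule ::
  "('k::field, 'h::ring_1) hopf \<Rightarrow> ('k, 'v::ab_group_add, 'm) vspace_scheme
     \<Rightarrow> ('v \<Rightarrow> ('k, 'v, 'h) tensors) \<Rightarrow> bool" where
  "semisimple_comodule H V \<rho> \<longleftrightarrow>
     (\<exists>\<S>. (\<forall>N\<in>\<S>. simple_subcomodule H V \<rho> N) \<and>
          module.span (smul V) (\<Union>\<S>) = carr V \<and>
          (\<forall>N\<in>\<S>. N \<inter> module.span (smul V) (\<Union>(\<S> - {N})) = {0}))"

text \<open>
  Every comodule living in the type \<open>'v\<close> is semisimple. HOL cannot quantify over the type
  \<open>'v\<close> inside a formula. As a conclusion, \<open>cosemisimple TYPE('v) H\<close> with \<open>'v\<close>
  free covers all comodules. As a hypothesis on a Hopf algebra \<open>H\<close> over the type \<open>'h\<close> it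
  is used with \<open>'v = (nat \<Rightarrow> 'h)\<close>, which loses nothing: every comodule is the union of its
  finite-dimensional subcomodules, every finite-dimensional vector space is isomorphic to a
  subspace of \<open>nat \<Rightarrow> 'h\<close>, and all comodules are semisimple as soon as the
  finite-dimensional ones are.
\<close>

definition cosemisimple ::
  "'v::ab_group_add itself \<Rightarrow> ('k::field, 'h::ring_1) hopf \<Rightarrow> bool" where
  "cosemisimple T H \<longleftrightarrow>
     (\<forall>(V :: ('k, 'v) vspace) \<rho>. comodule H V \<rho> \<longrightarrow> semisimple_comodule H V \<rho>)"

definition coaction ::
  "('k::field, 'h::ring_1) hopf \<Rightarrow> ('k, 'a::ring_1, 'm) vspace_scheme
     \<Rightarrow> ('a \<Rightarrow> ('k, 'a, 'h) tensors) \<Rightarrow> bool" where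
  "coaction H A \<beta> \<longleftrightarrow> comodule H A \<beta> \<and> algebra_map_tensor A A H \<beta>"

section \<open>The diagonal algebra\<close>

text \<open>The product of \<open>'k ^ 'n\<close> is componentwise; \<open>axis i 1\<close> is the
  \<open>i\<close>-th canonical basis vector.\<close>

definition diag_algebra :: "('k::field, 'k ^ 'n) vspace" where
  "diag_algebra = \<lparr>carr = UNIV, smul = (*s)\<rparr>"

section \<open>The free algebra and the quantum permutation algebra\<close>

datatype 'x free_word = Word "'x list"

instantiation free_word :: (type) monoid_add
begin

definition zero_free_word :: "'x free_word" where "zero_free_word = Word []"

fun plus_free_word :: "'x free_word \<Rightarrow> 'x free_word \<Rightarrow> 'x free_word" where
  "plus_free_word (Word xs) (Word ys) = Word (xs @ ys)"

instance
proof
  fix a b c :: "'x free_word"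
  show "a + b + c = a + (b + c)" by (cases a; cases b; cases c) simp
  show "0 + a = a" by (cases a) (simp add: zero_free_word_def)
  show "a + 0 = a" by (cases a) (simp add: zero_free_word_def)
qed

end

text \<open>Monoid algebra of the free monoid: the free unital algebra on \<open>'x\<close>.\<close>

type_synonym ('k, 'x) free_algebra = "'x free_word \<Rightarrow>\<^sub>0 'k"

definition gen :: "'x \<Rightarrow> ('k::field, 'x) free_algebra" where
  "gen x = Poly_Mapping.single (Word [x]) 1"

definition qperm_relations :: "('k::field, 'n::finite \<times> 'n) free_algebra set" where
  "qperm_relations =
     {gen (k, i) * gen (k, j) - (if i = j then gen (k, i) else 0) | i j k. True} \<union>
     {(\<Sum>l\<in>UNIV. gen (i, l)) - 1 | i. True} \<union>
     {gen (i, k) * gen (j, k) - (if i = j then gen (i, k) else 0) | i j k. True} \<union>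
     {(\<Sum>l\<in>UNIV. gen (l, i)) - 1 | i. True}"

text \<open>The two-sided ideal generated by the relations; closed under scalars because the scalars
  are the multiples of the empty word.\<close>

inductive_set qperm_ideal :: "('k::field, 'n::finite \<times> 'n) free_algebra set" where
  zero: "0 \<in> qperm_ideal"
| add: "x \<in> qperm_ideal \<Longrightarrow> y \<in> qperm_ideal \<Longrightarrow> x + y \<in> qperm_ideal"
| rel: "r \<in> qperm_relations \<Longrightarrow> a * r * b \<in> qperm_ideal"

lemma qperm_ideal_mult: "x \<in> qperm_ideal \<Longrightarrow> a * x * b \<in> qperm_ideal"
proof (induction rule: qperm_ideal.induct)
  case zero
  then show ?case by (simp add: qperm_ideal.zero)
next
  case (add x y)
  then show ?case by (simp add: distrib_left distrib_right qperm_ideal.add)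
next
  case (rel r c d)
  have "a * (c * r * d) * b = (a * c) * r * (d * b)" by (simp add: mult.assoc)
  then show ?case using qperm_ideal.rel[OF rel] by metis
qed

lemma qperm_ideal_mult_left: "x \<in> qperm_ideal \<Longrightarrow> a * x \<in> qperm_ideal"
  using qperm_ideal_mult[of x a 1] by simp

lemma qperm_ideal_mult_right: "x \<in> qperm_ideal \<Longrightarrow> x * b \<in> qperm_ideal"
  using qperm_ideal_mult[of x 1 b] by simp

lemma qperm_ideal_uminus: "x \<in> qperm_ideal \<Longrightarrow> - x \<in> qperm_ideal"
  using qperm_ideal_mult_left[of x "- 1"] by simp

definition qperm_rel ::
  "('k::field, 'n::finite \<times> 'n) free_algebra \<Rightarrow> ('k, 'n \<times> 'n) free_algebra \<Rightarrow> bool" where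
  "qperm_rel x y \<longleftrightarrow> x - y \<in> qperm_ideal"

lemma equivp_qperm_rel: "equivp (qperm_rel :: ('k::field, 'n::finite \<times> 'n) free_algebra \<Rightarrow> _)"
proof (rule equivpI)
  show "reflp (qperm_rel :: ('k, 'n \<times> 'n) free_algebra \<Rightarrow> _)"
    by (simp add: reflp_def qperm_rel_def qperm_ideal.zero)
  show "symp (qperm_rel :: ('k, 'n \<times> 'n) free_algebra \<Rightarrow> _)"
    by (metis sympI qperm_rel_def qperm_ideal_uminus minus_diff_eq)
  show "transp (qperm_rel :: ('k, 'n \<times> 'n) free_algebra \<Rightarrow> _)"
  proof (rule transpI)
    fix x y z :: "('k, 'n \<times> 'n) free_algebra"
    assume "qperm_rel x y" "qperm_rel y z"
    then have "(x - y) + (y - z) \<in> qperm_ideal"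
      unfolding qperm_rel_def by (rule qperm_ideal.add)
    then show "qperm_rel x z" by (simp add: qperm_rel_def)
  qed
qed

text \<open>The counit on the free algebra, used to see that the quotient is nonzero.\<close>

definition word_counit :: "('n \<times> 'n) free_word \<Rightarrow> 'k::field" where
  "word_counit w = (case w of Word xs \<Rightarrow> if \<forall>(i, j)\<in>set xs. i = j then 1 else 0)"

definition free_counit :: "('k::field, 'n \<times> 'n) free_algebra \<Rightarrow> 'k" where
  "free_counit p = (\<Sum>w\<in>Poly_Mapping.keys p. Poly_Mapping.lookup p w * word_counit w)"

lemma free_counit_superset:
  assumes "finite A" "Poly_Mapping.keys p \<subseteq> A"
  shows "free_counit p = (\<Sum>w\<in>A. Poly_Mapping.lookup p w * word_counit w)"
  unfolding free_counit_def using assms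
  by (intro sum.mono_neutral_left) (auto simp: in_keys_iff)

lemma free_counit_add: "free_counit (p + q) = free_counit p + free_counit q"
proof -
  let ?A = "Poly_Mapping.keys p \<union> Poly_Mapping.keys q"
  have "Poly_Mapping.keys (p + q) \<subseteq> ?A" by (rule Poly_Mapping.keys_add)
  then show ?thesis
    by (simp add: free_counit_superset[of ?A] lookup_add sum.distrib distrib_right)
qed

lemma free_counit_single: "free_counit (Poly_Mapping.single w c) = c * word_counit w"
  by (subst free_counit_superset[of "{w}"]) auto

lemma word_counit_add: "word_counit (v + w) = (word_counit v * word_counit w :: 'k::field)"
  by (cases v; cases w) (auto simp: word_counit_def)

lemma free_algebra_induct [case_names single add]:
  assumes "\<And>w c. P (Poly_Mapping.single w c)" "\<And>p q. P p \<Longrightarrow> P q \<Longrightarrow> P (p + q)"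
  shows "P (p :: ('k::field, 'x) free_algebra)"
proof (induction p rule: Poly_Mapping.update_induct)
  case const
  then show ?case using assms(1)[of 0 0] by simp
next
  case (update f a b)
  have "Poly_Mapping.update a b f = Poly_Mapping.single a b + f"
    using update(1) by (intro poly_mapping_eqI)
      (auto simp: lookup_update lookup_add lookup_single in_keys_iff when_def)
  then show ?case using assms(2)[OF assms(1) update(3)] by simp
qed

lemma free_counit_mult: "free_counit (p * q) = free_counit p * free_counit q"
proof (induction p rule: free_algebra_induct)
  case (single v c)
  show ?case
    by (induction q rule: free_algebra_induct)
       (auto simp: mult_single free_counit_single free_counit_add word_counit_add distrib_left)
next
  case (add p p')
  then show ?case by (simp add: distrib_right free_counit_add)
qed

lemma free_counit_zero: "free_counit 0 = 0"
  by (simp add: free_counit_def)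

lemma free_counit_one: "free_counit 1 = 1"
  unfolding single_one[symmetric] free_counit_single
  by (simp add: word_counit_def zero_free_word_def)

lemma free_counit_gen: "free_counit (gen (i, j)) = (if i = j then 1 else 0)"
  by (simp add: gen_def free_counit_single word_counit_def)

lemma free_counit_diff: "free_counit (p - q) = free_counit p - free_counit q"
  using free_counit_add[of "p - q" q] by simp

lemma free_counit_sum: "free_counit (\<Sum>i\<in>A. f i) = (\<Sum>i\<in>A. free_counit (f i))"
  by (induction A rule: infinite_finite_induct) (auto simp: free_counit_zero free_counit_add)

lemma free_counit_ideal: "x \<in> qperm_ideal \<Longrightarrow> free_counit x = 0"
proof (induction rule: qperm_ideal.induct)
  case (rel r a b)
  then have "free_counit r = 0"
    by (auto simp: qperm_relations_def free_counit_diff free_counit_mult free_counit_sum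
        free_counit_gen free_counit_one free_counit_zero)
  then show ?case by (simp add: free_counit_mult)
qed (auto simp: free_counit_zero free_counit_add)

quotient_type (overloaded) ('k, 'n) qperm_algebra =
  "('k::field, 'n::finite \<times> 'n) free_algebra" / qperm_rel
  by (rule equivp_qperm_rel)

instantiation qperm_algebra :: (field, finite) ring_1
begin

lift_definition zero_qperm_algebra :: "('a, 'b) qperm_algebra" is 0 .
lift_definition one_qperm_algebra :: "('a, 'b) qperm_algebra" is 1 .

lift_definition plus_qperm_algebra ::
  "('a, 'b) qperm_algebra \<Rightarrow> ('a, 'b) qperm_algebra \<Rightarrow> ('a, 'b) qperm_algebra" is "(+)"
proof -
  fix p p' q q' :: "('a, 'b \<times> 'b) free_algebra"
  assume "qperm_rel p p'" "qperm_rel q q'"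
  then have "(p - p') + (q - q') \<in> qperm_ideal"
    unfolding qperm_rel_def by (rule qperm_ideal.add)
  then show "qperm_rel (p + q) (p' + q')" by (simp add: qperm_rel_def algebra_simps)
qed

lift_definition uminus_qperm_algebra ::
  "('a, 'b) qperm_algebra \<Rightarrow> ('a, 'b) qperm_algebra" is uminus
  unfolding qperm_rel_def by (metis qperm_ideal_uminus minus_diff_minus)

lift_definition minus_qperm_algebra ::
  "('a, 'b) qperm_algebra \<Rightarrow> ('a, 'b) qperm_algebra \<Rightarrow> ('a, 'b) qperm_algebra" is "(-)"
proof -
  fix p p' q q' :: "('a, 'b \<times> 'b) free_algebra"
  assume "qperm_rel p p'" "qperm_rel q q'"
  then have "(p - p') + - (q - q') \<in> qperm_ideal"
    unfolding qperm_rel_def by (intro qperm_ideal.add qperm_ideal_uminus)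
  then show "qperm_rel (p - q) (p' - q')" by (simp add: qperm_rel_def algebra_simps)
qed

lift_definition times_qperm_algebra ::
  "('a, 'b) qperm_algebra \<Rightarrow> ('a, 'b) qperm_algebra \<Rightarrow> ('a, 'b) qperm_algebra" is "(*)"
proof -
  fix p p' q q' :: "('a, 'b \<times> 'b) free_algebra"
  assume "qperm_rel p p'" "qperm_rel q q'"
  then have "(p - p') * q + p' * (q - q') \<in> qperm_ideal"
    unfolding qperm_rel_def
    by (intro qperm_ideal.add qperm_ideal_mult_left qperm_ideal_mult_right)
  then show "qperm_rel (p * q) (p' * q')" by (simp add: qperm_rel_def algebra_simps)
qed

instance
proof
  fix a b c :: "('a, 'b) qperm_algebra"
  note R = equivp_reflp[OF equivp_qperm_rel]
  show "a * b * c = a * (b * c)" by transfer (simp add: mult.assoc R)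
  show "a + b + c = a + (b + c)" by transfer (simp add: add.assoc R)
  show "a + b = b + a" by transfer (simp add: add.commute R)
  show "0 + a = a" by transfer (simp add: R)
  show "- a + a = 0" by transfer (simp add: R)
  show "a - b = a + - b" by transfer (simp add: R)
  show "1 * a = a" by transfer (simp add: R)
  show "a * 1 = a" by transfer (simp add: R)
  show "(a + b) * c = a * c + b * c" by transfer (simp add: distrib_right R)
  show "a * (b + c) = a * b + a * c" by transfer (simp add: distrib_left R)
  show "(0 :: ('a, 'b) qperm_algebra) \<noteq> 1"
  proof transfer
    show "\<not> qperm_rel (0 :: ('a, 'b \<times> 'b) free_algebra) 1"
    proof
      assume "qperm_rel (0 :: ('a, 'b \<times> 'b) free_algebra) 1"
      then have "free_counit (0 - 1 :: ('a, 'b \<times> 'b) free_algebra) = 0"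
        unfolding qperm_rel_def by (rule free_counit_ideal)
      then show False
        unfolding free_counit_diff free_counit_zero free_counit_one by simp
    qed
  qed
qed

end

lift_definition qperm_scale ::
  "'k::field \<Rightarrow> ('k, 'n::finite) qperm_algebra \<Rightarrow> ('k, 'n) qperm_algebra"
  is "\<lambda>c p. Poly_Mapping.single 0 c * p"
  unfolding qperm_rel_def by (metis qperm_ideal_mult_left right_diff_distrib)

lift_definition qperm_gen :: "'n::finite \<Rightarrow> 'n \<Rightarrow> ('k::field, 'n) qperm_algebra"
  is "\<lambda>i j. gen (i, j)" .

definition qperm_space :: "('k::field, ('k, 'n::finite) qperm_algebra) vspace" where
  "qperm_space = \<lparr>carr = UNIV, smul = qperm_scale\<rparr>"

text \<open>The structure maps are the algebra maps, respectively the algebra antimorphism, with the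
  prescribed values on the generators.\<close>

definition qperm_comult ::
  "('k::field, 'n::finite) qperm_algebra
     \<Rightarrow> ('k, ('k, 'n) qperm_algebra, ('k, 'n) qperm_algebra) tensors" where
  "qperm_comult = (THE D. algebra_map_tensor qperm_space qperm_space qperm_space D \<and>
     (\<forall>i j. D (qperm_gen i j) =
        (\<Sum>k\<in>UNIV. tens qperm_space qperm_space (qperm_gen i k) (qperm_gen k j))))"

definition qperm_counit :: "('k::field, 'n::finite) qperm_algebra \<Rightarrow> 'k" where
  "qperm_counit = (THE e. algebra_map qperm_space base_field e \<and>
     (\<forall>i j. e (qperm_gen i j) = (if i = j then 1 else 0)))"

definition qperm_antipode ::
  "('k::field, 'n::finite) qperm_algebra \<Rightarrow> ('k, 'n) qperm_algebra" where
  "qperm_antipode = (THE S. linear_map qperm_space qperm_space S \<and> S 1 = 1 \<and>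
     (\<forall>x y. S (x * y) = S y * S x) \<and> (\<forall>i j. S (qperm_gen i j) = qperm_gen j i))"

definition qperm :: "('k::field, ('k, 'n::finite) qperm_algebra) hopf" where
  "qperm = \<lparr>carr = UNIV, smul = qperm_scale,
     comult = qperm_comult, counit = qperm_counit, antipode = qperm_antipode\<rparr>"

text \<open>The canonical coaction, extended linearly from the basis vectors.\<close>

definition qperm_coaction ::
  "'k::field ^ 'n::finite \<Rightarrow> ('k, 'k ^ 'n, ('k, 'n) qperm_algebra) tensors" where
  "qperm_coaction x = (\<Sum>i\<in>UNIV. tscale (x $ i)
     (\<Sum>k\<in>UNIV. tens diag_algebra qperm (axis k 1) (qperm_gen k i)))"

end

theory Submission
  imports Defs
begin

text \<open>
  The entries of the tensor powers of the fundamental matrix \<open>u\<close> span \<open>A\<^sub>s(n)\<close>, and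
  they multiply and comultiply by explicit formulas, so all identities are checked on them.

  Cosemisimplicity: the defining relations say exactly that merging two adjacent tensor factors,
  inserting the unit vector, and the transposes of these maps are intertwiners. Let \<open>P\<^sub>k\<close> be the
  orthogonal projection, over the ordered field of rationals, onto the rational vectors fixed by the
  \<open>k\<close>-th tensor power of \<open>u\<close>. The \<open>P\<^sub>k\<close> commute with the four intertwiners, hence their entries define
  a linear functional on the quotient by the relations: the Haar functional. It makes the coalgebra
  coseparable, and Maschke averaging splits every comodule.

  Universality: the matrix \<open>x\<close> of a coaction on \<open>K\<^sup>n\<close> satisfies the row relations. By
  semisimplicity there are enough invariant functionals on \<open>K\<^sup>n\<close> to show that the inverse matrix
  \<open>S(x)\<close> is the transpose of \<open>x\<close>, and this gives the column relations.
\<close>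

text \<open>The obstacle to a Haar functional is the choice, for each tensor power, of a projection
  onto invariants that is compatible with all defining relations at once. An orthogonal projection
  commutes with every matrix that preserves invariants together with its transpose, but over a field
  containing a square root of \<open>-1\<close> the standard form has isotropic vectors. The
  intertwiners have entries 0 and 1, so the projections can be taken over the rationals and moved to
  the base field by \<open>of_rat\<close>; characteristic zero enters here. Symmetry of the
  projections also turns statements on rows into statements on columns. In the universal property
  the difficulty is one-sided information: multiplicativity of a coaction constrains products within
  one row of \<open>x\<close>, and the columns are reached through the antipode, whose values on
  \<open>x\<close> are unknown at first. An invariant functional with nonzero coordinate at
  \<open>i\<close> compares \<open>S(x i l)\<close> with \<open>x l i\<close>. Tensors are functions
  here, so the pointwise simplification rules for sums are switched off.\<close>

declare plus_fun_apply [simp del] zero_fun_apply [simp del]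


section \<open>Linear and bilinear maps\<close>

lemma space_zero: "is_space V \<Longrightarrow> 0 \<in> carr V"
  unfolding is_space_def by (metis module.subspace_0 module_iff_vector_space)

lemma space_add: "is_space V \<Longrightarrow> x \<in> carr V \<Longrightarrow> y \<in> carr V \<Longrightarrow> x + y \<in> carr V"
  unfolding is_space_def by (metis module.subspace_add module_iff_vector_space)

lemma space_diff: "is_space V \<Longrightarrow> x \<in> carr V \<Longrightarrow> y \<in> carr V \<Longrightarrow> x - y \<in> carr V"
  unfolding is_space_def by (metis module.subspace_diff module_iff_vector_space)

lemma space_scale: "is_space V \<Longrightarrow> x \<in> carr V \<Longrightarrow> smul V c x \<in> carr V"
  unfolding is_space_def by (metis module.subspace_scale module_iff_vector_space)

lemma space_sum: "is_space V \<Longrightarrow> (\<And>i. i \<in> I \<Longrightarrow> g i \<in> carr V) \<Longrightarrow> sum g I \<in> carr V"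
  by (induction I rule: infinite_finite_induct) (auto simp: space_zero space_add)

lemma space_vs: "is_space V \<Longrightarrow> vector_space (smul V)"
  by (simp add: is_space_def)

lemma space_subspace: "is_space V \<Longrightarrow> module.subspace (smul V) (carr V)"
  by (simp add: is_space_def)

lemma space_smul_simps:
  assumes "is_space V"
  shows "smul V c (x + y) = smul V c x + smul V c y" "smul V (a + b) x = smul V a x + smul V b x"
    "smul V a (smul V b x) = smul V (a * b) x" "smul V 1 x = x" "smul V 0 x = 0" "smul V c 0 = 0"
    "smul V c (sum g I) = (\<Sum>i\<in>I. smul V c (g i))" "smul V (sum h I) x = (\<Sum>i\<in>I. smul V (h i) x)"
    "smul V c (x - y) = smul V c x - smul V c y"
proof -
  interpret vector_space "smul V" using assms by (rule space_vs)
  show "smul V c (x + y) = smul V c x + smul V c y" "smul V (a + b) x = smul V a x + smul V b x"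
    "smul V a (smul V b x) = smul V (a * b) x" "smul V 1 x = x" "smul V 0 x = 0" "smul V c 0 = 0"
    "smul V c (sum g I) = (\<Sum>i\<in>I. smul V c (g i))" "smul V (sum h I) x = (\<Sum>i\<in>I. smul V (h i) x)"
    "smul V c (x - y) = smul V c x - smul V c y"
    by (auto simp: algebra_simps scale_sum_right scale_sum_left)
qed

lemma space_smul_eq_0: "is_space V \<Longrightarrow> smul V c x = 0 \<longleftrightarrow> c = 0 \<or> x = 0"
  using vector_space.scale_eq_0_iff[OF space_vs] .

lemma is_space_base_field: "is_space base_field"
proof -
  have "vector_space ((*) :: 'a \<Rightarrow> 'a \<Rightarrow> 'a::field)"
    by (rule vector_space_over_itself.vector_space_axioms)
  then show ?thesis
    unfolding is_space_def base_field_def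
    by (auto simp: module.subspace_def module_iff_vector_space)
qed

lemma base_field_simps [simp]: "carr base_field = UNIV" "smul base_field = (*)"
  by (simp_all add: base_field_def)

lemma linear_mapI:
  assumes "\<And>x. x \<in> carr V \<Longrightarrow> f x \<in> carr W"
    and "\<And>x y. x \<in> carr V \<Longrightarrow> y \<in> carr V \<Longrightarrow> f (x + y) = f x + f y"
    and "\<And>c x. x \<in> carr V \<Longrightarrow> f (smul V c x) = smul W c (f x)"
  shows "linear_map V W f"
  using assms by (simp add: linear_map_def)

lemma linear_map_in: "linear_map V W f \<Longrightarrow> x \<in> carr V \<Longrightarrow> f x \<in> carr W"
  by (simp add: linear_map_def)

lemma linear_map_add:
  "linear_map V W f \<Longrightarrow> x \<in> carr V \<Longrightarrow> y \<in> carr V \<Longrightarrow> f (x + y) = f x + f y"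
  by (simp add: linear_map_def)

lemma linear_map_scale:
  "linear_map V W f \<Longrightarrow> x \<in> carr V \<Longrightarrow> f (smul V c x) = smul W c (f x)"
  by (simp add: linear_map_def)

lemma linear_map_zero: "linear_map V W f \<Longrightarrow> is_space V \<Longrightarrow> f 0 = 0"
  using linear_map_add[of V W f 0 0] by (simp add: space_zero)

lemma linear_map_diff:
  assumes "linear_map V W f" "is_space V" "x \<in> carr V" "y \<in> carr V"
  shows "f (x - y) = f x - f y"
  using linear_map_add[OF assms(1), of "x - y" y] assms by (simp add: space_diff)

lemma linear_map_sum:
  assumes "linear_map V W f" "is_space V" "\<And>i. i \<in> I \<Longrightarrow> g i \<in> carr V"
  shows "f (\<Sum>i\<in>I. g i) = (\<Sum>i\<in>I. f (g i))"
  using assms(3)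
proof (induction I rule: infinite_finite_induct)
  case (insert i I)
  then show ?case
    using linear_map_add[OF assms(1), of "g i" "sum g I"] assms(2) by (simp add: space_sum)
qed (simp_all add: linear_map_zero[OF assms(1,2)])

lemma linear_map_id: "linear_map V V (\<lambda>x. x)" "linear_map V V id"
  by (simp_all add: linear_map_def)

lemma linear_map_comp:
  "linear_map V W f \<Longrightarrow> linear_map W U g \<Longrightarrow> linear_map V U (\<lambda>x. g (f x))"
  by (simp add: linear_map_def)

lemma linear_map_plus:
  assumes "is_space W" "linear_map V W f" "linear_map V W g"
  shows "linear_map V W (\<lambda>x. f x + g x)"
  using assms by (simp add: linear_map_def space_add space_smul_simps(1) add_ac)

lemma linear_map_sum_fun:
  assumes "is_space W" "\<And>i. i \<in> I \<Longrightarrow> linear_map V W (f i)"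
  shows "linear_map V W (\<lambda>x. \<Sum>i\<in>I. f i x)"
  using assms by (simp add: linear_map_def space_sum sum.distrib space_smul_simps)

lemma linear_map_smul:
  "is_space W \<Longrightarrow> linear_map V W f \<Longrightarrow> linear_map V W (\<lambda>x. smul W c (f x))"
  by (simp add: linear_map_def space_scale space_smul_simps mult.commute)

lemma linear_map_smul_left:
  "is_space W \<Longrightarrow> linear_map V base_field f \<Longrightarrow> w \<in> carr W \<Longrightarrow> linear_map V W (\<lambda>x. smul W (f x) w)"
  by (simp add: linear_map_def space_scale space_smul_simps)

lemma bilinear_mapI:
  assumes "\<And>v. v \<in> carr V \<Longrightarrow> linear_map W U (\<phi> v)"
    and "\<And>w. w \<in> carr W \<Longrightarrow> linear_map V U (\<lambda>v. \<phi> v w)"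
  shows "bilinear_map V W U \<phi>"
  using assms by (simp add: bilinear_map_def)

lemma bilinear_right: "bilinear_map V W U \<phi> \<Longrightarrow> v \<in> carr V \<Longrightarrow> linear_map W U (\<phi> v)"
  by (simp add: bilinear_map_def)

lemma bilinear_left: "bilinear_map V W U \<phi> \<Longrightarrow> w \<in> carr W \<Longrightarrow> linear_map V U (\<lambda>v. \<phi> v w)"
  by (simp add: bilinear_map_def)

lemma bilinear_in:
  "bilinear_map V W U \<phi> \<Longrightarrow> v \<in> carr V \<Longrightarrow> w \<in> carr W \<Longrightarrow> \<phi> v w \<in> carr U"
  by (simp add: bilinear_map_def linear_map_def)

lemma bilinear_comp:
  assumes "bilinear_map V W U \<phi>" "linear_map V' V f" "linear_map W' W g" "linear_map U U' k"
  shows "bilinear_map V' W' U' (\<lambda>v w. k (\<phi> (f v) (g w)))"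
  using assms by (simp add: bilinear_map_def linear_map_def)

section \<open>Calculus of tensors\<close>

lemma smul_tensor [simp]: "smul (tensor V W) = tscale"
  by (simp add: tensor_def)

lemma tens_in:
  "is_space V \<Longrightarrow> is_space W \<Longrightarrow> v \<in> carr V \<Longrightarrow> w \<in> carr W \<Longrightarrow> tens V W v w \<in> carr (tensor V W)"
  using bilinear_tens bilinear_in by blast

lemma linear_tens_right:
  "is_space V \<Longrightarrow> is_space W \<Longrightarrow> v \<in> carr V \<Longrightarrow> linear_map W (tensor V W) (tens V W v)"
  using bilinear_tens bilinear_right by blast

lemma linear_tens_left:
  "is_space V \<Longrightarrow> is_space W \<Longrightarrow> w \<in> carr W \<Longrightarrow> linear_map V (tensor V W) (\<lambda>v. tens V W v w)"
  using bilinear_tens bilinear_left by blast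

lemma tens_sum_right:
  assumes "is_space V" "is_space W" "v \<in> carr V" "\<And>i. i \<in> I \<Longrightarrow> g i \<in> carr W"
  shows "tens V W v (\<Sum>i\<in>I. g i) = (\<Sum>i\<in>I. tens V W v (g i))"
  by (intro linear_map_sum[OF linear_tens_right]) (use assms in auto)

lemma tens_sum_left:
  assumes "is_space V" "is_space W" "w \<in> carr W" "\<And>i. i \<in> I \<Longrightarrow> g i \<in> carr V"
  shows "tens V W (\<Sum>i\<in>I. g i) w = (\<Sum>i\<in>I. tens V W (g i) w)"
  by (rule linear_map_sum[OF linear_tens_left]) (use assms in auto)

lemma tens_scale_right:
  assumes "is_space V" "is_space W" "v \<in> carr V" "w \<in> carr W"
  shows "tens V W v (smul W c w) = tscale c (tens V W v w)"
  using linear_map_scale[OF linear_tens_right[OF assms(1,2,3)], of w c] assms by simp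

lemma tens_scale_left:
  assumes "is_space V" "is_space W" "v \<in> carr V" "w \<in> carr W"
  shows "tens V W (smul V c v) w = tscale c (tens V W v w)"
  using linear_map_scale[OF linear_tens_left[OF assms(1,2,4)], of v c] assms by simp

lemma tens_zero_right: "is_space V \<Longrightarrow> is_space W \<Longrightarrow> v \<in> carr V \<Longrightarrow> tens V W v 0 = 0"
  by (rule linear_map_zero[OF linear_tens_right])

lemma tens_zero_left: "is_space V \<Longrightarrow> is_space W \<Longrightarrow> w \<in> carr W \<Longrightarrow> tens V W 0 w = 0"
  using linear_map_zero[OF linear_tens_left] by blast

text \<open>There is no case for scalars, because a scalar multiple of a pure tensor is pure, and
  none for zero, because \<open>0\<close> is the pure tensor of \<open>0\<close> and
  \<open>0\<close>.\<close>

lemma tensor_induct [consumes 1, case_names space_left space_right tens add]: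
  assumes t: "t \<in> carr (tensor V W)" and V: "is_space V" and W: "is_space W"
    and tens: "\<And>v w. v \<in> carr V \<Longrightarrow> w \<in> carr W \<Longrightarrow> Q (tens V W v w)"
    and add: "\<And>s t. s \<in> carr (tensor V W) \<Longrightarrow> t \<in> carr (tensor V W) \<Longrightarrow> Q s \<Longrightarrow> Q t \<Longrightarrow> Q (s + t)"
  shows "Q t"
proof -
  obtain ps where ps: "set ps \<subseteq> carr V \<times> carr W" and t': "t = (\<Sum>(v, w)\<leftarrow>ps. tens V W v w)"
    using tensor_list_sum[OF V t] by blast
  have "(\<Sum>(v, w)\<leftarrow>ps. tens V W v w) \<in> carr (tensor V W) \<and> Q (\<Sum>(v, w)\<leftarrow>ps. tens V W v w)"
    using ps
  proof (induction ps)
    case Nil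
    have "tens V W 0 0 = 0" using V W by (simp add: tens_zero_left space_zero)
    then show ?case
      using tens[of 0 0] V W by (simp add: space_zero is_space_tensor)
  next
    case (Cons p ps)
    then obtain v w where p: "p = (v, w)" "v \<in> carr V" "w \<in> carr W" by (cases p) auto
    have "tens V W v w + (\<Sum>(v, w)\<leftarrow>ps. tens V W v w) \<in> carr (tensor V W)
        \<and> Q (tens V W v w + (\<Sum>(v, w)\<leftarrow>ps. tens V W v w))"
      using Cons p V W by (intro conjI space_add is_space_tensor add tens tens_in) auto
    then show ?case unfolding p list.map sum_list.Cons prod.case .
  qed
  then show ?thesis using t' by simp
qed

lemma tensor_eqI:
  assumes "is_space V" "is_space W"
    and F: "linear_map (tensor V W) U F" and G: "linear_map (tensor V W) U G"
    and eq: "\<And>v w. v \<in> carr V \<Longrightarrow> w \<in> carr W \<Longrightarrow> F (tens V W v w) = G (tens V W v w)"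
    and t: "t \<in> carr (tensor V W)"
  shows "F t = G t"
  using t
proof (induction rule: tensor_induct)
  case (add s t)
  then show ?case using linear_map_add[OF F] linear_map_add[OF G] by metis
qed (simp_all add: assms)

lemma tensor_lift_sum:
  assumes "is_space V" "is_space W" "is_space U" "bilinear_map V W U \<phi>"
    and "\<And>i. i \<in> I \<Longrightarrow> a i \<in> carr V" "\<And>i. i \<in> I \<Longrightarrow> b i \<in> carr W"
  shows "tensor_lift V W \<phi> (\<Sum>i\<in>I. tens V W (a i) (b i)) = (\<Sum>i\<in>I. \<phi> (a i) (b i))"
proof -
  have "tensor_lift V W \<phi> (\<Sum>i\<in>I. tens V W (a i) (b i))
      = (\<Sum>i\<in>I. tensor_lift V W \<phi> (tens V W (a i) (b i)))"
    using assms by (intro linear_map_sum[OF tensor_lift_linear]) (auto intro: tens_in is_space_tensor)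
  then show ?thesis using assms by (simp add: tensor_lift_tens)
qed

lemma tensor_lift_linear_comp:
  assumes V: "is_space V" and W: "is_space W" and U: "is_space U" "is_space U'"
    and \<phi>: "bilinear_map V W U \<phi>" and g: "linear_map U U' g" and t: "t \<in> carr (tensor V W)"
  shows "g (tensor_lift V W \<phi> t) = tensor_lift V W (\<lambda>v w. g (\<phi> v w)) t"
proof -
  have b: "bilinear_map V W U' (\<lambda>v w. g (\<phi> v w))"
    using \<phi> g by (simp add: bilinear_map_def linear_map_def)
  show ?thesis
    by (rule tensor_eqI[OF V W linear_map_comp[OF tensor_lift_linear[OF V U(1) \<phi>] g]
          tensor_lift_linear[OF V U(2) b] _ t])
      (simp add: tensor_lift_tens[OF U(1) \<phi>] tensor_lift_tens[OF U(2) b])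
qed

lemma tensor_lift_cong:
  assumes V: "is_space V" and W: "is_space W" and U: "is_space U"
    and \<phi>: "bilinear_map V W U \<phi>" and t: "t \<in> carr (tensor V W)"
    and eq: "\<And>v w. v \<in> carr V \<Longrightarrow> w \<in> carr W \<Longrightarrow> \<phi> v w = \<psi> v w"
  shows "tensor_lift V W \<phi> t = tensor_lift V W \<psi> t"
proof -
  have \<psi>: "bilinear_map V W U \<psi>"
    using \<phi> eq by (simp add: bilinear_map_def linear_map_def space_add[OF V] space_add[OF W] space_scale[OF V] space_scale[OF W])
  show ?thesis
    by (rule tensor_eqI[OF V W tensor_lift_linear[OF V U \<phi>] tensor_lift_linear[OF V U \<psi>] _ t])
      (simp add: tensor_lift_tens[OF U \<phi>] tensor_lift_tens[OF U \<psi>] eq)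
qed

text \<open>Counterpart of \<open>tensor_lift_linear\<close>: the tensor is fixed and the bilinear
  map varies linearly with a parameter. The two together give bilinearity of nested lifts such as
  \<open>tensor_assoc\<close> and \<open>tensor_mult\<close>.\<close>

lemma linear_tensor_lift_param:
  assumes V: "is_space V" and W: "is_space W" and U: "is_space U" and X: "is_space X"
    and b: "\<And>x. x \<in> carr X \<Longrightarrow> bilinear_map V W U (\<phi> x)"
    and l: "\<And>v w. v \<in> carr V \<Longrightarrow> w \<in> carr W \<Longrightarrow> linear_map X U (\<lambda>x. \<phi> x v w)"
    and t: "t \<in> carr (tensor V W)"
  shows "linear_map X U (\<lambda>x. tensor_lift V W (\<phi> x) t)"
  using t
proof (induction rule: tensor_induct)
  case (tens v w)
  show ?case
    using l[OF tens] tens by (simp add: linear_map_def tensor_lift_tens[OF U b] space_add[OF X] space_scale[OF X])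
next
  case (add s t)
  have eq: "tensor_lift V W (\<phi> x) (s + t) = tensor_lift V W (\<phi> x) s + tensor_lift V W (\<phi> x) t"
    if "x \<in> carr X" for x
    using linear_map_add[OF tensor_lift_linear[OF V U b[OF that]] add(1,2)] .
  show ?case
    using linear_map_plus[OF U add(3,4)] by (simp add: linear_map_def eq space_add[OF X] space_scale[OF X])
qed (use V W in auto)

lemma bilinear_tens_map:
  assumes "is_space V1" "is_space W1" "linear_map V V1 f" "linear_map W W1 g"
  shows "bilinear_map V W (tensor V1 W1) (\<lambda>v w. tens V1 W1 (f v) (g w))"
  using bilinear_comp[OF bilinear_tens[OF assms(1,2)] assms(3,4) linear_map_id(1)] .

lemma tensor_map_linear:
  assumes "is_space V" "is_space V1" "is_space W1" "linear_map V V1 f" "linear_map W W1 g"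
  shows "linear_map (tensor V W) (tensor V1 W1) (tensor_map V W V1 W1 f g)"
  unfolding tensor_map_def by (intro tensor_lift_linear bilinear_tens_map is_space_tensor assms)

lemma tensor_map_tens:
  assumes "is_space V1" "is_space W1" "linear_map V V1 f" "linear_map W W1 g" "v \<in> carr V" "w \<in> carr W"
  shows "tensor_map V W V1 W1 f g (tens V W v w) = tens V1 W1 (f v) (g w)"
  unfolding tensor_map_def
  using tensor_lift_tens[OF is_space_tensor bilinear_tens_map[OF assms(1-4)] assms(5,6)] .

lemma tensor_map_sum:
  assumes "is_space V" "is_space W" "is_space V1" "is_space W1" "linear_map V V1 f" "linear_map W W1 g"
    and "\<And>i. i \<in> I \<Longrightarrow> a i \<in> carr V" "\<And>i. i \<in> I \<Longrightarrow> b i \<in> carr W"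
  shows "tensor_map V W V1 W1 f g (\<Sum>i\<in>I. tens V W (a i) (b i)) = (\<Sum>i\<in>I. tens V1 W1 (f (a i)) (g (b i)))"
  unfolding tensor_map_def
  by (rule tensor_lift_sum[OF _ _ is_space_tensor bilinear_tens_map]) (use assms in auto)

lemma tensor_assoc_bilinear:
  assumes U: "is_space U" and V: "is_space V" and W: "is_space W"
  shows "w \<in> carr W \<Longrightarrow> bilinear_map U V (tensor U (tensor V W)) (\<lambda>u v. tens U (tensor V W) u (tens V W v w))"
    and "bilinear_map (tensor U V) W (tensor U (tensor V W))
       (\<lambda>t w. tensor_lift U V (\<lambda>u v. tens U (tensor V W) u (tens V W v w)) t)"
proof -
  have 1: "bilinear_map U V (tensor U (tensor V W)) (\<lambda>u v. tens U (tensor V W) u (tens V W v w))"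
    if "w \<in> carr W" for w
    using that by (intro bilinear_tens_map is_space_tensor linear_map_id linear_tens_left U V W)
  then show "w \<in> carr W \<Longrightarrow> bilinear_map U V (tensor U (tensor V W)) (\<lambda>u v. tens U (tensor V W) u (tens V W v w))" .
  show "bilinear_map (tensor U V) W (tensor U (tensor V W))
       (\<lambda>t w. tensor_lift U V (\<lambda>u v. tens U (tensor V W) u (tens V W v w)) t)"
  proof (rule bilinear_mapI)
    fix t assume "t \<in> carr (tensor U V)"
    then show "linear_map W (tensor U (tensor V W))
        (\<lambda>w. tensor_lift U V (\<lambda>u v. tens U (tensor V W) u (tens V W v w)) t)"
      by (intro linear_tensor_lift_param linear_map_comp[OF linear_tens_right linear_tens_right]
          is_space_tensor U V W 1)
  next
    fix w assume "w \<in> carr W"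
    then show "linear_map (tensor U V) (tensor U (tensor V W))
        (tensor_lift U V (\<lambda>u v. tens U (tensor V W) u (tens V W v w)))"
      by (intro tensor_lift_linear 1 is_space_tensor U V W)
  qed
qed

lemma tensor_assoc_linear:
  assumes U: "is_space U" and V: "is_space V" and W: "is_space W"
  shows "linear_map (tensor (tensor U V) W) (tensor U (tensor V W)) (tensor_assoc U V W)"
  unfolding tensor_assoc_def
  by (intro tensor_lift_linear tensor_assoc_bilinear is_space_tensor assms)

lemma tensor_assoc_tens_left:
  assumes U: "is_space U" and V: "is_space V" and W: "is_space W"
    and "t \<in> carr (tensor U V)" "w \<in> carr W"
  shows "tensor_assoc U V W (tens (tensor U V) W t w)
    = tensor_lift U V (\<lambda>u v. tens U (tensor V W) u (tens V W v w)) t"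
  unfolding tensor_assoc_def
  using tensor_lift_tens[OF is_space_tensor tensor_assoc_bilinear(2)[OF U V W] assms(4,5)] .

lemma tensor_assoc_tens:
  assumes "is_space U" "is_space V" "is_space W" "u \<in> carr U" "v \<in> carr V" "w \<in> carr W"
  shows "tensor_assoc U V W (tens (tensor U V) W (tens U V u v) w) = tens U (tensor V W) u (tens V W v w)"
  using assms by (simp add: tensor_assoc_tens_left tens_in
      tensor_lift_tens[OF is_space_tensor tensor_assoc_bilinear(1)])

lemma tensor_assoc_sum:
  assumes "is_space U" "is_space V" "is_space W"
    and "\<And>i j. i \<in> I \<Longrightarrow> j \<in> J i \<Longrightarrow> u i j \<in> carr U" "\<And>i j. i \<in> I \<Longrightarrow> j \<in> J i \<Longrightarrow> v i j \<in> carr V"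
    "\<And>i. i \<in> I \<Longrightarrow> w i \<in> carr W"
  shows "tensor_assoc U V W (\<Sum>i\<in>I. tens (tensor U V) W (\<Sum>j\<in>J i. tens U V (u i j) (v i j)) (w i))
    = (\<Sum>i\<in>I. \<Sum>j\<in>J i. tens U (tensor V W) (u i j) (tens V W (v i j) (w i)))"
proof -
  note sp = is_space_tensor assms(1-3)
  have "tensor_assoc U V W (\<Sum>i\<in>I. tens (tensor U V) W (\<Sum>j\<in>J i. tens U V (u i j) (v i j)) (w i))
    = (\<Sum>i\<in>I. tensor_assoc U V W (tens (tensor U V) W (\<Sum>j\<in>J i. tens U V (u i j) (v i j)) (w i)))"
    by (intro linear_map_sum[OF tensor_assoc_linear] sp tens_in space_sum assms)
  also have "\<dots> = (\<Sum>i\<in>I. \<Sum>j\<in>J i. tens U (tensor V W) (u i j) (tens V W (v i j) (w i)))"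
  proof (rule sum.cong)
    fix i assume i: "i \<in> I"
    have "tensor_assoc U V W (tens (tensor U V) W (\<Sum>j\<in>J i. tens U V (u i j) (v i j)) (w i))
      = tensor_lift U V (\<lambda>u v. tens U (tensor V W) u (tens V W v (w i))) (\<Sum>j\<in>J i. tens U V (u i j) (v i j))"
      using i by (intro tensor_assoc_tens_left sp space_sum tens_in assms)
    also have "\<dots> = (\<Sum>j\<in>J i. tens U (tensor V W) (u i j) (tens V W (v i j) (w i)))"
      using i by (intro tensor_lift_sum[OF _ _ is_space_tensor tensor_assoc_bilinear(1)] sp assms)
    finally show "tensor_assoc U V W (tens (tensor U V) W (\<Sum>j\<in>J i. tens U V (u i j) (v i j)) (w i))
      = (\<Sum>j\<in>J i. tens U (tensor V W) (u i j) (tens V W (v i j) (w i)))" .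
  qed simp
  finally show ?thesis .
qed

section \<open>Algebras and the universal property of \<open>A\<^sub>s(n)\<close>\<close>

lemma is_algebraD:
  assumes "is_algebra A"
  shows "is_space A" "carr A = UNIV" "smul A c x * y = smul A c (x * y)" "x * smul A c y = smul A c (x * y)"
  using assms by (auto simp: is_algebra_def)

lemma linear_mult_left: "is_algebra A \<Longrightarrow> linear_map V A f \<Longrightarrow> linear_map V A (\<lambda>x. f x * a)"
  by (simp add: linear_map_def distrib_right is_algebraD)

lemma linear_mult_right: "is_algebra A \<Longrightarrow> linear_map V A f \<Longrightarrow> linear_map V A (\<lambda>x. a * f x)"
  by (simp add: linear_map_def distrib_left is_algebraD)

lemma bilinear_mult: "is_algebra A \<Longrightarrow> bilinear_map A A A (*)"
  by (intro bilinear_mapI linear_mult_left linear_mult_right linear_map_id)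

text \<open>Product and unit are parameters because a tensor product carries
  \<open>tensor_mult\<close> instead of the product of its type, and because the antipode is a
  homomorphism to the opposite product.\<close>

definition algebra_on ::
  "('k::field, 't::ab_group_add, 'm) vspace_scheme \<Rightarrow> ('t \<Rightarrow> 't \<Rightarrow> 't) \<Rightarrow> 't \<Rightarrow> bool" where
  "algebra_on T m e \<longleftrightarrow> is_space T \<and> e \<in> carr T \<and> bilinear_map T T T m \<and>
     (\<forall>x\<in>carr T. m e x = x \<and> m x e = x) \<and>
     (\<forall>x\<in>carr T. \<forall>y\<in>carr T. \<forall>z\<in>carr T. m (m x y) z = m x (m y z))"

lemma algebra_on_algebra: "is_algebra A \<Longrightarrow> algebra_on A (*) 1"
  by (simp add: algebra_on_def is_algebraD bilinear_mult mult.assoc)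

lemma algebra_on_opposite: "algebra_on T m e \<Longrightarrow> algebra_on T (\<lambda>x y. m y x) e"
  by (simp add: algebra_on_def bilinear_map_def)

section \<open>The algebra structure on a tensor product of algebras\<close>

context
  fixes A :: "('k::field, 'a::ring_1, 'm) vspace_scheme" and B :: "('k, 'b::ring_1, 'l) vspace_scheme"
  assumes A: "is_algebra A" and B: "is_algebra B"
begin

private lemma sp: "is_space A" "is_space B" "is_space (tensor A B)"
  using A B by (simp_all add: is_algebraD is_space_tensor)

private lemma bil: "bilinear_map A B (tensor A B) (\<lambda>a' b'. tens A B (a * a') (b * b'))"
  by (intro bilinear_tens_map sp linear_mult_right linear_map_id A B)

private lemma bil': "t \<in> carr (tensor A B) \<Longrightarrow>
  bilinear_map A B (tensor A B) (\<lambda>a b. tensor_lift A B (\<lambda>a' b'. tens A B (a * a') (b * b')) t)"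
  by (intro bilinear_mapI linear_tensor_lift_param sp bil
      linear_map_comp[OF linear_mult_left[OF A] linear_tens_left]
      linear_map_comp[OF linear_mult_left[OF B] linear_tens_right] linear_map_id)
     (auto simp: is_algebraD(2)[OF A] is_algebraD(2)[OF B])

lemma tensor_mult_bilinear: "bilinear_map (tensor A B) (tensor A B) (tensor A B) (tensor_mult A B)"
  unfolding tensor_mult_def
proof (rule bilinear_mapI)
  fix s assume "s \<in> carr (tensor A B)"
  then show "linear_map (tensor A B) (tensor A B)
     (\<lambda>t. tensor_lift A B (\<lambda>a b. tensor_lift A B (\<lambda>a' b'. tens A B (a * a') (b * b')) t) s)"
    by (intro linear_tensor_lift_param sp bil' tensor_lift_linear bil)
next
  fix t assume "t \<in> carr (tensor A B)"
  then show "linear_map (tensor A B) (tensor A B)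
     (tensor_lift A B (\<lambda>a b. tensor_lift A B (\<lambda>a' b'. tens A B (a * a') (b * b')) t))"
    by (intro tensor_lift_linear sp bil')
qed

lemma tensor_mult_tens:
  "tensor_mult A B (tens A B a b) (tens A B a' b') = tens A B (a * a') (b * b')"
proof -
  have t: "tens A B a' b' \<in> carr (tensor A B)"
    by (intro tens_in sp) (auto simp: is_algebraD(2)[OF A] is_algebraD(2)[OF B])
  show ?thesis
    unfolding tensor_mult_def
    by (subst tensor_lift_tens[OF sp(3) bil'[OF t]], simp_all add: is_algebraD(2)[OF A] is_algebraD(2)[OF B])
      (subst tensor_lift_tens[OF sp(3) bil], simp_all add: is_algebraD(2)[OF A] is_algebraD(2)[OF B])
qed

lemma tensor_mult_sum:
  "tensor_mult A B (\<Sum>i\<in>I. tens A B (a i) (b i)) (\<Sum>j\<in>J. tens A B (a' j) (b' j))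
    = (\<Sum>i\<in>I. \<Sum>j\<in>J. tens A B (a i * a' j) (b i * b' j))"
proof -
  have ins: "tens A B x y \<in> carr (tensor A B)" for x y
    by (intro tens_in sp) (auto simp: is_algebraD(2)[OF A] is_algebraD(2)[OF B])
  then have s: "(\<Sum>j\<in>J. tens A B (a' j) (b' j)) \<in> carr (tensor A B)" by (intro space_sum sp)
  show ?thesis
    unfolding linear_map_sum[OF bilinear_left[OF tensor_mult_bilinear s] sp(3) ins]
    unfolding linear_map_sum[OF bilinear_right[OF tensor_mult_bilinear ins] sp(3) ins]
    by (simp add: tensor_mult_tens)
qed

lemma algebra_on_tensor: "algebra_on (tensor A B) (tensor_mult A B) (tens A B 1 1)"
proof -
  note ml = bilinear_left[OF tensor_mult_bilinear] and mr = bilinear_right[OF tensor_mult_bilinear]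
  have ins: "tens A B x y \<in> carr (tensor A B)" for x y
    by (intro tens_in sp) (auto simp: is_algebraD(2)[OF A] is_algebraD(2)[OF B])
  have min: "tensor_mult A B s t \<in> carr (tensor A B)"
    if "s \<in> carr (tensor A B)" "t \<in> carr (tensor A B)" for s t
    using that by (rule bilinear_in[OF tensor_mult_bilinear])
  have unit: "tensor_mult A B (tens A B 1 1) x = x" "tensor_mult A B x (tens A B 1 1) = x"
    if x: "x \<in> carr (tensor A B)" for x
    using tensor_eqI[OF sp(1,2) mr[OF ins[of 1 1]] linear_map_id(1) _ x]
      tensor_eqI[OF sp(1,2) ml[OF ins[of 1 1]] linear_map_id(1) _ x]
    by (simp_all add: tensor_mult_tens)
  \<comment> \<open>Associativity is extended from pure to general tensors one argument at a time:
    here the last one, in \<open>2\<close> the middle one, and then the first.\<close>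
  have 1: "tensor_mult A B (tensor_mult A B (tens A B a b) (tens A B a' b')) z
      = tensor_mult A B (tens A B a b) (tensor_mult A B (tens A B a' b') z)"
    if z: "z \<in> carr (tensor A B)" for a b a' b' z
    by (rule tensor_eqI[OF sp(1,2) mr linear_map_comp[OF mr mr] _ z])
      (simp_all add: tensor_mult_tens ins mult.assoc)
  have 2: "tensor_mult A B (tensor_mult A B (tens A B a b) y) z
      = tensor_mult A B (tens A B a b) (tensor_mult A B y z)"
    if y: "y \<in> carr (tensor A B)" and z: "z \<in> carr (tensor A B)" for a b y z
    by (rule tensor_eqI[OF sp(1,2) linear_map_comp[OF mr ml] linear_map_comp[OF ml mr] _ y])
      (simp_all add: 1 z ins)
  have "tensor_mult A B (tensor_mult A B x y) z = tensor_mult A B x (tensor_mult A B y z)"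
    if x: "x \<in> carr (tensor A B)" and y: "y \<in> carr (tensor A B)" and z: "z \<in> carr (tensor A B)" for x y z
    by (rule tensor_eqI[OF sp(1,2) linear_map_comp[OF ml ml] ml _ x])
      (simp_all add: 2 y z ins min)
  then show ?thesis
    by (simp add: algebra_on_def sp ins tensor_mult_bilinear unit)
qed

end

section \<open>Linear maps on the free algebra and their descent to the quotient\<close>

definition lin_ext ::
  "('k::field, 'v::ab_group_add, 'm) vspace_scheme \<Rightarrow> ('w \<Rightarrow> 'v) \<Rightarrow> ('w \<Rightarrow>\<^sub>0 'k) \<Rightarrow> 'v" where
  "lin_ext V f p = (\<Sum>w\<in>Poly_Mapping.keys p. smul V (Poly_Mapping.lookup p w) (f w))"

lemma lin_ext_superset:
  assumes "is_space V" "finite A" "Poly_Mapping.keys p \<subseteq> A"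
  shows "lin_ext V f p = (\<Sum>w\<in>A. smul V (Poly_Mapping.lookup p w) (f w))"
  unfolding lin_ext_def using assms
  by (intro sum.mono_neutral_left) (auto simp: in_keys_iff space_smul_simps)

lemma lin_ext_add: "is_space V \<Longrightarrow> lin_ext V f (p + q) = lin_ext V f p + lin_ext V f q"
  using Poly_Mapping.keys_add[of p q]
  by (simp add: lin_ext_superset[of V "Poly_Mapping.keys p \<union> Poly_Mapping.keys q"] lookup_add
      sum.distrib space_smul_simps)

lemma lin_ext_single: "is_space V \<Longrightarrow> lin_ext V f (Poly_Mapping.single w c) = smul V c (f w)"
  by (subst lin_ext_superset[of V "{w}"]) auto

lemma lin_ext_zero: "lin_ext V f 0 = 0"
  by (simp add: lin_ext_def)

lemma lin_ext_diff: "is_space V \<Longrightarrow> lin_ext V f (p - q) = lin_ext V f p - lin_ext V f q"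
  using lin_ext_add[of V f "p - q" q] by simp

lemma lin_ext_sum: "is_space V \<Longrightarrow> lin_ext V f (\<Sum>i\<in>I. p i) = (\<Sum>i\<in>I. lin_ext V f (p i))"
  by (induction I rule: infinite_finite_induct) (auto simp: lin_ext_zero lin_ext_add)

lemma lin_ext_in: "is_space V \<Longrightarrow> (\<And>w. f w \<in> carr V) \<Longrightarrow> lin_ext V f p \<in> carr V"
  unfolding lin_ext_def by (intro space_sum space_scale)

lemma lin_ext_scale:
  fixes f :: "'x free_word \<Rightarrow> 'v::ab_group_add"
  assumes V: "is_space (V :: ('k::field, 'v, 'm) vspace_scheme)"
  shows "lin_ext V f (Poly_Mapping.single 0 c * p) = smul V c (lin_ext V f p)"
proof (induction p rule: free_algebra_induct)
  case (single w d)
  show ?case by (simp add: mult_single lin_ext_single[OF V] space_smul_simps[OF V])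
next
  case (add p q)
  then show ?case by (simp add: distrib_left lin_ext_add[OF V] space_smul_simps[OF V])
qed

text \<open>The ideal is spanned by the products of a relation with a word on either side. The
  criterion is stated for an arbitrary \<open>f\<close> on words because the Haar functional is in
  general not multiplicative.\<close>

lemma lin_ext_ideal:
  fixes f :: "('n::finite \<times> 'n) free_word \<Rightarrow> 'v::ab_group_add"
  assumes V: "is_space (V :: ('k::field, 'v, 'm) vspace_scheme)"
    and rel: "\<And>r v w. r \<in> qperm_relations \<Longrightarrow>
      lin_ext V f (Poly_Mapping.single v 1 * r * Poly_Mapping.single w 1) = 0"
    and x: "x \<in> qperm_ideal"
  shows "lin_ext V f x = 0"
  using x
proof (induction rule: qperm_ideal.induct)
  case (rel r a b)
  have comm: "p * Poly_Mapping.single 0 c = Poly_Mapping.single 0 c * p"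
    for p :: "('k, 'n \<times> 'n) free_algebra" and c
    by (induction p rule: free_algebra_induct) (auto simp: mult_single distrib_left distrib_right mult.commute)
  show ?case
  proof (induction a rule: free_algebra_induct)
    case (single v c)
    show ?case
    proof (induction b rule: free_algebra_induct)
      case (single w d)
      have "Poly_Mapping.single v c * r * Poly_Mapping.single w d
        = Poly_Mapping.single 0 c * (Poly_Mapping.single 0 d
            * (Poly_Mapping.single v 1 * r * Poly_Mapping.single w 1))"
      proof -
        let ?S = "Poly_Mapping.single 0" and ?v = "Poly_Mapping.single v 1" and ?w = "Poly_Mapping.single w 1"
        have "Poly_Mapping.single v c * r * Poly_Mapping.single w d = (?S c * ?v) * r * (?S d * ?w)"
          by (simp add: mult_single)
        also have "\<dots> = ?S c * ((?v * r) * ?S d * ?w)" by (simp only: mult.assoc)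
        also have "(?v * r) * ?S d = ?S d * (?v * r)" by (rule comm)
        finally show ?thesis by (simp only: mult.assoc)
      qed
      then show ?case
        by (simp only: lin_ext_scale[OF V] assms(2)[OF rel] space_smul_simps[OF V])
    qed (simp add: distrib_left lin_ext_add[OF V])
  qed (simp add: distrib_right lin_ext_add[OF V])
qed (simp_all add: lin_ext_zero lin_ext_add[OF V])

lemma abs_qperm_simps:
  "abs_qperm_algebra p + abs_qperm_algebra q = abs_qperm_algebra (p + q)"
  "abs_qperm_algebra p * abs_qperm_algebra q = abs_qperm_algebra (p * q)"
  "abs_qperm_algebra 1 = 1" "abs_qperm_algebra 0 = 0"
  "qperm_scale c (abs_qperm_algebra p) = abs_qperm_algebra (Poly_Mapping.single 0 c * p)"
  "qperm_gen i j = abs_qperm_algebra (gen (i, j))"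
  by (simp_all add: plus_qperm_algebra.abs_eq times_qperm_algebra.abs_eq one_qperm_algebra.abs_eq
      zero_qperm_algebra.abs_eq qperm_scale.abs_eq qperm_gen.abs_eq)

lemma abs_qperm_eq_iff: "abs_qperm_algebra p = abs_qperm_algebra q \<longleftrightarrow> p - q \<in> qperm_ideal"
  using qperm_algebra.abs_eq_iff[of p q] by (simp add: qperm_rel_def)

lemma qperm_cases: obtains p where "x = abs_qperm_algebra p"
  by (metis Quotient_abs_rep Quotient_qperm_algebra)

lemma is_algebra_qperm_space: "is_algebra qperm_space"
proof -
  have sw: "Poly_Mapping.single 0 (c + d) * p = Poly_Mapping.single 0 c * p + Poly_Mapping.single 0 d * p"
    for c d :: 'a and p :: "('a, 'b \<times> 'b) free_algebra"
    by (simp add: single_add distrib_right)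
  have comm: "p * Poly_Mapping.single 0 c = Poly_Mapping.single 0 c * p"
    for p :: "('a, 'b \<times> 'b) free_algebra" and c
    by (induction p rule: free_algebra_induct) (auto simp: mult_single distrib_left distrib_right mult.commute)
  have vs: "vector_space (qperm_scale :: 'a \<Rightarrow> ('a, 'b) qperm_algebra \<Rightarrow> _)"
  proof
    fix a b :: 'a and x y :: "('a, 'b) qperm_algebra"
    obtain p q where "x = abs_qperm_algebra p" "y = abs_qperm_algebra q" by (metis qperm_cases)
    then show "qperm_scale a (x + y) = qperm_scale a x + qperm_scale a y"
      "qperm_scale (a + b) x = qperm_scale a x + qperm_scale b x"
      "qperm_scale a (qperm_scale b x) = qperm_scale (a * b) x"
      "qperm_scale 1 x = x"
      by (simp_all add: abs_qperm_simps sw distrib_left mult.assoc[symmetric] mult_single)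
  qed
  have "qperm_scale c x * y = qperm_scale c (x * y) \<and> x * qperm_scale c y = qperm_scale c (x * y)"
    for c and x y :: "('a, 'b) qperm_algebra"
  proof -
    obtain p q where "x = abs_qperm_algebra p" "y = abs_qperm_algebra q" by (metis qperm_cases)
    moreover have "p * (Poly_Mapping.single 0 c * q) = Poly_Mapping.single 0 c * (p * q)"
      by (metis comm mult.assoc)
    ultimately show ?thesis by (simp add: abs_qperm_simps mult.assoc)
  qed
  with vs show ?thesis
    by (simp add: is_algebra_def is_space_def qperm_space_def module.subspace_UNIV module_iff_vector_space)
qed

lemma qperm_space_simps [simp]: "carr qperm_space = UNIV" "smul qperm_space = qperm_scale"
  by (simp_all add: qperm_space_def)

text \<open>The entry of the \<open>k\<close>-fold tensor power of a matrix at two words of length \<open>k\<close>.\<close>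

definition mon :: "('n \<Rightarrow> 'n \<Rightarrow> 'a::monoid_mult) \<Rightarrow> 'n list \<Rightarrow> 'n list \<Rightarrow> 'a" where
  "mon x I J = prod_list (map2 x I J)"

lemma mon_Nil [simp]: "mon x [] [] = 1"
  by (simp add: mon_def)

lemma mon_Cons [simp]: "mon x (i # I) (j # J) = x i j * mon x I J"
  by (simp add: mon_def)

lemma mon_append: "length I = length J \<Longrightarrow> mon x (I @ I') (J @ J') = mon x I J * mon x I' J'"
  by (simp add: mon_def)

abbreviation qmon :: "'n::finite list \<Rightarrow> 'n list \<Rightarrow> ('k::field, 'n) qperm_algebra" where
  "qmon \<equiv> mon qperm_gen"

lemma qmon_abs:
  "length I = length J \<Longrightarrow> qmon I J = abs_qperm_algebra (Poly_Mapping.single (Word (zip I J)) 1)"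
proof (induction I J rule: list_induct2)
  case Nil
  show ?case by (simp add: abs_qperm_simps(3)[symmetric] single_one[symmetric] zero_free_word_def)
next
  case (Cons i I j J)
  then show ?case by (simp add: abs_qperm_simps gen_def mult_single)
qed

text \<open>By \<open>zip\<close>, a word in index pairs is a pair of words of equal length; this
  identifies the images of free words with the entries of tensor powers.\<close>

lemma qperm_linear_eqI:
  assumes F: "linear_map qperm_space U F" and G: "linear_map qperm_space U G"
    and eq: "\<And>I J. length I = length J \<Longrightarrow> F (qmon I J) = G (qmon I J)"
  shows "F x = G x"
proof -
  obtain p where x: "x = abs_qperm_algebra p" by (rule qperm_cases)
  have "F (abs_qperm_algebra p) = G (abs_qperm_algebra p)"
  proof (induction p rule: free_algebra_induct)
    case (single w c)
    obtain ps where w: "w = Word ps" by (cases w)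
    have "abs_qperm_algebra (Poly_Mapping.single w c) = qperm_scale c (qmon (map fst ps) (map snd ps))"
      by (simp add: qmon_abs w abs_qperm_simps mult_single zip_map_fst_snd)
    then show ?case
      using linear_map_scale[OF F] linear_map_scale[OF G] eq by simp
  next
    case (add p q)
    then show ?case
      using linear_map_add[OF F] linear_map_add[OF G] by (simp add: abs_qperm_simps(1)[symmetric])
  qed
  then show ?thesis by (simp add: x)
qed

lemma qperm_gen_relations:
  fixes i j k :: "'n::finite"
  shows "qperm_gen k i * qperm_gen k j = (if i = j then qperm_gen k i else 0)"
  "(\<Sum>l\<in>UNIV. qperm_gen i l) = 1"
  "qperm_gen i k * qperm_gen j k = (if i = j then qperm_gen i k else 0)"
  "(\<Sum>l\<in>UNIV. qperm_gen l i) = 1"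
proof -
  have z: "abs_qperm_algebra p = abs_qperm_algebra q" if "p - q \<in> qperm_relations" for p q
    using qperm_ideal.rel[OF that, of 1 1] by (simp add: abs_qperm_eq_iff)
  have s: "(\<Sum>l\<in>S. abs_qperm_algebra (p l)) = abs_qperm_algebra (\<Sum>l\<in>S. p l)"
    for p :: "'n \<Rightarrow> _" and S
    by (induction S rule: infinite_finite_induct) (simp_all add: abs_qperm_simps)
  have r: "gen (k, i) * gen (k, j) - (if i = j then gen (k, i) else 0) \<in> qperm_relations"
    "(\<Sum>l\<in>UNIV. gen (i, l)) - 1 \<in> qperm_relations"
    "gen (i, k) * gen (j, k) - (if i = j then gen (i, k) else 0) \<in> qperm_relations"
    "(\<Sum>l\<in>UNIV. gen (l, i)) - 1 \<in> qperm_relations"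
    for i j k :: 'n
    unfolding qperm_relations_def by blast+
  show "qperm_gen k i * qperm_gen k j = (if i = j then qperm_gen k i else 0)"
    using z[OF r(1)[of k i j]] by (simp add: abs_qperm_simps split: if_splits)
  show "qperm_gen i k * qperm_gen j k = (if i = j then qperm_gen i k else 0)"
    using z[OF r(3)[of i k j]] by (simp add: abs_qperm_simps split: if_splits)
  show "(\<Sum>l\<in>UNIV. qperm_gen i l) = 1" "(\<Sum>l\<in>UNIV. qperm_gen l i) = 1"
    using z[OF r(2)[of i]] z[OF r(4)[of i]] by (simp_all add: abs_qperm_simps s)
qed

section \<open>Universal property of the presentation\<close>

definition word_eval :: "('t \<Rightarrow> 't \<Rightarrow> 't) \<Rightarrow> 't \<Rightarrow> ('x \<Rightarrow> 't) \<Rightarrow> 'x free_word \<Rightarrow> 't" where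
  "word_eval m e t w = (case w of Word xs \<Rightarrow> foldr (\<lambda>x. m (t x)) xs e)"

lemma ex_qperm_linear:
  fixes V :: "('k::field, 'v::ab_group_add, 'm) vspace_scheme" and f :: "('n::finite \<times> 'n) free_word \<Rightarrow> 'v"
  assumes V: "is_space V" and f: "\<And>w. f w \<in> carr V" and ideal: "\<And>x. x \<in> qperm_ideal \<Longrightarrow> lin_ext V f x = 0"
  obtains F where "linear_map qperm_space V F" "\<And>p. F (abs_qperm_algebra p) = lin_ext V f p"
proof -
  define F where "F x = lin_ext V f (rep_qperm_algebra x)" for x
  have F_abs: "F (abs_qperm_algebra p) = lin_ext V f p" for p
  proof -
    have "abs_qperm_algebra (rep_qperm_algebra (abs_qperm_algebra p)) = abs_qperm_algebra p"
      by (metis Quotient_abs_rep Quotient_qperm_algebra)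
    then show ?thesis
      using ideal lin_ext_diff[OF V] unfolding F_def abs_qperm_eq_iff by (metis eq_iff_diff_eq_0)
  qed
  moreover have "linear_map qperm_space V F"
  proof (rule linear_mapI)
    fix x y :: "('k, 'n) qperm_algebra" and c :: 'k
    obtain p q where [simp]: "x = abs_qperm_algebra p" "y = abs_qperm_algebra q" by (metis qperm_cases)
    show "F x \<in> carr V" "F (x + y) = F x + F y" "F (smul qperm_space c x) = smul V c (F x)"
      by (simp_all add: F_abs abs_qperm_simps lin_ext_add[OF V] lin_ext_scale[OF V] lin_ext_in[OF V f])
  qed
  ultimately show thesis using that by blast
qed

text \<open>Evaluation of words at \<open>t\<close> is multiplicative for \<open>m\<close>, so it
  vanishes on the whole ideal as soon as it vanishes on the relations, and then descends to the
  quotient.\<close>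

lemma ex_qperm_hom:
  fixes T :: "('k::field, 't::ab_group_add, 'm) vspace_scheme" and t :: "'n::finite \<Rightarrow> 'n \<Rightarrow> 't"
  assumes T: "algebra_on T m e" and t: "\<And>i j. t i j \<in> carr T"
    and rel: "\<And>k i j. m (t k i) (t k j) = (if i = j then t k i else 0)" "\<And>i. (\<Sum>l\<in>UNIV. t i l) = e"
      "\<And>k i j. m (t i k) (t j k) = (if i = j then t i k else 0)" "\<And>i. (\<Sum>l\<in>UNIV. t l i) = e"
  obtains F where "linear_map qperm_space T F" "F 1 = e" "\<And>x y. F (x * y) = m (F x) (F y)"
    "\<And>i j. F (qperm_gen i j) = t i j"
proof -
  have sp: "is_space T" and e: "e \<in> carr T" and bil: "bilinear_map T T T m"
    and unit: "\<And>x. x \<in> carr T \<Longrightarrow> m e x = x" "\<And>x. x \<in> carr T \<Longrightarrow> m x e = x"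
    and assoc: "\<And>x y z. x \<in> carr T \<Longrightarrow> y \<in> carr T \<Longrightarrow> z \<in> carr T \<Longrightarrow> m (m x y) z = m x (m y z)"
    using T by (auto simp: algebra_on_def)
  note m_in = bilinear_in[OF bil] and ml = bilinear_left[OF bil] and mr = bilinear_right[OF bil]
  let ?w = "word_eval m e (\<lambda>(i, j). t i j)"
  have w_in: "?w w \<in> carr T" for w
  proof (cases w)
    case (Word xs)
    have "foldr (\<lambda>x. m (case x of (i, j) \<Rightarrow> t i j)) xs e \<in> carr T"
      by (induction xs) (auto simp: e t m_in)
    then show ?thesis by (simp add: Word word_eval_def)
  qed
  have w_add: "?w (v + w) = m (?w v) (?w w)" for v w
  proof (cases v; cases w)
    fix xs ys assume [simp]: "v = Word xs" "w = Word ys"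
    have *: "foldr (\<lambda>x. m (case x of (i, j) \<Rightarrow> t i j)) zs e \<in> carr T" for zs
      using w_in[of "Word zs"] by (simp add: word_eval_def)
    have "foldr (\<lambda>x. m (case x of (i, j) \<Rightarrow> t i j)) (xs @ ys) e =
      m (foldr (\<lambda>x. m (case x of (i, j) \<Rightarrow> t i j)) xs e) (foldr (\<lambda>x. m (case x of (i, j) \<Rightarrow> t i j)) ys e)"
    proof (induction xs)
      case Nil
      show ?case using unit(1)[OF *] by simp
    next
      case (Cons x xs)
      then show ?case using assoc[OF _ * *] by (simp add: t split: prod.splits)
    qed
    then show ?thesis by (simp add: word_eval_def)
  qed
  define E where "E = lin_ext T ?w"
  have E_in: "E p \<in> carr T" for p unfolding E_def by (intro lin_ext_in sp w_in)
  have E_add: "E (p + q) = E p + E q" for p q by (simp add: E_def lin_ext_add sp)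
  have E_mult: "E (p * q) = m (E p) (E q)" for p q
  proof (induction p rule: free_algebra_induct)
    case (single v c)
    show ?case
    proof (induction q rule: free_algebra_induct)
      case (single w d)
      show ?case
        by (simp add: E_def mult_single lin_ext_single sp w_add linear_map_scale[OF ml]
            linear_map_scale[OF mr] w_in space_scale space_smul_simps[OF sp] mult.commute)
    next
      case (add q q')
      then show ?case
        by (simp add: distrib_left E_add linear_map_add[OF mr[OF E_in] E_in E_in])
    qed
  next
    case (add p p')
    then show ?case
      by (simp add: distrib_right E_add linear_map_add[OF ml[OF E_in] E_in E_in])
  qed
  have E_gen: "E (gen (i, j)) = t i j" for i j
    by (simp add: E_def gen_def lin_ext_single sp word_eval_def unit t space_smul_simps[OF sp])
  have E_one: "E 1 = e"
    unfolding single_one[symmetric]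
    by (simp add: E_def lin_ext_single sp word_eval_def zero_free_word_def space_smul_simps[OF sp])
  have E_sum: "E (\<Sum>i\<in>S. p i) = (\<Sum>i\<in>S. E (p i))" for p :: "'n \<Rightarrow> _" and S
    by (simp add: E_def lin_ext_sum sp)
  have E_diff: "E (p - q) = E p - E q" for p q by (simp add: E_def lin_ext_diff sp)
  have E_zero: "E 0 = 0" by (simp add: E_def lin_ext_zero)
  have E_rel: "E r = 0" if "r \<in> qperm_relations" for r
    using that by (auto simp: qperm_relations_def E_diff E_mult E_gen E_sum E_one E_zero rel)
  have E_ideal: "E x = 0" if "x \<in> qperm_ideal" for x
    using that
  proof (induction rule: qperm_ideal.induct)
    case (rel r a b)
    have "m (E a) 0 = 0" "m 0 (E b) = 0"
      by (rule linear_map_zero[OF mr[OF E_in] sp]) (rule linear_map_zero[OF ml[OF E_in] sp])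
    then show ?case by (simp add: E_mult E_rel[OF rel])
  qed (simp_all add: E_zero E_add)
  note hom = that
  show thesis
  proof (rule ex_qperm_linear[OF sp w_in])
    show "lin_ext T ?w x = 0" if "x \<in> qperm_ideal" for x using E_ideal[OF that] by (simp add: E_def)
    fix F :: "('k, 'n) qperm_algebra \<Rightarrow> 't"
    assume F: "linear_map qperm_space T F" "\<And>p. F (abs_qperm_algebra p) = lin_ext T ?w p"
    have F_abs: "F (abs_qperm_algebra p) = E p" for p by (simp only: F(2) E_def)
    show thesis
    proof (rule hom[OF F(1)])
      show "F 1 = e" by (simp add: F_abs E_one flip: abs_qperm_simps(3))
      show "F (qperm_gen i j) = t i j" for i j by (simp add: F_abs E_gen abs_qperm_simps)
      show "F (x * y) = m (F x) (F y)" for x y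
        by (cases x rule: qperm_cases; cases y rule: qperm_cases) (simp add: F_abs E_mult abs_qperm_simps)
    qed
  qed
qed

lemma qperm_hom_unique:
  assumes F: "linear_map qperm_space T F" "F 1 = e" "\<And>x y. F (x * y) = m (F x) (F y)"
    and G: "linear_map qperm_space T G" "G 1 = e" "\<And>x y. G (x * y) = m (G x) (G y)"
    and eq: "\<And>i j. F (qperm_gen i j) = G (qperm_gen i j)"
  shows "F = G"
proof
  fix x
  show "F x = G x"
  proof (rule qperm_linear_eqI[OF F(1) G(1)])
    fix I J :: "'b list"
    assume "length I = length J"
    then show "F (qmon I J) = G (qmon I J)"
      by (induction I J rule: list_induct2) (simp_all add: F(2,3) G(2,3) eq)
  qed
qed

text \<open>The conjuncts are grouped to match the definite descriptions that define
  \<open>qperm_comult\<close>, \<open>qperm_counit\<close> and \<open>qperm_antipode\<close>, so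
  that \<open>theI'\<close> yields their characterisations.\<close>

lemma ex1_qperm_hom:
  fixes T :: "('k::field, 't::ab_group_add, 'm) vspace_scheme" and t :: "'n::finite \<Rightarrow> 'n \<Rightarrow> 't"
  assumes "algebra_on T m e" "\<And>i j. t i j \<in> carr T"
    "\<And>k i j. m (t k i) (t k j) = (if i = j then t k i else 0)" "\<And>i. (\<Sum>l\<in>UNIV. t i l) = e"
    "\<And>k i j. m (t i k) (t j k) = (if i = j then t i k else 0)" "\<And>i. (\<Sum>l\<in>UNIV. t l i) = e"
  shows "\<exists>!F. (linear_map qperm_space T F \<and> F 1 = e \<and> (\<forall>x y. F (x * y) = m (F x) (F y))) \<and>
    (\<forall>i j. F (qperm_gen i j) = t i j)"
proof -
  obtain F where F: "linear_map qperm_space T F" "F 1 = e" "\<And>x y. F (x * y) = m (F x) (F y)"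
    "\<And>i j. F (qperm_gen i j) = t i j"
    using ex_qperm_hom[of T m e t] assms by blast
  show ?thesis
  proof (rule ex1I[of _ F])
    fix G assume "(linear_map qperm_space T G \<and> G 1 = e \<and> (\<forall>x y. G (x * y) = m (G x) (G y))) \<and>
      (\<forall>i j. G (qperm_gen i j) = t i j)"
    then show "G = F" using F by (intro qperm_hom_unique[of T G e m F]) auto
  qed (use F in auto)
qed

section \<open>Sums over words\<close>

definition words :: "nat \<Rightarrow> 'n::finite list set" where
  "words k = {L. length L = k}"

lemma finite_words [simp]: "finite (words k :: 'n::finite list set)"
  using finite_lists_length_eq[of "UNIV :: 'n set" k] by (simp add: words_def)

lemma words_iff [simp]: "L \<in> words k \<longleftrightarrow> length L = k"
  by (simp add: words_def)

lemma sum_words_0: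
  fixes F :: "'n::finite list \<Rightarrow> 'a::comm_monoid_add"
  shows "(\<Sum>L\<in>words 0. F L) = F []"
proof -
  have "words 0 = {[] :: 'n list}" by auto
  then show ?thesis by simp
qed

lemma sum_words_append:
  fixes F :: "'n::finite list \<Rightarrow> 'a::comm_monoid_add"
  shows "(\<Sum>L\<in>words (j + k). F L) = (\<Sum>A\<in>words j. \<Sum>B\<in>words k. F (A @ B))"
  unfolding sum.cartesian_product
proof (intro sum.reindex_bij_witness[where i = "\<lambda>(A, B). A @ B" and j = "\<lambda>L. (take j L, drop j L)"])
qed auto

lemma sum_words_1: "(\<Sum>L\<in>words 1. F L) = (\<Sum>i\<in>UNIV. F [i])"
  by (intro sum.reindex_bij_witness[where i = "\<lambda>i. [i]" and j = hd]) (auto simp: length_Suc_conv)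

lemma sum_words_Suc:
  fixes F :: "'n::finite list \<Rightarrow> 'a::comm_monoid_add"
  shows "(\<Sum>L\<in>words (Suc k). F L) = (\<Sum>i\<in>UNIV. \<Sum>L\<in>words k. F (i # L))"
  using sum_words_append[of F 1 k] by (simp add: sum_words_1[simplified])

section \<open>Comultiplicative matrices\<close>

lemma bialgebraD:
  assumes "bialgebra H"
  shows "is_algebra H" "algebra_map_tensor H H H (comult H)" "algebra_map H base_field (counit H)"
    "is_space H" "linear_map H (tensor H H) (comult H)" "linear_map H base_field (counit H)"
    "counit H 1 = 1" "counit H (x * y) = counit H x * counit H y"
  using assms by (auto simp: bialgebra_def is_algebra_def algebra_map_tensor_def algebra_map_def)

text \<open>These are the coefficient matrices of the comodule structures on \<open>'k ^ 'n\<close>,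
  see \<open>matrix_comodule\<close> and \<open>comodule_matrix\<close>.\<close>

definition comult_matrix :: "('k::field, 'h::ring_1) hopf \<Rightarrow> ('n::finite \<Rightarrow> 'n \<Rightarrow> 'h) \<Rightarrow> bool" where
  "comult_matrix H x \<longleftrightarrow> (\<forall>i j. comult H (x i j) = (\<Sum>k\<in>UNIV. tens H H (x i k) (x k j))) \<and>
     (\<forall>i j. counit H (x i j) = of_bool (i = j))"

text \<open>If vectors \<open>e k\<close> are permuted by the coaction through a matrix
  \<open>x\<close>, both sides of coassociativity become expansions along the same
  \<open>e l\<close>, and the axiom reduces to comparing \<Delta>\<open>(c l)\<close> with the sum
  of the \<open>x l k\<close> \<otimes> \<open>c k\<close>. It serves for the comultiplication
  itself and for the passage between comodules and matrices in both directions.\<close>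

lemma coassoc_expansion:
  assumes V: "is_space V" and H: "is_space H" "carr H = UNIV"
    and \<rho>: "linear_map V (tensor V H) \<rho>" and \<Delta>: "linear_map H (tensor H H) \<Delta>"
    and e: "\<And>k. e k \<in> carr V" and v: "\<rho> v = (\<Sum>k\<in>A. tens V H (e k) (c k))"
    and e_\<rho>: "\<And>k. k \<in> A \<Longrightarrow> \<rho> (e k) = (\<Sum>l\<in>A. tens V H (e l) (x l k))"
  shows "tensor_assoc V H H (tensor_map V H (tensor V H) H \<rho> id (\<rho> v))
      = (\<Sum>l\<in>A. tens V (tensor H H) (e l) (\<Sum>k\<in>A. tens H H (x l k) (c k)))"
    and "tensor_map V H V (tensor H H) id \<Delta> (\<rho> v) = (\<Sum>l\<in>A. tens V (tensor H H) (e l) (\<Delta> (c l)))"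
proof -
  note sp = V H(1) is_space_tensor
  have "tensor_map V H (tensor V H) H \<rho> id (\<rho> v)
      = (\<Sum>k\<in>A. tens (tensor V H) H (\<Sum>l\<in>A. tens V H (e l) (x l k)) (c k))"
    unfolding v by (subst tensor_map_sum[OF sp(1,2,3,2) \<rho> linear_map_id(2)])
      (simp_all add: e e_\<rho> H(2) cong: sum.cong_simp)
  then have "tensor_assoc V H H (tensor_map V H (tensor V H) H \<rho> id (\<rho> v))
      = (\<Sum>k\<in>A. \<Sum>l\<in>A. tens V (tensor H H) (e l) (tens H H (x l k) (c k)))"
    by (simp add: tensor_assoc_sum[OF sp(1,2,2)] e H(2))
  also have "\<dots> = (\<Sum>l\<in>A. tens V (tensor H H) (e l) (\<Sum>k\<in>A. tens H H (x l k) (c k)))"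
    by (subst sum.swap) (simp add: tens_sum_right[OF sp(1,3)] tens_in[OF sp(2,2)] e H(2))
  finally show "tensor_assoc V H H (tensor_map V H (tensor V H) H \<rho> id (\<rho> v))
      = (\<Sum>l\<in>A. tens V (tensor H H) (e l) (\<Sum>k\<in>A. tens H H (x l k) (c k)))" .
  show "tensor_map V H V (tensor H H) id \<Delta> (\<rho> v) = (\<Sum>l\<in>A. tens V (tensor H H) (e l) (\<Delta> (c l)))"
    unfolding v by (subst tensor_map_sum[OF sp(1,2,1,3) linear_map_id(2) \<Delta>]) (simp_all add: e H(2))
qed

lemma comult_mon:
  assumes H: "is_algebra H" "algebra_map_tensor H H H (comult H)"
    and x: "\<And>i j. comult H (x i j) = (\<Sum>k\<in>UNIV. tens H H (x i k) (x k j))"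
    and "length I = length J"
  shows "comult H (mon x I J) = (\<Sum>L\<in>words (length I). tens H H (mon x I L) (mon x L J))"
  using assms(4)
proof (induction I J rule: list_induct2)
  case Nil
  then show ?case using H(2) by (simp add: sum_words_0 algebra_map_tensor_def del: sum_constant)
next
  case (Cons i I j J)
  have "comult H (mon x (i # I) (j # J)) = tensor_mult H H (comult H (x i j)) (comult H (mon x I J))"
    using H(2) by (simp add: algebra_map_tensor_def)
  also have "\<dots> = (\<Sum>k\<in>UNIV. \<Sum>L\<in>words (length I). tens H H (x i k * mon x I L) (x k j * mon x L J))"
    unfolding x Cons by (rule tensor_mult_sum[OF H(1,1)])
  finally show ?case by (simp add: sum_words_Suc)
qed

lemma counit_mon:
  assumes H: "algebra_map H base_field (counit H)" and x: "\<And>i j. counit H (x i j) = of_bool (i = j)"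
    and "length I = length J"
  shows "counit H (mon x I J) = of_bool (I = J)"
  using assms(3)
  by (induction I J rule: list_induct2) (use H in \<open>auto simp: x algebra_map_def\<close>)

section \<open>The Hopf algebra \<open>A\<^sub>s(n)\<close>\<close>

lemma qperm_simps [simp]: "carr qperm = UNIV" "smul qperm = qperm_scale"
  "comult qperm = qperm_comult" "counit qperm = qperm_counit" "antipode qperm = qperm_antipode"
  by (simp_all add: qperm_def)

text \<open>The structure maps are defined over the bare space because \<open>qperm\<close> is
  assembled from them. The two records agree in \<open>carr\<close> and \<open>smul\<close>, and the
  linear notions see nothing else.\<close>

lemma qperm_space_eq:
  "linear_map qperm_space W = linear_map qperm W" "linear_map V qperm_space = linear_map V qperm"
  by (simp_all add: linear_map_def fun_eq_iff)

lemma tens_qperm_space: "tens qperm_space qperm_space = tens qperm qperm"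
  by (simp add: tens_def bilinear_map_def qperm_space_eq fun_eq_iff)

lemma tensor_qperm_space: "tensor qperm_space qperm_space = tensor qperm qperm"
  by (simp add: tensor_def tens_qperm_space)

lemma tensor_mult_qperm_space: "tensor_mult qperm_space qperm_space = tensor_mult qperm qperm"
  by (simp add: tensor_mult_def tensor_lift_def tens_qperm_space fun_eq_iff)

lemma is_algebra_qperm: "is_algebra qperm"
  using is_algebra_qperm_space by (simp add: is_algebra_def is_space_def)

lemma is_space_qperm: "is_space qperm"
  by (rule is_algebraD(1)[OF is_algebra_qperm])

lemma is_algebra_base_field: "is_algebra base_field"
  by (simp add: is_algebra_def is_space_base_field)

lemma qperm_comult_spec:
  "algebra_map_tensor qperm qperm qperm (qperm_comult :: ('k::field, 'n::finite) qperm_algebra \<Rightarrow> _)"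
  "qperm_comult (qperm_gen i j :: ('k, 'n) qperm_algebra) = (\<Sum>k\<in>UNIV. tens qperm qperm (qperm_gen i k) (qperm_gen k j))"
proof -
  let ?Q = "qperm_space :: ('k, ('k, 'n) qperm_algebra) vspace"
  note A = is_algebra_qperm_space and sp = is_algebraD(1)[OF is_algebra_qperm_space]
  define t :: "'n \<Rightarrow> 'n \<Rightarrow> _" where "t i j = (\<Sum>k\<in>UNIV. tens ?Q ?Q (qperm_gen i k) (qperm_gen k j))" for i j
  have z: "tens ?Q ?Q 0 y = 0" "tens ?Q ?Q y 0 = 0" for y
    by (simp_all add: tens_zero_left[OF sp sp] tens_zero_right[OF sp sp])
  have d: "tens ?Q ?Q (if a then x else 0) y = (if a then tens ?Q ?Q x y else 0)"
    "tens ?Q ?Q y (if a then x else 0) = (if a then tens ?Q ?Q y x else 0)" for a x y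
    by (simp_all add: z)
  \<comment> \<open>The candidate matrix \<open>t\<close> satisfies the defining relations again. In
    \<open>t1\<close> the left tensor factors reduce the double sum to its diagonal and the right
    factors then produce \<open>i = j\<close>; in \<open>t2\<close> the two factors exchange
    roles.\<close>
  have t1: "tensor_mult ?Q ?Q (t k i) (t k j) = (if i = j then t k i else 0)" for i j k
    unfolding t_def tensor_mult_sum[OF A A]
    by (cases "i = j") (simp_all add: qperm_gen_relations(1) d tens_zero_right[OF sp sp])
  have t2: "tensor_mult ?Q ?Q (t i k) (t j k) = (if i = j then t i k else 0)" for i j k
    unfolding t_def tensor_mult_sum[OF A A]
    by (cases "i = j") (simp_all add: qperm_gen_relations(3) d tens_zero_left[OF sp sp])
  have t3: "(\<Sum>l\<in>UNIV. t i l) = tens ?Q ?Q 1 1" for i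
    unfolding t_def
    by (subst sum.swap) (simp add: tens_sum_right[OF sp sp, symmetric] tens_sum_left[OF sp sp, symmetric] qperm_gen_relations)
  have t4: "(\<Sum>l\<in>UNIV. t l i) = tens ?Q ?Q 1 1" for i
    unfolding t_def
    by (subst sum.swap) (simp add: tens_sum_right[OF sp sp, symmetric] tens_sum_left[OF sp sp, symmetric] qperm_gen_relations)
  have t_in: "t i j \<in> carr (tensor ?Q ?Q)" for i j
    unfolding t_def by (intro space_sum is_space_tensor tens_in sp) auto
  note spec = theI'[OF ex1_qperm_hom[OF algebra_on_tensor[OF A A] t_in t1 t3 t2 t4],
      folded algebra_map_tensor_def, unfolded t_def, folded qperm_comult_def]
  show "algebra_map_tensor qperm qperm qperm (qperm_comult :: ('k, 'n) qperm_algebra \<Rightarrow> _)"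
    "qperm_comult (qperm_gen i j :: ('k, 'n) qperm_algebra) = (\<Sum>k\<in>UNIV. tens qperm qperm (qperm_gen i k) (qperm_gen k j))"
    using spec by (simp_all add: algebra_map_tensor_def qperm_space_eq tens_qperm_space tensor_qperm_space
        tensor_mult_qperm_space)
qed

lemma qperm_comult_linear: "linear_map qperm (tensor qperm qperm) qperm_comult"
  using qperm_comult_spec(1) unfolding algebra_map_tensor_def by blast

lemma qperm_counit_spec:
  "algebra_map qperm base_field (qperm_counit :: ('k::field, 'n::finite) qperm_algebra \<Rightarrow> _)"
  "qperm_counit (qperm_gen i j :: ('k, 'n) qperm_algebra) = of_bool (i = j)"
proof -
  define t :: "'n \<Rightarrow> 'n \<Rightarrow> 'k" where "t i j = (if i = j then 1 else 0)" for i j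
  have t: "t i j \<in> carr base_field" "t k i * t k j = (if i = j then t k i else 0)" "(\<Sum>l\<in>UNIV. t i l) = 1"
    "t i k * t j k = (if i = j then t i k else 0)" "(\<Sum>l\<in>UNIV. t l i) = 1" for i j k
    by (simp_all add: t_def)
  note spec = theI'[OF ex1_qperm_hom[OF algebra_on_algebra[OF is_algebra_base_field] t],
      folded algebra_map_def, unfolded t_def, folded qperm_counit_def]
  show "algebra_map qperm base_field (qperm_counit :: ('k, 'n) qperm_algebra \<Rightarrow> _)"
    "qperm_counit (qperm_gen i j :: ('k, 'n) qperm_algebra) = of_bool (i = j)"
    using spec by (simp_all add: algebra_map_def qperm_space_eq)
qed

lemma qperm_counit_linear: "linear_map qperm base_field qperm_counit"
  using qperm_counit_spec(1) unfolding algebra_map_def by blast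

lemma qperm_antipode_spec:
  "linear_map qperm qperm (qperm_antipode :: ('k::field, 'n::finite) qperm_algebra \<Rightarrow> _)"
  "qperm_antipode (1 :: ('k, 'n) qperm_algebra) = 1"
  "qperm_antipode (x * y :: ('k, 'n) qperm_algebra) = qperm_antipode y * qperm_antipode x"
  "qperm_antipode (qperm_gen i j :: ('k, 'n) qperm_algebra) = qperm_gen j i"
proof -
  let ?Q = "qperm_space :: ('k, ('k, 'n) qperm_algebra) vspace"
  define t :: "'n \<Rightarrow> 'n \<Rightarrow> ('k, 'n) qperm_algebra" where "t i j = qperm_gen j i" for i j
  have t: "t i j \<in> carr ?Q" "t k j * t k i = (if i = j then t k i else 0)" "(\<Sum>l\<in>UNIV. t i l) = 1"
    "t j k * t i k = (if i = j then t i k else 0)" "(\<Sum>l\<in>UNIV. t l i) = 1" for i j k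
    by (auto simp: t_def qperm_gen_relations)
  note spec = theI'[OF ex1_qperm_hom[OF algebra_on_opposite[OF algebra_on_algebra[OF is_algebra_qperm_space]] t],
      unfolded t_def conj_assoc, folded qperm_antipode_def]
  show "linear_map qperm qperm (qperm_antipode :: ('k, 'n) qperm_algebra \<Rightarrow> _)"
    "qperm_antipode (1 :: ('k, 'n) qperm_algebra) = 1"
    "qperm_antipode (x * y :: ('k, 'n) qperm_algebra) = qperm_antipode y * qperm_antipode x"
    "qperm_antipode (qperm_gen i j :: ('k, 'n) qperm_algebra) = qperm_gen j i"
    using spec by (simp_all add: qperm_space_eq)
qed

lemmas qperm_linear_eqI' = qperm_linear_eqI[unfolded qperm_space_eq]

lemma qperm_comult_mon:
  "length I = length J \<Longrightarrow>
    qperm_comult (qmon I J) = (\<Sum>L\<in>words (length I). tens qperm qperm (qmon I L) (qmon L J))"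
  using comult_mon[of qperm qperm_gen I J]
  by (simp add: is_algebra_qperm qperm_comult_spec)

lemma qperm_counit_mon: "length I = length J \<Longrightarrow> qperm_counit (qmon I J) = of_bool (I = J)"
  using counit_mon[of qperm qperm_gen I J] by (simp add: qperm_counit_spec)

lemma qperm_antipode_mon: "length I = length J \<Longrightarrow> qperm_antipode (qmon I J) = qmon (rev J) (rev I)"
  by (induction I J rule: list_induct2) (simp_all add: qperm_antipode_spec mon_append)

text \<open>In view of \<open>qperm_antipode_mon\<close> this is \<open>S(U) U = 1\<close> for a
  tensor power \<open>U\<close> of the fundamental matrix. The antipode reverses words, so the first
  letters meet in the middle of the product and are removed there by the relations.\<close>

lemma sum_qmon_left:
  fixes I J :: "'n::finite list"
  assumes "length I = length J"
  shows "(\<Sum>L\<in>words (length I). qmon (rev L) (rev I) * qmon L J) = (of_bool (I = J) :: ('k::field, 'n) qperm_algebra)"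
  using assms
proof (induction I J rule: list_induct2)
  case (Cons i I j J)
  have "(\<Sum>L\<in>words (length (i # I)). qmon (rev L) (rev (i # I)) * qmon L (j # J) :: ('k, 'n) qperm_algebra)
    = (\<Sum>k\<in>UNIV. \<Sum>L\<in>words (length I).
        qmon (rev L) (rev I) * (qperm_gen k i * qperm_gen k j) * qmon L J)"
    by (simp add: sum_words_Suc mon_append mult.assoc Cons.hyps cong: sum.cong_simp)
  also have "\<dots> = (\<Sum>L\<in>words (length I). qmon (rev L) (rev I) *
        (\<Sum>k\<in>UNIV. qperm_gen k i * qperm_gen k j) * qmon L J)"
    by (subst sum.swap) (simp add: sum_distrib_left sum_distrib_right)
  also have "(\<Sum>k\<in>UNIV. qperm_gen k i * qperm_gen k j) = (of_bool (i = j) :: ('k, 'n) qperm_algebra)"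
    by (simp add: qperm_gen_relations)
  finally show ?case using Cons.IH by auto
qed (simp add: sum_words_0 del: sum_constant)

text \<open>This is \<open>U S(U) = 1\<close>. Here the first letters stand outermost, so the
  induction hypothesis is applied inside and the relations afterwards.\<close>

lemma sum_qmon_right:
  fixes I J :: "'n::finite list"
  assumes "length I = length J"
  shows "(\<Sum>L\<in>words (length I). qmon I L * qmon (rev J) (rev L)) = (of_bool (I = J) :: ('k::field, 'n) qperm_algebra)"
  using assms
proof (induction I J rule: list_induct2)
  case (Cons i I j J)
  have "(\<Sum>L\<in>words (length (i # I)). qmon (i # I) L * qmon (rev (j # J)) (rev L) :: ('k, 'n) qperm_algebra)
    = (\<Sum>k\<in>UNIV. \<Sum>L\<in>words (length I).
        qperm_gen i k * (qmon I L * qmon (rev J) (rev L)) * qperm_gen j k)"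
    by (simp add: sum_words_Suc mon_append mult.assoc Cons.hyps cong: sum.cong_simp)
  also have "\<dots> = (\<Sum>k\<in>UNIV. qperm_gen i k *
        (\<Sum>L\<in>words (length I). qmon I L * qmon (rev J) (rev L)) * qperm_gen j k)"
    by (simp add: sum_distrib_left sum_distrib_right)
  also have "\<dots> = of_bool (i = j \<and> I = J)"
    unfolding Cons.IH by (simp add: qperm_gen_relations)
  finally show ?case by simp
qed (simp add: sum_words_0 del: sum_constant)

lemma bilinear_qperm_antipode:
  "bilinear_map qperm qperm qperm (\<lambda>a b. qperm_antipode a * b)"
  "bilinear_map qperm qperm qperm (\<lambda>a b. a * qperm_antipode b)"
  using bilinear_comp[OF bilinear_mult[OF is_algebra_qperm] qperm_antipode_spec(1) linear_map_id(1) linear_map_id(1)]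
    bilinear_comp[OF bilinear_mult[OF is_algebra_qperm] linear_map_id(1) qperm_antipode_spec(1) linear_map_id(1)]
  by simp_all

section \<open>Verification of the bialgebra and antipode axioms\<close>

lemma bialgebra_qperm: "bialgebra (qperm :: ('k::field, ('k, 'n::finite) qperm_algebra) hopf)"
proof -
  let ?Q = "qperm :: ('k, ('k, 'n) qperm_algebra) hopf"
  note sp = is_space_qperm is_space_tensor
  have \<Delta>: "linear_map ?Q (tensor ?Q ?Q) qperm_comult"
    by (rule qperm_comult_linear)
  have \<epsilon>: "linear_map ?Q base_field qperm_counit"
    by (rule qperm_counit_linear)
  have Ul: "linear_map (tensor ?Q ?Q) (tensor (tensor ?Q ?Q) ?Q) (tensor_map ?Q ?Q (tensor ?Q ?Q) ?Q qperm_comult id)"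
    and Ur: "linear_map (tensor ?Q ?Q) (tensor ?Q (tensor ?Q ?Q)) (tensor_map ?Q ?Q ?Q (tensor ?Q ?Q) id qperm_comult)"
    by (intro tensor_map_linear sp \<Delta> linear_map_id)+
  have coassoc: "tensor_assoc ?Q ?Q ?Q (tensor_map ?Q ?Q (tensor ?Q ?Q) ?Q qperm_comult id (qperm_comult x))
          = tensor_map ?Q ?Q ?Q (tensor ?Q ?Q) id qperm_comult (qperm_comult x)" for x
  proof (rule qperm_linear_eqI'[where x = x])
    show "linear_map ?Q (tensor ?Q (tensor ?Q ?Q))
      (\<lambda>x. tensor_assoc ?Q ?Q ?Q (tensor_map ?Q ?Q (tensor ?Q ?Q) ?Q qperm_comult id (qperm_comult x)))"
      by (rule linear_map_comp[OF linear_map_comp[OF \<Delta> Ul] tensor_assoc_linear[OF sp(1,1,1)]])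
    show "linear_map ?Q (tensor ?Q (tensor ?Q ?Q))
      (\<lambda>x. tensor_map ?Q ?Q ?Q (tensor ?Q ?Q) id qperm_comult (qperm_comult x))"
      by (rule linear_map_comp[OF \<Delta> Ur])
    fix I J :: "'n list" assume l: "length I = length J"
    have inQ: "qmon I M \<in> carr ?Q" for M by simp
    have e_\<Delta>: "qperm_comult (qmon I M) = (\<Sum>L\<in>words (length I). tens ?Q ?Q (qmon I L) (qmon L M))"
      if "M \<in> words (length I)" for M
      using that by (simp add: qperm_comult_mon)
    \<comment> \<open>The entries in row \<open>I\<close> of a tensor power play the part of the
      vectors \<open>e k\<close>, the entries in column \<open>J\<close> that of the coefficients
      \<open>c k\<close>.\<close>
    note expansion = coassoc_expansion[OF sp(1,1) qperm_simps(1) \<Delta> \<Delta> inQ qperm_comult_mon[OF l]]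
    show "tensor_assoc ?Q ?Q ?Q (tensor_map ?Q ?Q (tensor ?Q ?Q) ?Q qperm_comult id (qperm_comult (qmon I J)))
      = tensor_map ?Q ?Q ?Q (tensor ?Q ?Q) id qperm_comult (qperm_comult (qmon I J))"
      by (subst expansion(1), erule e_\<Delta>, subst expansion(2), erule e_\<Delta>)
        (use l in \<open>simp add: qperm_comult_mon cong: sum.cong_simp\<close>)
  qed
  have bl: "bilinear_map ?Q ?Q ?Q (\<lambda>a b. qperm_scale (qperm_counit a) b)"
    and br: "bilinear_map ?Q ?Q ?Q (\<lambda>a b. qperm_scale (qperm_counit b) a)"
    using linear_map_smul[OF sp(1) linear_map_id(1)] linear_map_smul_left[OF sp(1) \<epsilon>]
    by (auto intro!: bilinear_mapI)
  have "tensor_lift ?Q ?Q (\<lambda>a b. qperm_scale (qperm_counit a) b) (qperm_comult x) = x" for x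
  proof (rule qperm_linear_eqI'[where x = x, OF linear_map_comp[OF \<Delta> tensor_lift_linear[OF sp(1,1) bl]] linear_map_id(1)])
    fix I J :: "'n list" assume l: "length I = length J"
    show "tensor_lift ?Q ?Q (\<lambda>a b. qperm_scale (qperm_counit a) b) (qperm_comult (qmon I J)) = qmon I J"
      unfolding qperm_comult_mon[OF l]
      by (subst tensor_lift_sum[OF sp(1,1,1) bl])
        (simp_all add: qperm_counit_mon of_bool_def if_distrib[of "\<lambda>c. qperm_scale c _"]
          space_smul_simps[OF is_space_qperm, simplified] cong: if_cong)
  qed
  moreover have "tensor_lift ?Q ?Q (\<lambda>a b. qperm_scale (qperm_counit b) a) (qperm_comult x) = x" for x
  proof (rule qperm_linear_eqI'[where x = x, OF linear_map_comp[OF \<Delta> tensor_lift_linear[OF sp(1,1) br]] linear_map_id(1)])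
    fix I J :: "'n list" assume l: "length I = length J"
    show "tensor_lift ?Q ?Q (\<lambda>a b. qperm_scale (qperm_counit b) a) (qperm_comult (qmon I J)) = qmon I J"
      unfolding qperm_comult_mon[OF l]
      by (subst tensor_lift_sum[OF sp(1,1,1) br])
        (simp_all add: qperm_counit_mon of_bool_def if_distrib[of "\<lambda>c. qperm_scale c _"] l
          space_smul_simps[OF is_space_qperm, simplified] cong: if_cong)
  qed
  ultimately show ?thesis
    by (simp add: bialgebra_def is_algebra_qperm qperm_comult_spec qperm_counit_spec coassoc)
qed

lemma hopf_algebra_qperm: "hopf_algebra (qperm :: ('k::field, ('k, 'n::finite) qperm_algebra) hopf)"
proof -
  let ?Q = "qperm :: ('k, ('k, 'n) qperm_algebra) hopf"
  note sp = is_space_qperm is_space_tensor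
  have \<Delta>: "linear_map ?Q (tensor ?Q ?Q) qperm_comult"
    by (rule qperm_comult_linear)
  have \<epsilon>: "linear_map ?Q base_field qperm_counit"
    by (rule qperm_counit_linear)
  have \<epsilon>1: "linear_map ?Q ?Q (\<lambda>x. qperm_scale (qperm_counit x) 1)"
    using linear_map_smul_left[OF sp(1) \<epsilon>, of 1] by simp
  note bil = bilinear_qperm_antipode
  have "tensor_lift ?Q ?Q (\<lambda>a b. qperm_antipode a * b) (qperm_comult x) = qperm_scale (qperm_counit x) 1" for x
  proof (rule qperm_linear_eqI'[where x = x, OF linear_map_comp[OF \<Delta> tensor_lift_linear[OF sp(1,1) bil(1)]] \<epsilon>1])
    fix I J :: "'n list" assume l: "length I = length J"
    show "tensor_lift ?Q ?Q (\<lambda>a b. qperm_antipode a * b) (qperm_comult (qmon I J)) = qperm_scale (qperm_counit (qmon I J)) 1"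
      unfolding qperm_comult_mon[OF l] qperm_counit_mon[OF l]
      by (subst tensor_lift_sum[OF sp(1,1,1) bil(1)])
        (simp_all add: qperm_antipode_mon sum_qmon_left[OF l] space_smul_simps[OF is_space_qperm, simplified])
  qed
  moreover have "tensor_lift ?Q ?Q (\<lambda>a b. a * qperm_antipode b) (qperm_comult x) = qperm_scale (qperm_counit x) 1" for x
  proof (rule qperm_linear_eqI'[where x = x, OF linear_map_comp[OF \<Delta> tensor_lift_linear[OF sp(1,1) bil(2)]] \<epsilon>1])
    fix I J :: "'n list" assume l: "length I = length J"
    show "tensor_lift ?Q ?Q (\<lambda>a b. a * qperm_antipode b) (qperm_comult (qmon I J)) = qperm_scale (qperm_counit (qmon I J)) 1"
      unfolding qperm_comult_mon[OF l] qperm_counit_mon[OF l]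
      by (subst tensor_lift_sum[OF sp(1,1,1) bil(2)])
        (simp_all add: qperm_antipode_mon l[symmetric] sum_qmon_right[OF l] space_smul_simps[OF is_space_qperm, simplified])
  qed
  ultimately show ?thesis
    by (simp add: hopf_algebra_def bialgebra_qperm qperm_antipode_spec)
qed

section \<open>Comodules as modules over the dual algebra\<close>

lemma tensor_lift_tensor_map:
  assumes V: "is_space V" and W: "is_space W" and V1: "is_space V1" and W1: "is_space W1" and U: "is_space U"
    and f: "linear_map V V1 f" and g: "linear_map W W1 g" and \<phi>: "bilinear_map V1 W1 U \<phi>"
    and t: "t \<in> carr (tensor V W)"
  shows "tensor_lift V1 W1 \<phi> (tensor_map V W V1 W1 f g t) = tensor_lift V W (\<lambda>v w. \<phi> (f v) (g w)) t"
proof -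
  have b: "bilinear_map V W U (\<lambda>v w. \<phi> (f v) (g w))"
    using bilinear_comp[OF \<phi> f g linear_map_id(1)] by simp
  show ?thesis
  proof (rule tensor_eqI[OF V W linear_map_comp[OF tensor_map_linear[OF V V1 W1 f g] tensor_lift_linear[OF V1 U \<phi>]]
      tensor_lift_linear[OF V U b] _ t])
    fix v w assume "v \<in> carr V" "w \<in> carr W"
    then show "tensor_lift V1 W1 \<phi> (tensor_map V W V1 W1 f g (tens V W v w))
      = tensor_lift V W (\<lambda>v w. \<phi> (f v) (g w)) (tens V W v w)"
      using linear_map_in[OF f] linear_map_in[OF g]
      by (simp add: tensor_map_tens[OF V1 W1 f g] tensor_lift_tens[OF U \<phi>] tensor_lift_tens[OF U b])
  qed
qed

text \<open>All right-hand factors are expanded along one basis of \<open>W\<close>. Independence of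
  \<open>F\<close> lets dual functionals read off the coefficients \<open>g b\<close>.\<close>

lemma tensor_basis_right:
  fixes W :: "('k::field, 'w::ab_group_add, 'l) vspace_scheme"
  assumes V: "is_space V" and W: "is_space W" "carr W = UNIV" and t: "t \<in> carr (tensor V W)"
  obtains F g where "finite F" "\<not> module.dependent (smul W) F" "\<And>b. g b \<in> carr V"
    "t = (\<Sum>b\<in>F. tens V W (g b) b)"
proof -
  interpret W: vector_space "smul W" using W(1) by (rule space_vs)
  define B where "B = W.extend_basis {}"
  have ind: "W.independent B" and sp: "W.span B = UNIV" by (simp_all add: B_def W.independent_extend_basis W.span_extend_basis W.independent_empty)
  \<comment> \<open>The coefficients vanish outside \<open>F\<close>, so that two expansions can be
    added over the union of their index sets.\<close>
  have "\<exists>F g. finite F \<and> F \<subseteq> B \<and> (\<forall>b. g b \<in> carr V) \<and> (\<forall>b. b \<notin> F \<longrightarrow> g b = 0) \<and>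
      t = (\<Sum>b\<in>F. tens V W (g b) b)"
    using t
  proof (induction rule: tensor_induct)
    case (tens v w)
    have "w \<in> W.span B" by (simp add: sp)
    then obtain F r where F: "finite F" "F \<subseteq> B" "w = (\<Sum>b\<in>F. smul W (r b) b)"
      by (auto simp: W.span_explicit)
    define g where "g b = (if b \<in> F then smul V (r b) v else 0)" for b
    have "tens V W v w = (\<Sum>b\<in>F. tens V W (g b) b)"
      unfolding F(3) using tens V W
      by (simp add: tens_sum_right tens_scale_right tens_scale_left g_def cong: sum.cong_simp)
    moreover have "g b \<in> carr V" for b using tens V by (simp add: g_def space_scale space_zero)
    ultimately show ?case using F by (intro exI[of _ F] exI[of _ g]) (auto simp: g_def)
  next
    case (add s t)
    then obtain F g F' g' where F: "finite F" "F \<subseteq> B" "\<forall>b. g b \<in> carr V" "\<forall>b. b \<notin> F \<longrightarrow> g b = 0"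
        "s = (\<Sum>b\<in>F. tens V W (g b) b)"
      and F': "finite F'" "F' \<subseteq> B" "\<forall>b. g' b \<in> carr V" "\<forall>b. b \<notin> F' \<longrightarrow> g' b = 0"
        "t = (\<Sum>b\<in>F'. tens V W (g' b) b)" by blast
    have "s = (\<Sum>b\<in>F \<union> F'. tens V W (g b) b)" "t = (\<Sum>b\<in>F \<union> F'. tens V W (g' b) b)"
      unfolding F(5) F'(5) using F F' W
      by (auto intro!: sum.mono_neutral_left simp: tens_zero_left[OF V W(1)])
    then have "s + t = (\<Sum>b\<in>F \<union> F'. tens V W (g b + g' b) b)"
      using F F' W linear_map_add[OF linear_tens_left[OF V W(1)]] by (simp add: sum.distrib)
    then show ?case using F F' V
      by (intro exI[of _ "F \<union> F'"] exI[of _ "\<lambda>b. g b + g' b"]) (auto simp: space_add)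
  qed (use V W in auto)
  then obtain F g where "finite F" "F \<subseteq> B" "\<forall>b. g b \<in> carr V" "t = (\<Sum>b\<in>F. tens V W (g b) b)" by blast
  then show thesis using that W.independent_mono[OF ind] by metis
qed

lemma dual_functional:
  fixes W :: "('k::field, 'w::ab_group_add, 'l) vspace_scheme"
  assumes W: "is_space W" and ind: "\<not> module.dependent (smul W) F" and c: "c \<in> F"
  obtains f where "linear_map W base_field f" "\<And>b. b \<in> F \<Longrightarrow> f b = (if b = c then 1 else 0)"
proof -
  interpret P: vector_space_pair "smul W" "(*) :: 'k \<Rightarrow> _"
    using space_vs[OF W] by (simp add: vector_space_pair_def vector_space_over_itself.vector_space_axioms)
  interpret L: Vector_Spaces.linear "smul W" "(*)" "P.construct F (\<lambda>b. if b = c then 1 else 0)"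
    using ind by (rule P.linear_construct)
  show thesis
  proof
    show "linear_map W base_field (P.construct F (\<lambda>b. if b = c then 1 else 0))"
      by (simp add: linear_map_def L.add L.scale)
  qed (use P.construct_basis[OF ind] in simp)
qed

lemma ex_linear_projection:
  fixes V :: "('k::field, 'v::ab_group_add, 'm) vspace_scheme"
  assumes V: "is_space V" and N: "module.subspace (smul V) N" "N \<subseteq> carr V"
  obtains p where "linear_map V V p" "\<And>v. p v \<in> N" "\<And>v. v \<in> N \<Longrightarrow> p v = v"
proof -
  interpret P: vector_space_pair "smul V" "smul V"
    using space_vs[OF V] by (simp add: vector_space_pair_def)
  obtain B where B: "B \<subseteq> N" "P.vs1.independent B" "N \<subseteq> P.vs1.span B"
    by (rule P.vs1.maximal_independent_subset)
  have NB: "N = P.vs1.span B"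
    using B(3) P.vs1.span_minimal[OF B(1) N(1)] by (rule equalityI)
  interpret L: Vector_Spaces.linear "smul V" "smul V" "P.construct B id"
    using B(2) by (rule P.linear_construct)
  have in_N: "P.construct B id v \<in> N" for v
    using P.construct_in_span[OF B(2), of id v] by (simp add: NB)
  show thesis
  proof
    show "linear_map V V (P.construct B id)"
      using in_N N(2) by (auto simp: linear_map_def L.add L.scale)
    show "P.construct B id v = v" if "v \<in> N" for v
      using that unfolding NB
    proof (induction rule: P.vs1.span_induct_alt)
      case (step c x y)
      then show ?case by (simp only: L.add L.scale P.construct_basis[OF B(2)] step.IH) simp
    qed (rule L.zero)
  qed (rule in_N)
qed

text \<open>In Sweedler notation this is \<open>f(v_1) v_0\<close>, the left action of the dual
  algebra attached to a right comodule.\<close>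

definition act ::
  "('k::field, 'h::ring_1) hopf \<Rightarrow> ('k, 'v::ab_group_add, 'm) vspace_scheme
     \<Rightarrow> ('v \<Rightarrow> ('k, 'v, 'h) tensors) \<Rightarrow> ('h \<Rightarrow> 'k) \<Rightarrow> 'v \<Rightarrow> 'v" where
  "act H V \<rho> f v = tensor_lift V H (\<lambda>w h. smul V (f h) w) (\<rho> v)"

locale right_comodule =
  fixes H :: "('k::field, 'h::ring_1) hopf" and V :: "('k, 'v::ab_group_add, 'm) vspace_scheme"
    and \<rho> :: "'v \<Rightarrow> ('k, 'v, 'h) tensors"
  assumes H: "bialgebra H" and comod: "comodule H V \<rho>"
begin

abbreviation "\<Delta> \<equiv> comult H"
abbreviation "dual f \<equiv> linear_map H base_field f"

lemma spH: "is_space H" and spV: "is_space V" and carrH [simp]: "carr H = UNIV"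
  and \<Delta>_lin: "linear_map H (tensor H H) \<Delta>" and \<rho>_lin: "linear_map V (tensor V H) \<rho>"
  and counit_dual: "dual (counit H)"
  using bialgebraD[OF H] is_algebraD(2)[of H] comod by (auto simp: comodule_def)

lemma \<rho>_in: "v \<in> carr V \<Longrightarrow> \<rho> v \<in> carr (tensor V H)"
  by (rule linear_map_in[OF \<rho>_lin])

lemma \<Delta>_in: "\<Delta> h \<in> carr (tensor H H)"
  by (rule linear_map_in[OF \<Delta>_lin]) simp

text \<open>Coassociativity in the form behind Sweedler notation: an expression trilinear in
  \<open>x_0\<close>, \<open>x_1\<close>, \<open>x_2\<close> has the same value whether the three
  parts arise from \<rho> applied twice or from \<rho> followed by \<Delta>.\<close>

lemma coassoc_trilinear:
  assumes U: "is_space U" and \<tau>: "\<And>v. v \<in> carr V \<Longrightarrow> bilinear_map H H U (\<tau> v)"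
    and \<tau>': "\<And>a b. linear_map V U (\<lambda>v. \<tau> v a b)" and x: "x \<in> carr V"
  shows "tensor_lift V H (\<lambda>v h. tensor_lift V H (\<lambda>w a. \<tau> w a h) (\<rho> v)) (\<rho> x)
    = tensor_lift V H (\<lambda>v h. tensor_lift H H (\<tau> v) (\<Delta> h)) (\<rho> x)"
proof -
  note sp = spV spH is_space_tensor
  \<comment> \<open>\<Omega> and \<Phi> are the bilinear maps that \<tau> induces for the two
    bracketings of the threefold tensor product; \<open>assoc\<close> says that
    \<open>tensor_assoc\<close> identifies their lifts.\<close>
  define \<Omega> where "\<Omega> v t = tensor_lift H H (\<tau> v) t" for v t
  have \<Omega>: "bilinear_map V (tensor H H) U \<Omega>"
    unfolding \<Omega>_def
    by (intro bilinear_mapI tensor_lift_linear linear_tensor_lift_param sp U \<tau> \<tau>')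
  have \<tau>1: "bilinear_map V H U (\<lambda>w a. \<tau> w a h)" for h
    by (intro bilinear_mapI \<tau>' bilinear_left[OF \<tau>]) simp_all
  define \<Phi> where "\<Phi> t h = tensor_lift V H (\<lambda>w a. \<tau> w a h) t" for t h
  have \<Phi>: "bilinear_map (tensor V H) H U \<Phi>"
    unfolding \<Phi>_def
    by (intro bilinear_mapI tensor_lift_linear linear_tensor_lift_param sp U \<tau>1 bilinear_right[OF \<tau>]) simp_all
  have assoc: "tensor_lift V (tensor H H) \<Omega> (tensor_assoc V H H s) = tensor_lift (tensor V H) H \<Phi> s"
    if s: "s \<in> carr (tensor (tensor V H) H)" for s
  proof (rule tensor_eqI[OF sp(3,2) linear_map_comp[OF tensor_assoc_linear[OF sp(1,2,2)] tensor_lift_linear[OF sp(1) U \<Omega>]]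
      tensor_lift_linear[OF sp(3) U \<Phi>] _ s])
    fix t h assume t: "t \<in> carr (tensor V H)" and h: "h \<in> carr H"
    have "tensor_lift V (tensor H H) \<Omega> (tensor_assoc V H H (tens (tensor V H) H t h)) = \<Phi> t h"
    proof (rule tensor_eqI[OF sp(1,2) linear_map_comp[OF linear_tens_left[OF sp(3,2) h]
        linear_map_comp[OF tensor_assoc_linear[OF sp(1,2,2)] tensor_lift_linear[OF sp(1) U \<Omega>]]] bilinear_left[OF \<Phi> h] _ t])
      fix v a assume v: "v \<in> carr V" and a: "a \<in> carr H"
      have "tens H H a h \<in> carr (tensor H H)" using a h by (intro tens_in sp)
      then show "tensor_lift V (tensor H H) \<Omega> (tensor_assoc V H H (tens (tensor V H) H (tens V H v a) h))
          = \<Phi> (tens V H v a) h"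
        using v a h
        by (simp add: tensor_assoc_tens[OF sp(1,2,2)] tensor_lift_tens[OF U \<Omega>])
          (simp add: \<Omega>_def \<Phi>_def tensor_lift_tens[OF U \<tau>] tensor_lift_tens[OF U \<tau>1])
    qed
    then show "tensor_lift V (tensor H H) \<Omega> (tensor_assoc V H H (tens (tensor V H) H t h))
        = tensor_lift (tensor V H) H \<Phi> (tens (tensor V H) H t h)"
      by (simp add: tensor_lift_tens[OF U \<Phi> t h])
  qed
  have r: "tensor_map V H (tensor V H) H \<rho> id (\<rho> x) \<in> carr (tensor (tensor V H) H)"
    by (rule linear_map_in[OF tensor_map_linear[OF sp(1,3,2) \<rho>_lin linear_map_id(2)] \<rho>_in[OF x]])
  have "tensor_lift V H (\<lambda>v h. \<Phi> (\<rho> v) (id h)) (\<rho> x)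
    = tensor_lift (tensor V H) H \<Phi> (tensor_map V H (tensor V H) H \<rho> id (\<rho> x))"
    by (rule tensor_lift_tensor_map[symmetric, OF sp(1,2,3,2) U \<rho>_lin linear_map_id(2) \<Phi> \<rho>_in[OF x]])
  also have "\<dots> = tensor_lift V (tensor H H) \<Omega> (tensor_assoc V H H (tensor_map V H (tensor V H) H \<rho> id (\<rho> x)))"
    by (rule assoc[OF r, symmetric])
  also have "tensor_assoc V H H (tensor_map V H (tensor V H) H \<rho> id (\<rho> x))
    = tensor_map V H V (tensor H H) id \<Delta> (\<rho> x)"
    using comod x by (simp add: comodule_def)
  also have "tensor_lift V (tensor H H) \<Omega> \<dots> = tensor_lift V H (\<lambda>v h. \<Omega> (id v) (\<Delta> h)) (\<rho> x)"
    by (rule tensor_lift_tensor_map[OF sp(1,2,1,3) U linear_map_id(2) \<Delta>_lin \<Omega> \<rho>_in[OF x]])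
  finally show ?thesis by (simp add: \<Phi>_def \<Omega>_def)
qed

section \<open>The action of linear functionals on a comodule\<close>

lemma act_bilinear: "dual f \<Longrightarrow> bilinear_map V H V (\<lambda>w h. smul V (f h) w)"
  using linear_map_smul[OF spV linear_map_id(1)] linear_map_smul_left[OF spV]
  by (intro bilinear_mapI)

lemma act_linear: "dual f \<Longrightarrow> linear_map V V (act H V \<rho> f)"
  unfolding act_def by (rule linear_map_comp[OF \<rho>_lin tensor_lift_linear[OF spV spV act_bilinear]])

lemma act_in: "dual f \<Longrightarrow> v \<in> carr V \<Longrightarrow> act H V \<rho> f v \<in> carr V"
  by (rule linear_map_in[OF act_linear])

lemma act_counit: "v \<in> carr V \<Longrightarrow> act H V \<rho> (counit H) v = v"
  using comod by (simp add: comodule_def act_def)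

lemma act_linear_functional:
  assumes X: "is_space X" and f: "\<And>x. x \<in> carr X \<Longrightarrow> dual (f x)"
    and l: "\<And>h. linear_map X base_field (\<lambda>x. f x h)" and v: "v \<in> carr V"
  shows "linear_map X V (\<lambda>x. act H V \<rho> (f x) v)"
  unfolding act_def
  by (intro linear_tensor_lift_param spV spH X act_bilinear f linear_map_smul_left l \<rho>_in v)

lemma conv_bilinear: "bilinear_map H H base_field \<theta> \<Longrightarrow> dual (\<lambda>x. tensor_lift H H \<theta> (\<Delta> x))"
  by (rule linear_map_comp[OF \<Delta>_lin tensor_lift_linear[OF spH is_space_base_field]])

text \<open>Both sides are \<theta>\<open>(x_1, x_2) x_0\<close>. A product of two functionals in
  place of \<theta> gives the module law \<open>act_act\<close>; a normalised cointegral gives back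
  \<open>x\<close>, which is how averaging fixes a subcomodule.\<close>

lemma act_convolution:
  assumes \<theta>: "bilinear_map H H base_field \<theta>" and x: "x \<in> carr V"
  shows "tensor_lift V H (\<lambda>v h. act H V \<rho> (\<lambda>a. \<theta> a h) v) (\<rho> x)
    = act H V \<rho> (\<lambda>h. tensor_lift H H \<theta> (\<Delta> h)) x"
proof -
  have l: "linear_map base_field V (\<lambda>c. smul V c v)" if "v \<in> carr V" for v
    using linear_map_smul_left[OF spV linear_map_id(1) that] .
  have b: "bilinear_map H H V (\<lambda>a h. smul V (\<theta> a h) v)" if "v \<in> carr V" for v
    using bilinear_comp[OF \<theta> linear_map_id(1) linear_map_id(1) l[OF that]] .
  have c: "bilinear_map V H V (\<lambda>v h. tensor_lift H H (\<lambda>a h. smul V (\<theta> a h) v) (\<Delta> h))"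
  proof (rule bilinear_mapI)
    show "linear_map H V (\<lambda>h. tensor_lift H H (\<lambda>a h. smul V (\<theta> a h) v) (\<Delta> h))" if "v \<in> carr V" for v
      by (rule linear_map_comp[OF \<Delta>_lin tensor_lift_linear[OF spH spV b[OF that]]])
    show "linear_map V V (\<lambda>v. tensor_lift H H (\<lambda>a h. smul V (\<theta> a h) v) (\<Delta> h))" for h
      by (rule linear_tensor_lift_param[OF spH spH spV spV b linear_map_smul[OF spV linear_map_id(1)] \<Delta>_in])
  qed
  have "tensor_lift V H (\<lambda>v h. act H V \<rho> (\<lambda>a. \<theta> a h) v) (\<rho> x)
      = tensor_lift V H (\<lambda>v h. tensor_lift H H (\<lambda>a h. smul V (\<theta> a h) v) (\<Delta> h)) (\<rho> x)"
    unfolding act_def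
    by (rule coassoc_trilinear[OF spV b linear_map_smul[OF spV linear_map_id(1)] x])
  also have "\<dots> = tensor_lift V H (\<lambda>v h. smul V (tensor_lift H H \<theta> (\<Delta> h)) v) (\<rho> x)"
    by (rule tensor_lift_cong[OF spV spH spV c \<rho>_in[OF x]])
      (rule tensor_lift_linear_comp[OF spH spH is_space_base_field spV \<theta> l \<Delta>_in, symmetric])
  finally show ?thesis by (simp add: act_def)
qed

lemma act_act:
  assumes f: "dual f" and g: "dual g" and x: "x \<in> carr V"
  shows "act H V \<rho> f (act H V \<rho> g x) = act H V \<rho> (\<lambda>h. tensor_lift H H (\<lambda>a b. f a * g b) (\<Delta> h)) x"
proof -
  have \<theta>: "bilinear_map H H base_field (\<lambda>a b. f a * g b)"
    using f g by (auto simp: bilinear_map_def linear_map_def algebra_simps)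
  have s: "act H V \<rho> f (smul V (g h) v) = act H V \<rho> (\<lambda>a. f a * g h) v" if v: "v \<in> carr V" for v h
  proof -
    have "act H V \<rho> f (smul V (g h) v) = smul V (g h) (act H V \<rho> f v)"
      using linear_map_scale[OF act_linear[OF f] v] .
    also have "\<dots> = tensor_lift V H (\<lambda>w a. smul V (g h) (smul V (f a) w)) (\<rho> v)"
      unfolding act_def
      by (rule tensor_lift_linear_comp[OF spV spH spV spV act_bilinear[OF f] linear_map_smul[OF spV linear_map_id(1)] \<rho>_in[OF v]])
    finally show ?thesis by (simp add: act_def space_smul_simps[OF spV] mult.commute)
  qed
  have "act H V \<rho> f (act H V \<rho> g x) = tensor_lift V H (\<lambda>w h. act H V \<rho> f (smul V (g h) w)) (\<rho> x)"
    unfolding act_def[of _ _ _ g]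
    by (rule tensor_lift_linear_comp[OF spV spH spV spV act_bilinear[OF g] act_linear[OF f] \<rho>_in[OF x]])
  also have "\<dots> = tensor_lift V H (\<lambda>w h. act H V \<rho> (\<lambda>a. f a * g h) w) (\<rho> x)"
    by (rule tensor_lift_cong[OF spV spH spV bilinear_comp[OF act_bilinear[OF g] linear_map_id(1) linear_map_id(1) act_linear[OF f]] \<rho>_in[OF x] s])
  also have "\<dots> = act H V \<rho> (\<lambda>h. tensor_lift H H (\<lambda>a b. f a * g b) (\<Delta> h)) x"
    by (rule act_convolution[OF \<theta> x])
  finally show ?thesis .
qed

lemma hit_bilinear: "dual f \<Longrightarrow> bilinear_map H H H (\<lambda>a b. smul H (f b) a)"
  by (intro bilinear_mapI linear_map_smul[OF spH linear_map_id(1)] linear_map_smul_left[OF spH])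

lemma hit_linear: "dual f \<Longrightarrow> linear_map H H (\<lambda>h. tensor_lift H H (\<lambda>a b. smul H (f b) a) (\<Delta> h))"
  by (rule linear_map_comp[OF \<Delta>_lin tensor_lift_linear[OF spH spH hit_bilinear]])

text \<open>In Sweedler notation the right side is \<open>x_0\<close> \<otimes>
  \<open>x_1 f(x_2)\<close>: acting by \<open>f\<close> before the coaction only changes the
  coefficient in \<open>H\<close>.\<close>

lemma coaction_act:
  assumes f: "dual f" and x: "x \<in> carr V"
  shows "\<rho> (act H V \<rho> f x)
    = tensor_lift V H (\<lambda>v h. tens V H v (tensor_lift H H (\<lambda>a b. smul H (f b) a) (\<Delta> h))) (\<rho> x)"
proof -
  note sp = spV spH is_space_tensor
  have b: "bilinear_map H H (tensor V H) (\<lambda>a b. tens V H v (smul H (f b) a))" if "v \<in> carr V" for v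
    using bilinear_comp[OF hit_bilinear[OF f] linear_map_id(1) linear_map_id(1) linear_tens_right[OF sp(1,2) that]] .
  have c: "bilinear_map V H (tensor V H) (\<lambda>v h. \<rho> (smul V (f h) v))"
    using bilinear_comp[OF act_bilinear[OF f] linear_map_id(1) linear_map_id(1) \<rho>_lin] .
  have t: "\<rho> (smul V (f h) v) = tensor_lift V H (\<lambda>w a. tens V H w (smul H (f h) a)) (\<rho> v)"
    if v: "v \<in> carr V" for v h
  proof -
    have bb: "bilinear_map V H (tensor V H) (\<lambda>w a. tens V H w (smul H (f h) a))"
      by (intro bilinear_tens_map sp linear_map_id linear_map_smul)
    have "tscale (f h) (\<rho> v) = tensor_lift V H (\<lambda>w a. tens V H w (smul H (f h) a)) (\<rho> v)"
    proof (rule tensor_eqI[OF sp(1,2) _ tensor_lift_linear[OF sp(1,3) bb] _ \<rho>_in[OF v]])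
      show "linear_map (tensor V H) (tensor V H) (tscale (f h))"
        using linear_map_smul[OF sp(3) linear_map_id(1), of V H "f h"] by simp
    qed (simp add: tensor_lift_tens[OF sp(3) bb] tens_scale_right sp)
    then show ?thesis using linear_map_scale[OF \<rho>_lin v] by simp
  qed
  have d: "bilinear_map V H (tensor V H) (\<lambda>v h. tensor_lift H H (\<lambda>a b. tens V H v (smul H (f b) a)) (\<Delta> h))"
  proof (rule bilinear_mapI)
    show "linear_map H (tensor V H) (\<lambda>h. tensor_lift H H (\<lambda>a b. tens V H v (smul H (f b) a)) (\<Delta> h))"
      if "v \<in> carr V" for v
      by (rule linear_map_comp[OF \<Delta>_lin tensor_lift_linear[OF sp(2,3) b[OF that]]])
    show "linear_map V (tensor V H) (\<lambda>v. tensor_lift H H (\<lambda>a b. tens V H v (smul H (f b) a)) (\<Delta> h))" for h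
      by (rule linear_tensor_lift_param[OF sp(2,2,3,1) b linear_tens_left[OF sp(1,2)] \<Delta>_in])
        simp_all
  qed
  have "\<rho> (act H V \<rho> f x) = tensor_lift V H (\<lambda>v h. \<rho> (smul V (f h) v)) (\<rho> x)"
    unfolding act_def
    by (rule tensor_lift_linear_comp[OF sp(1,2,1,3) act_bilinear[OF f] \<rho>_lin \<rho>_in[OF x]])
  also have "\<dots> = tensor_lift V H (\<lambda>v h. tensor_lift V H (\<lambda>w a. tens V H w (smul H (f h) a)) (\<rho> v)) (\<rho> x)"
    by (rule tensor_lift_cong[OF sp(1,2,3) c \<rho>_in[OF x] t])
  also have "\<dots> = tensor_lift V H (\<lambda>v h. tensor_lift H H (\<lambda>a b. tens V H v (smul H (f b) a)) (\<Delta> h)) (\<rho> x)"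
    by (rule coassoc_trilinear[OF sp(3) b _ x]) (simp_all add: linear_tens_left sp)
  also have "\<dots> = tensor_lift V H (\<lambda>v h. tens V H v (tensor_lift H H (\<lambda>a b. smul H (f b) a) (\<Delta> h))) (\<rho> x)"
    by (rule tensor_lift_cong[OF sp(1,2,3) d \<rho>_in[OF x]])
      (rule tensor_lift_linear_comp[OF sp(2,2,2,3) hit_bilinear[OF f] linear_tens_right[OF sp(1,2)] \<Delta>_in, symmetric])
  finally show ?thesis .
qed

section \<open>Subcomodules as stable subspaces\<close>

definition stable :: "'v set \<Rightarrow> bool" where
  "stable N \<longleftrightarrow> module.subspace (smul V) N \<and> N \<subseteq> carr V \<and>
     (\<forall>f. dual f \<longrightarrow> (\<forall>x\<in>N. act H V \<rho> f x \<in> N))"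

lemma lift_span_in:
  assumes N: "module.subspace (smul V) N" "N \<subseteq> carr V" and \<phi>: "bilinear_map V H V \<phi>"
    and in_N: "\<And>v h. v \<in> N \<Longrightarrow> \<phi> v h \<in> N"
    and t: "t \<in> module.span tscale {tens V H v h | v h. v \<in> N \<and> h \<in> carr H}"
  shows "t \<in> carr (tensor V H) \<and> tensor_lift V H \<phi> t \<in> N"
proof -
  interpret V: vector_space "smul V" using spV by (rule space_vs)
  interpret T: vector_space "tscale :: 'k \<Rightarrow> ('k, 'v, 'h) tensors \<Rightarrow> _" by (rule vector_space_tscale)
  note lin = tensor_lift_linear[OF spV spV \<phi>]
  show ?thesis
    using t
  proof (induction rule: T.span_induct_alt)
    case base
    then show ?case using linear_map_zero[OF lin is_space_tensor] V.subspace_0[OF N(1)] space_zero[OF is_space_tensor] by simp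
  next
    case (step c t s)
    then obtain v h where t: "t = tens V H v h" and v: "v \<in> N" by auto
    have tc: "t \<in> carr (tensor V H)" using v N spV spH by (auto simp: t intro: tens_in)
    have ct: "tscale c t \<in> carr (tensor V H)" using space_scale[OF is_space_tensor tc] by simp
    have "tensor_lift V H \<phi> (tscale c t + s) = smul V c (\<phi> v h) + tensor_lift V H \<phi> s"
      using linear_map_add[OF lin ct] linear_map_scale[OF lin tc] step v N
      by (simp add: t tensor_lift_tens[OF spV \<phi>] subset_iff)
    then show ?case
      using step in_N[OF v] space_add[OF is_space_tensor ct] V.subspace_add[OF N(1)] V.subspace_scale[OF N(1)]
      by simp
  qed
qed

text \<open>For the harder direction, \<rho>\<open>(x)\<close> is expanded with independent right
  factors. The functional dual to one of them acts on \<open>x\<close> by extracting the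
  corresponding left factor, which therefore lies in \<open>N\<close>.\<close>

lemma subcomodule_iff_stable: "subcomodule H V \<rho> N \<longleftrightarrow> stable N"
proof
  assume N: "subcomodule H V \<rho> N"
  then have sub: "module.subspace (smul V) N" "N \<subseteq> carr V" by (simp_all add: subcomodule_def)
  interpret V: vector_space "smul V" using spV by (rule space_vs)
  have "act H V \<rho> f x \<in> N" if f: "dual f" and x: "x \<in> N" for f x
    using lift_span_in[OF sub act_bilinear[OF f] V.subspace_scale[OF sub(1)]] N x
    by (simp add: subcomodule_def act_def)
  then show "stable N" using sub by (simp add: stable_def)
next
  assume N: "stable N"
  interpret T: vector_space "tscale :: 'k \<Rightarrow> ('k, 'v, 'h) tensors \<Rightarrow> _" by (rule vector_space_tscale)
  have "\<rho> x \<in> T.span {tens V H v h |v h. v \<in> N \<and> h \<in> carr H}" if x: "x \<in> N" for x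
  proof -
    have xV: "x \<in> carr V" using N x by (auto simp: stable_def)
    obtain F g where F: "finite F" "\<not> module.dependent (smul H) F" "\<And>b. g b \<in> carr V"
      "\<rho> x = (\<Sum>b\<in>F. tens V H (g b) b)"
      using tensor_basis_right[OF spV spH carrH \<rho>_in[OF xV]] by blast
    have "g c \<in> N" if c: "c \<in> F" for c
    proof -
      obtain f where f: "dual f" "\<And>b. b \<in> F \<Longrightarrow> f b = (if b = c then 1 else 0)"
        using dual_functional[OF spH F(2) c] by blast
      have "act H V \<rho> f x = (\<Sum>b\<in>F. smul V (f b) (g b))"
        unfolding act_def F(4) by (rule tensor_lift_sum[OF spV spH spV act_bilinear[OF f(1)]]) (simp_all add: F(3))
      also have "\<dots> = (\<Sum>b\<in>F. if b = c then g b else 0)"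
        by (intro sum.cong) (simp_all add: f(2) space_smul_simps[OF spV])
      also have "\<dots> = g c" using F(1) c by simp
      finally show ?thesis using N f(1) x by (metis stable_def)
    qed
    then show ?thesis unfolding F(4) by (intro T.span_sum T.span_base) auto
  qed
  then show "subcomodule H V \<rho> N" using N by (simp add: subcomodule_def stable_def)
qed

end

section \<open>Coseparability and semisimplicity\<close>

context right_comodule
begin

text \<open>Local finiteness of comodules. The orbit of \<open>v\<close> under all functionals is
  stable, contains \<open>v\<close> because the counit acts as the identity, and lies in the span of
  the finitely many left factors of one expression for \<rho>\<open>(v)\<close>.\<close>

lemma finite_stable_containing:
  assumes v: "v \<in> carr V"
  obtains M F where "stable M" "v \<in> M" "finite F" "M \<subseteq> module.span (smul V) F"
proof -
  interpret V: vector_space "smul V" using spV by (rule space_vs)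
  define M where "M = {act H V \<rho> f v | f. dual f}"
  obtain ps where ps: "set ps \<subseteq> carr V \<times> carr H" "\<rho> v = (\<Sum>(w, h)\<leftarrow>ps. tens V H w h)"
    using tensor_list_sum[OF spV \<rho>_in[OF v]] by blast
  have act_v: "act H V \<rho> f v = (\<Sum>(w, h)\<leftarrow>ps. smul V (f h) w)" if "dual f" for f
    unfolding act_def ps(2) by (rule tensor_lift_eq[OF spV act_bilinear[OF that] ps(1)])
  have add: "act H V \<rho> (\<lambda>h. f h + g h) v = act H V \<rho> f v + act H V \<rho> g v"
    and scale: "act H V \<rho> (\<lambda>h. c * f h) v = smul V c (act H V \<rho> f v)" if f: "dual f" and g: "dual g" for f g c
  proof -
    have fg: "dual (\<lambda>h. f h + g h)" "dual (\<lambda>h. c * f h)"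
      using linear_map_plus[OF is_space_base_field f g] linear_map_smul[OF is_space_base_field f, of c] by simp_all
    have "(\<Sum>(w, h)\<leftarrow>qs. smul V (f h + g h) w) = (\<Sum>(w, h)\<leftarrow>qs. smul V (f h) w) + (\<Sum>(w, h)\<leftarrow>qs. smul V (g h) w)"
      "(\<Sum>(w, h)\<leftarrow>qs. smul V (c * f h) w) = smul V c (\<Sum>(w, h)\<leftarrow>qs. smul V (f h) w)" for qs
      by (induction qs) (auto simp: space_smul_simps[OF spV] algebra_simps)
    then show "act H V \<rho> (\<lambda>h. f h + g h) v = act H V \<rho> f v + act H V \<rho> g v"
      "act H V \<rho> (\<lambda>h. c * f h) v = smul V c (act H V \<rho> f v)"
      by (simp_all only: act_v[OF fg(1)] act_v[OF fg(2)] act_v[OF f] act_v[OF g])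
  qed
  have dual_fg: "dual (\<lambda>h. f h + g h)" "dual (\<lambda>h. c * f h)" if "dual f" "dual g" for f g c
    using linear_map_plus[OF is_space_base_field that] linear_map_smul[OF is_space_base_field that(1), of c] by simp_all
  show thesis
  proof
    have scale_M: "smul V c x \<in> M" if x: "x \<in> M" for x c
    proof -
      obtain f where f: "dual f" "x = act H V \<rho> f v" using x by (auto simp: M_def)
      then show ?thesis
        unfolding M_def mem_Collect_eq f(2) using scale[OF f(1,1), symmetric] dual_fg(2)[OF f(1,1)] by blast
    qed
    have v_M: "v \<in> M" unfolding M_def using act_counit[OF v] counit_dual by force
    have "0 \<in> M" using scale_M[OF v_M, of 0] by (simp add: space_smul_simps[OF spV])
    moreover have "x + y \<in> M" if xy: "x \<in> M" "y \<in> M" for x y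
    proof -
      obtain f g where f: "dual f" "x = act H V \<rho> f v" and g: "dual g" "y = act H V \<rho> g v"
        using xy by (auto simp: M_def)
      then show ?thesis
        unfolding M_def mem_Collect_eq f(2) g(2) using add[OF f(1) g(1), symmetric] dual_fg(1)[OF f(1) g(1)] by blast
    qed
    moreover note scale_M
    ultimately have "V.subspace M" by (simp add: V.subspace_def)
    moreover have "act H V \<rho> f x \<in> M" if f: "dual f" and x: "x \<in> M" for f x
    proof -
      obtain g where g: "dual g" "x = act H V \<rho> g v" using x by (auto simp: M_def)
      have "bilinear_map H H base_field (\<lambda>a b. f a * g b)"
        using f g(1) by (auto simp: bilinear_map_def linear_map_def algebra_simps)
      then show ?thesis unfolding g(2) act_act[OF f g(1) v] M_def using conv_bilinear by blast
    qed
    moreover have "M \<subseteq> carr V" using act_in v by (auto simp: M_def)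
    ultimately show "stable M" by (simp add: stable_def)
    show "v \<in> M" by (rule v_M)
    show "finite (fst ` set ps)" by simp
    show "M \<subseteq> V.span (fst ` set ps)"
    proof
      fix x assume "x \<in> M"
      then obtain f where f: "dual f" "x = act H V \<rho> f v" by (auto simp: M_def)
      have "(\<Sum>(w, h)\<leftarrow>qs. smul V (f h) w) \<in> V.span (fst ` set qs)" for qs
      proof (induction qs)
        case (Cons q qs)
        obtain w h where q: "q = (w, h)" by (cases q)
        have "V.span (fst ` set qs) \<subseteq> V.span (fst ` set (q # qs))" by (intro V.span_mono) auto
        moreover have "smul V (f h) w \<in> V.span (fst ` set (q # qs))"
          by (intro V.span_scale V.span_base) (simp add: q)
        ultimately show ?case using Cons V.span_add by (auto simp: q)
      qed (simp add: V.span_zero)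
      then show "x \<in> V.span (fst ` set ps)" by (simp add: f act_v)
    qed
  qed
qed

text \<open>A nonzero stable subspace of least dimension inside \<open>C \<inter> M\<close>, where
  \<open>M\<close> is finite-dimensional. The bound by \<open>M\<close> makes bases finite, so that
  equal dimensions force a stable subspace of \<open>N\<close> to be all of
  \<open>N\<close>.\<close>

lemma simple_stable_exists:
  assumes C: "stable C" "C \<noteq> {0}"
  obtains N where "stable N" "N \<noteq> {0}" "N \<subseteq> C" "\<And>N'. stable N' \<Longrightarrow> N' \<subseteq> N \<Longrightarrow> N' = {0} \<or> N' = N"
proof -
  interpret V: vector_space "smul V" using spV by (rule space_vs)
  have "0 \<in> C" using C V.subspace_0 by (auto simp: stable_def)
  then obtain v where v: "v \<in> C" "v \<noteq> 0" using C(2) by blast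
  have "v \<in> carr V" using C(1) v(1) by (auto simp: stable_def)
  then obtain M F where M: "stable M" "v \<in> M" "finite F" "M \<subseteq> V.span F"
    using finite_stable_containing by blast
  define P where "P N \<longleftrightarrow> stable N \<and> N \<noteq> {0} \<and> N \<subseteq> C \<and> N \<subseteq> M" for N
  have "stable (C \<inter> M)"
    using C(1) M(1) V.subspace_inter by (auto simp: stable_def)
  then have "P (C \<inter> M)" using v M(2) by (auto simp: P_def)
  then obtain N where N: "P N" and least: "\<And>N'. P N' \<Longrightarrow> V.dim N \<le> V.dim N'"
    using ex_has_least_nat[of P "C \<inter> M" V.dim] by blast
  show thesis
  proof
    show "stable N" "N \<noteq> {0}" "N \<subseteq> C" using N by (simp_all add: P_def)
    fix N' assume N': "stable N'" "N' \<subseteq> N"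
    show "N' = {0} \<or> N' = N"
    proof (cases "N' = {0}")
      case False
      then have "P N'" using N N' by (auto simp: P_def)
      then have d: "V.dim N \<le> V.dim N'" by (rule least)
      obtain B where B: "B \<subseteq> N'" "V.independent B" "N' \<subseteq> V.span B" "card B = V.dim N'"
        by (rule V.basis_exists)
      obtain B' where B': "B \<subseteq> B'" "B' \<subseteq> N" "V.independent B'" "N \<subseteq> V.span B'"
        using V.maximal_independent_subset_extend[of B N] B(1,2) N'(2) by blast
      have "B' \<subseteq> V.span F" using B'(2) N M(4) by (auto simp: P_def)
      then have fin: "finite B'" using V.independent_span_bound[OF M(3) B'(3)] by blast
      have "card B' = V.dim N" by (rule V.basis_card_eq_dim[OF B'(2,4,3)])
      then have "B = B'" using card_seteq[OF fin B'(1)] d B(4) by simp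
      moreover have "V.span B \<subseteq> N'"
        using V.span_minimal[OF B(1)] N'(1) by (simp add: stable_def)
      ultimately show ?thesis using B'(4) N'(2) by blast
    qed simp
  qed
qed

lemma stable_span_Union:
  assumes "\<And>N. N \<in> \<S> \<Longrightarrow> stable N"
  shows "stable (module.span (smul V) (\<Union>\<S>))"
proof -
  interpret V: vector_space "smul V" using spV by (rule space_vs)
  have sub: "V.span (\<Union>\<S>) \<subseteq> carr V"
    using assms space_subspace[OF spV] by (intro V.span_minimal) (auto simp: stable_def)
  have "x \<in> carr V \<and> act H V \<rho> f x \<in> V.span (\<Union>\<S>)" if f: "dual f" and x: "x \<in> V.span (\<Union>\<S>)" for f x
    using x
  proof (induction rule: V.span_induct_alt)
    case base
    then show ?case by (simp add: linear_map_zero[OF act_linear[OF f] spV] V.span_zero space_zero[OF spV])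
  next
    case (step c y z)
    then obtain N where N: "N \<in> \<S>" "y \<in> N" by blast
    have y: "y \<in> carr V" "act H V \<rho> f y \<in> N" using assms[OF N(1)] N(2) f by (auto simp: stable_def)
    have z: "z \<in> carr V" using step.IH by blast
    have "act H V \<rho> f (smul V c y + z) = smul V c (act H V \<rho> f y) + act H V \<rho> f z"
      using linear_map_add[OF act_linear[OF f] space_scale[OF spV y(1)] z]
        linear_map_scale[OF act_linear[OF f] y(1)] by simp
    moreover have "act H V \<rho> f y \<in> V.span (\<Union>\<S>)" using y(2) N(1) by (auto intro: V.span_base)
    ultimately show ?case using step.IH y(1) z by (simp add: V.span_add V.span_scale space_add[OF spV] space_scale[OF spV])
  qed
  then show ?thesis using sub by (simp add: stable_def)
qed

text \<open>Zorn's lemma: a maximal independent family of simple submodules spans, because a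
  complement of its span would contain a further simple submodule.\<close>

lemma semisimple_if_complemented:
  assumes compl: "\<And>N. stable N \<Longrightarrow> \<exists>C. stable C \<and> N \<inter> C = {0} \<and> (\<forall>v\<in>carr V. \<exists>n\<in>N. \<exists>c\<in>C. v = n + c)"
  shows "semisimple_comodule H V \<rho>"
proof -
  interpret V: vector_space "smul V" using spV by (rule space_vs)
  define simple where "simple N \<longleftrightarrow> stable N \<and> N \<noteq> {0} \<and> (\<forall>N'. stable N' \<and> N' \<subseteq> N \<longrightarrow> N' = {0} \<or> N' = N)" for N
  define indep where "indep \<S> \<longleftrightarrow> (\<forall>N\<in>\<S>. N \<inter> V.span (\<Union>(\<S> - {N})) = {0})" for \<S>
  define A where "A = {\<S>. (\<forall>N\<in>\<S>. simple N) \<and> indep \<S>}"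
  have zero: "0 \<in> N" if "stable N" for N using that V.subspace_0 by (simp add: stable_def)
  have "\<exists>M\<in>A. \<forall>X\<in>A. M \<subseteq> X \<longrightarrow> X = M"
  proof (rule subset_Zorn')
    fix \<C> assume \<C>: "subset.chain A \<C>"
    then have sub: "\<C> \<subseteq> A" and ch: "\<And>X Y. X \<in> \<C> \<Longrightarrow> Y \<in> \<C> \<Longrightarrow> X \<subseteq> Y \<or> Y \<subseteq> X"
      by (auto simp: subset.chain_def)
    have simple: "simple N" if "N \<in> \<Union>\<C>" for N using that sub by (auto simp: A_def)
    have "x = 0" if N: "N \<in> \<Union>\<C>" and x: "x \<in> N" "x \<in> V.span (\<Union>(\<Union>\<C> - {N}))" for N x
    proof -
      obtain t r where t: "finite t" "t \<subseteq> \<Union>(\<Union>\<C> - {N})" "x = (\<Sum>a\<in>t. smul V (r a) a)"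
        using x(2) by (auto simp: V.span_explicit)
      \<comment> \<open>A linear dependence involves finitely many vectors; their summands, together
        with \<open>N\<close>, already belong to a single member of the chain, which is
        independent.\<close>
      have "\<exists>\<S>\<in>\<C>. N \<in> \<S> \<and> t \<subseteq> \<Union>(\<S> - {N})"
        using t(1,2)
      proof (induction t)
        case empty
        then show ?case using N by blast
      next
        case (insert a t)
        then obtain \<S> where \<S>: "\<S> \<in> \<C>" "N \<in> \<S>" "t \<subseteq> \<Union>(\<S> - {N})" by auto
        obtain \<S>' N' where \<S>': "\<S>' \<in> \<C>" "N' \<in> \<S>'" "N' \<noteq> N" "a \<in> N'" using insert by auto
        show ?case
        proof (cases "\<S> \<subseteq> \<S>'")
          case True
          then have "t \<subseteq> \<Union>(\<S>' - {N})" "a \<in> \<Union>(\<S>' - {N})" "N \<in> \<S>'" using \<S> \<S>' by blast+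
          then show ?thesis using \<S>'(1) by blast
        next
          case False
          then have "\<S>' \<subseteq> \<S>" using ch \<S>(1) \<S>'(1) by blast
          then have "a \<in> \<Union>(\<S> - {N})" using \<S>' by blast
          then show ?thesis using \<S> by blast
        qed
      qed
      then obtain \<S> where \<S>: "\<S> \<in> \<C>" "N \<in> \<S>" "t \<subseteq> \<Union>(\<S> - {N})" by blast
      have "x \<in> V.span (\<Union>(\<S> - {N}))" unfolding t(3) using \<S>(3)
        by (intro V.span_sum V.span_scale V.span_base) auto
      moreover have "indep \<S>" using \<S>(1) sub by (auto simp: A_def)
      ultimately show ?thesis using x(1) \<S>(2) unfolding indep_def by blast
    qed
    then have "N \<inter> V.span (\<Union>(\<Union>\<C> - {N})) = {0}" if "N \<in> \<Union>\<C>" for N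
      using that simple[OF that] zero[of N] V.span_zero unfolding simple_def by blast
    then have "indep (\<Union>\<C>)" unfolding indep_def by blast
    then show "\<Union>\<C> \<in> A" using simple by (simp add: A_def)
  qed
  then obtain \<S> where \<S>: "\<S> \<in> A" and max: "\<And>X. X \<in> A \<Longrightarrow> \<S> \<subseteq> X \<Longrightarrow> X = \<S>" by blast
  define M where "M = V.span (\<Union>\<S>)"
  have st: "stable N" if "N \<in> \<S>" for N using \<S> that by (simp add: A_def simple_def)
  have M: "stable M" unfolding M_def by (rule stable_span_Union) (rule st)
  obtain C where C: "stable C" "M \<inter> C = {0}" "\<And>v. v \<in> carr V \<Longrightarrow> \<exists>n\<in>M. \<exists>c\<in>C. v = n + c"
    using compl[OF M] by blast
  have "C = {0}"
  proof (rule ccontr)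
    assume "C \<noteq> {0}"
    then obtain N where N: "stable N" "N \<noteq> {0}" "N \<subseteq> C"
      "\<And>N'. stable N' \<Longrightarrow> N' \<subseteq> N \<Longrightarrow> N' = {0} \<or> N' = N"
      using simple_stable_exists[OF C(1)] by blast
    have NM: "x = 0" if "x \<in> N" "x \<in> M" for x using that N(3) C(2) by blast
    have "N \<notin> \<S>"
    proof
      assume "N \<in> \<S>"
      then have "N \<subseteq> M" unfolding M_def by (auto intro: V.span_base)
      then show False using NM N(2) zero[OF N(1)] by blast
    qed
    have "insert N \<S> \<in> A"
    proof -
      \<comment> \<open>A dependence after adding \<open>N\<close> has a part \<open>n\<close> in
        \<open>N\<close>. Since \<open>x\<close> and \<open>m\<close> lie in \<open>M\<close>, so
        does \<open>n\<close>; hence \<open>n = 0\<close> and the dependence involves only old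
        summands.\<close>
      have old: "x = 0" if N': "N' \<in> \<S>" and x: "x \<in> N'" "x \<in> V.span (\<Union>(insert N \<S> - {N'}))" for N' x
      proof -
        have "\<Union>(insert N \<S> - {N'}) = \<Union>(\<S> - {N'}) \<union> N" using \<open>N \<notin> \<S>\<close> N' by auto
        then obtain m n where x': "x = m + n" "m \<in> V.span (\<Union>(\<S> - {N'}))" "n \<in> V.span N"
          using x(2) by (auto simp: V.span_Un)
        have n: "n \<in> N" using x'(3) N(1) V.span_minimal[of N N] by (auto simp: stable_def)
        have "m \<in> M" unfolding M_def using x'(2) V.span_mono[of "\<Union>(\<S> - {N'})" "\<Union>\<S>"] by blast
        moreover have "x \<in> M" unfolding M_def using x(1) N' by (auto intro: V.span_base)
        ultimately have "x - m \<in> M" unfolding M_def by (simp add: V.span_diff)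
        then have "n = 0" using NM[OF n] x'(1) by simp
        then have "x \<in> N' \<inter> V.span (\<Union>(\<S> - {N'}))" using x x' by simp
        moreover have "N' \<inter> V.span (\<Union>(\<S> - {N'})) = {0}" using \<S> N' by (simp add: A_def indep_def)
        ultimately show ?thesis by blast
      qed
      have new: "x = 0" if "x \<in> N" "x \<in> V.span (\<Union>(insert N \<S> - {N}))" for x
        using that NM \<open>N \<notin> \<S>\<close> by (simp add: M_def)
      have "N' \<inter> V.span (\<Union>(insert N \<S> - {N'})) = {0}" if "N' \<in> insert N \<S>" for N'
      proof -
        have "x = 0" if "x \<in> N'" "x \<in> V.span (\<Union>(insert N \<S> - {N'}))" for x
          using that old new \<open>N' \<in> insert N \<S>\<close> by blast
        moreover have "0 \<in> N'" using that zero st N(1) by blast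
        ultimately show ?thesis using V.span_zero by blast
      qed
      then have "indep (insert N \<S>)" unfolding indep_def by blast
      moreover have "simple N" using N unfolding simple_def by blast
      ultimately show ?thesis using \<S> by (simp add: A_def)
    qed
    then show False using max \<open>N \<notin> \<S>\<close> by blast
  qed
  then have "carr V \<subseteq> M" using C(3) by fastforce
  moreover have "M \<subseteq> carr V" using M by (simp add: stable_def)
  ultimately show ?thesis
    unfolding semisimple_comodule_def simple_subcomodule_def subcomodule_iff_stable
    using \<S> by (intro exI[of _ \<S>]) (auto simp: A_def simple_def indep_def M_def)
qed

text \<open>Maschke averaging of a linear projection \<open>p\<close> along the cointegral \<open>\<theta>\<close>:
  in Sweedler notation \<open>q v = \<theta>(p(v\<^sub>0)\<^sub>1, v\<^sub>1) p(v\<^sub>0)\<^sub>0\<close>.\<close>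

lemma coseparable_complement:
  assumes \<theta>: "bilinear_map H H base_field \<theta>"
    and coint: "\<And>f x y. dual f \<Longrightarrow> tensor_lift H H (\<lambda>a b. f a * \<theta> b x) (\<Delta> y)
      = \<theta> y (tensor_lift H H (\<lambda>a b. smul H (f b) a) (\<Delta> x))"
    and norm: "\<And>x. tensor_lift H H \<theta> (\<Delta> x) = counit H x"
    and N: "stable N"
  shows "\<exists>C. stable C \<and> N \<inter> C = {0} \<and> (\<forall>v\<in>carr V. \<exists>n\<in>N. \<exists>c\<in>C. v = n + c)"
proof -
  interpret V: vector_space "smul V" using spV by (rule space_vs)
  note sp = spV spH
  have Nsub: "V.subspace N" "N \<subseteq> carr V" and Nact: "\<And>f x. dual f \<Longrightarrow> x \<in> N \<Longrightarrow> act H V \<rho> f x \<in> N"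
    using N by (auto simp: stable_def)
  obtain p where p: "linear_map V V p" "\<And>v. p v \<in> N" "\<And>v. v \<in> N \<Longrightarrow> p v = v"
    using ex_linear_projection[OF spV Nsub] by blast
  have \<theta>l: "dual (\<lambda>a. \<theta> a h)" for h using bilinear_left[OF \<theta>] by simp
  have \<theta>r: "dual (\<theta> a)" for a using bilinear_right[OF \<theta>] by simp
  have pV: "p v \<in> carr V" for v using p(2) Nsub by blast
  have bil: "bilinear_map V H V (\<lambda>v h. act H V \<rho> (\<lambda>a. \<theta> a h) (g v))" if g: "linear_map V V g" for g
  proof (rule bilinear_mapI)
    show "linear_map H V (\<lambda>h. act H V \<rho> (\<lambda>a. \<theta> a h) (g v))" if "v \<in> carr V" for v
      by (rule act_linear_functional[OF spH \<theta>l \<theta>r linear_map_in[OF g that]])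
    show "linear_map V V (\<lambda>v. act H V \<rho> (\<lambda>a. \<theta> a h) (g v))" for h
      by (rule linear_map_comp[OF g act_linear[OF \<theta>l]])
  qed
  define q where "q v = tensor_lift V H (\<lambda>v h. act H V \<rho> (\<lambda>a. \<theta> a h) (p v)) (\<rho> v)" for v
  have q_lin: "linear_map V V q"
    unfolding q_def by (rule linear_map_comp[OF \<rho>_lin tensor_lift_linear[OF spV spV bil[OF p(1)]]])
  have \<rho>N: "\<rho> v \<in> module.span tscale {tens V H v h | v h. v \<in> N \<and> h \<in> carr H}" if "v \<in> N" for v
    using that N unfolding subcomodule_iff_stable[symmetric] subcomodule_def by blast
  have q_N: "q v \<in> N" if v: "v \<in> carr V" for v
  proof -
    obtain F g where F: "finite F" "\<And>b. g b \<in> carr V" "\<rho> v = (\<Sum>b\<in>F. tens V H (g b) b)"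
      using tensor_basis_right[OF spV spH carrH \<rho>_in[OF v]] by blast
    have "q v = (\<Sum>b\<in>F. act H V \<rho> (\<lambda>a. \<theta> a b) (p (g b)))"
      unfolding q_def F(3) by (rule tensor_lift_sum[OF sp spV bil[OF p(1)]]) (simp_all add: F(2))
    moreover have "(\<Sum>b\<in>F. act H V \<rho> (\<lambda>a. \<theta> a b) (p (g b))) \<in> N"
      by (rule V.subspace_sum[OF Nsub(1)]) (rule Nact[OF \<theta>l p(2)])
    ultimately show ?thesis by simp
  qed
  \<comment> \<open>For \<open>v\<close> in \<open>N\<close> the coaction stays in the image of
    \<open>N\<close> \<otimes> \<open>H\<close>, where \<open>p\<close> is the identity. What
    remains is \<theta>\<open>(v_1, v_2) v_0\<close>, and \<open>norm\<close> turns it into the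
    counit axiom.\<close>
  have q_id: "q v = v" if v: "v \<in> N" for v
  proof -
    have vV: "v \<in> carr V" using v Nsub by blast
    let ?L = "tensor_lift V H (\<lambda>v h. act H V \<rho> (\<lambda>a. \<theta> a h) (p v))"
    let ?R = "tensor_lift V H (\<lambda>v h. act H V \<rho> (\<lambda>a. \<theta> a h) v)"
    have lin: "linear_map (tensor V H) V ?L" "linear_map (tensor V H) V ?R"
      by (rule tensor_lift_linear[OF spV spV bil[OF p(1)]], rule tensor_lift_linear[OF spV spV bil[OF linear_map_id(1)]])
    interpret T: vector_space "tscale :: 'k \<Rightarrow> ('k, 'v, 'h) tensors \<Rightarrow> _" by (rule vector_space_tscale)
    have "t \<in> carr (tensor V H) \<and> ?L t = ?R t"
      if "t \<in> T.span {tens V H v h | v h. v \<in> N \<and> h \<in> carr H}" for t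
      using that
    proof (induction rule: T.span_induct_alt)
      case base
      then show ?case using linear_map_zero[OF lin(1) is_space_tensor] linear_map_zero[OF lin(2) is_space_tensor]
          space_zero[OF is_space_tensor] by simp
    next
      case (step c t s)
      then obtain w h where t: "t = tens V H w h" and w: "w \<in> N" by auto
      have wV: "w \<in> carr V" using w Nsub by blast
      have tc: "t \<in> carr (tensor V H)" using wV sp by (auto simp: t intro: tens_in)
      have ct: "tscale c t \<in> carr (tensor V H)" using space_scale[OF is_space_tensor tc] by simp
      have "?L t = ?R t"
        using wV p(3)[OF w] by (simp add: t tensor_lift_tens[OF spV bil[OF p(1)]]
            tensor_lift_tens[OF spV bil[OF linear_map_id(1)]])
      then show ?case
        using linear_map_add[OF lin(1) ct, of s] linear_map_scale[OF lin(1) tc, of c]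
          linear_map_add[OF lin(2) ct, of s] linear_map_scale[OF lin(2) tc, of c]
          step.IH space_add[OF is_space_tensor ct] by simp
    qed
    then have "q v = ?R (\<rho> v)" using \<rho>N[OF v] by (simp add: q_def)
    also have "\<dots> = act H V \<rho> (\<lambda>h. tensor_lift H H \<theta> (\<Delta> h)) v" by (rule act_convolution[OF \<theta> vV])
    also have "\<dots> = v" using act_counit[OF vV] by (simp add: norm)
    finally show ?thesis .
  qed
  \<comment> \<open>In Sweedler notation \<open>coint\<close> reads \<open>f(y_1)\<close>
    \<theta>\<open>(y_2, x)\<close> = \<theta>\<open>(y, x_1) f(x_2)\<close>. It moves
    \<open>f\<close> from the vector \<open>p(v_0)\<close> to the coefficient \<open>v_1\<close>,
    where \<open>coaction_act\<close> recognises it. The kernel of \<open>q\<close> is then the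
    stable complement.\<close>
  have q_act: "q (act H V \<rho> f v) = act H V \<rho> f (q v)" if f: "dual f" and v: "v \<in> carr V" for f v
  proof -
    let ?f = "\<lambda>h. tensor_lift H H (\<lambda>a b. smul H (f b) a) (\<Delta> h)"
    have b: "bilinear_map V H (tensor V H) (\<lambda>v h. tens V H v (?f h))"
      by (rule bilinear_tens_map[OF sp linear_map_id(1) hit_linear[OF f]])
    have c: "bilinear_map V H V (\<lambda>v h. act H V \<rho> f (act H V \<rho> (\<lambda>a. \<theta> a h) (p v)))"
      using bilinear_comp[OF bil[OF p(1)] linear_map_id(1) linear_map_id(1) act_linear[OF f]] .
    have "act H V \<rho> f (q v) = tensor_lift V H (\<lambda>v h. act H V \<rho> f (act H V \<rho> (\<lambda>a. \<theta> a h) (p v))) (\<rho> v)"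
      unfolding q_def by (rule tensor_lift_linear_comp[OF sp spV spV bil[OF p(1)] act_linear[OF f] \<rho>_in[OF v]])
    also have "\<dots> = tensor_lift V H (\<lambda>v h. tensor_lift V H (\<lambda>v h. act H V \<rho> (\<lambda>a. \<theta> a h) (p v)) (tens V H v (?f h))) (\<rho> v)"
    proof (rule tensor_lift_cong[OF sp spV c \<rho>_in[OF v]])
      fix w h assume w: "w \<in> carr V"
      have "act H V \<rho> f (act H V \<rho> (\<lambda>a. \<theta> a h) (p w)) = act H V \<rho> (\<lambda>a. \<theta> a (?f h)) (p w)"
        unfolding act_act[OF f \<theta>l pV] coint[OF f] ..
      then show "act H V \<rho> f (act H V \<rho> (\<lambda>a. \<theta> a h) (p w))
        = tensor_lift V H (\<lambda>v h. act H V \<rho> (\<lambda>a. \<theta> a h) (p v)) (tens V H w (?f h))"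
        using w by (simp add: tensor_lift_tens[OF spV bil[OF p(1)]])
    qed
    also have "\<dots> = q (act H V \<rho> f v)"
      unfolding q_def coaction_act[OF f v]
      by (rule tensor_lift_linear_comp[OF sp is_space_tensor spV b tensor_lift_linear[OF spV spV bil[OF p(1)]] \<rho>_in[OF v], symmetric])
    finally show ?thesis by simp
  qed
  define C where "C = {v \<in> carr V. q v = 0}"
  have "V.subspace C"
    unfolding C_def V.subspace_def
    using linear_map_zero[OF q_lin spV] linear_map_add[OF q_lin] linear_map_scale[OF q_lin]
      space_zero[OF spV] space_add[OF spV] space_scale[OF spV] by (auto simp: V.scale_zero_right)
  then have "stable C"
    using q_act act_in linear_map_zero[OF act_linear spV] by (auto simp: stable_def C_def)
  moreover have "N \<inter> C = {0}"
    using q_id Nsub V.subspace_0[OF Nsub(1)] linear_map_zero[OF q_lin spV] space_zero[OF spV] by (auto simp: C_def)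
  moreover have "\<exists>n\<in>N. \<exists>c\<in>C. v = n + c" if v: "v \<in> carr V" for v
  proof -
    have qv: "q v \<in> carr V" using q_N[OF v] Nsub by blast
    have "v - q v \<in> C"
      using linear_map_diff[OF q_lin spV v qv] q_id[OF q_N[OF v]] space_diff[OF spV v qv] by (simp add: C_def)
    then show ?thesis by (intro bexI[OF bexI[OF _ \<open>v - q v \<in> C\<close>] q_N[OF v]]) simp
  qed
  ultimately show ?thesis by blast
qed

end

lemma coseparable_cosemisimple:
  fixes H :: "('k::field, 'h::ring_1) hopf"
  assumes H: "bialgebra H" and \<theta>: "bilinear_map H H base_field \<theta>"
    and coint: "\<And>f x y. linear_map H base_field f \<Longrightarrow> tensor_lift H H (\<lambda>a b. f a * \<theta> b x) (comult H y)
      = \<theta> y (tensor_lift H H (\<lambda>a b. smul H (f b) a) (comult H x))"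
    and norm: "\<And>x. tensor_lift H H \<theta> (comult H x) = counit H x"
  shows "cosemisimple TYPE('v::ab_group_add) H"
  unfolding cosemisimple_def
proof (intro allI impI)
  fix V :: "('k, 'v) vspace" and \<rho>
  assume "comodule H V \<rho>"
  then interpret right_comodule H V \<rho> by unfold_locales (rule H)
  show "semisimple_comodule H V \<rho>"
    by (rule semisimple_if_complemented) (rule coseparable_complement[OF \<theta> coint norm])
qed

section \<open>Orthogonal projections over an ordered field\<close>

text \<open>Gram-Schmidt without square roots: a projection \<open>P\<close> is enlarged by the
  rank-one matrix \<open>c i * c j / n\<close>, where \<open>c = b - P b\<close> is the residual of
  a new vector \<open>b\<close> and \<open>n\<close> its square length. The order of the field
  enters through \<open>n > 0\<close>.\<close>

lemma ex_orthogonal_projection: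
  fixes S :: "'a set" and W :: "('a \<Rightarrow> 'f::linordered_field) set"
  assumes S: "finite S" and zero: "(\<lambda>_. 0) \<in> W"
    and add: "\<And>u v. u \<in> W \<Longrightarrow> v \<in> W \<Longrightarrow> (\<lambda>i. u i + v i) \<in> W"
    and scale: "\<And>c v. v \<in> W \<Longrightarrow> (\<lambda>i. c * v i) \<in> W"
  obtains P where "\<And>i j. P i j = P j i" "\<And>j. j \<in> S \<Longrightarrow> \<exists>w\<in>W. \<forall>i\<in>S. P i j = w i"
    "\<And>w i. w \<in> W \<Longrightarrow> i \<in> S \<Longrightarrow> (\<Sum>j\<in>S. P i j * w j) = w i"
proof -
  define app where "app P v i = (\<Sum>j\<in>S. P i j * v j)" for P :: "'a \<Rightarrow> 'a \<Rightarrow> 'f" and v i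
  define dot where "dot u v = (\<Sum>i\<in>S. u i * v i)" for u v :: "'a \<Rightarrow> 'f"
  have sum_W: "(\<lambda>i. \<Sum>j\<in>J. f j i) \<in> W" if "\<And>j. j \<in> J \<Longrightarrow> f j \<in> W" for J :: "'a set" and f
    using that by (induction J rule: infinite_finite_induct) (auto simp: zero add)
  have diff_W: "(\<lambda>i. u i - v i) \<in> W" if "u \<in> W" "v \<in> W" for u v
    using add[OF that(1) scale[OF that(2), of "-1"]] by simp
  have dot_app: "dot u (app P v) = dot (app P u) v" if "\<And>i j. P i j = P j i" for P u v
  proof -
    have "dot u (app P v) = (\<Sum>i\<in>S. \<Sum>j\<in>S. u i * (P i j * v j))" by (simp add: dot_def app_def sum_distrib_left)
    also have "\<dots> = (\<Sum>j\<in>S. \<Sum>i\<in>S. P j i * u i * v j)"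
      by (subst sum.swap) (intro sum.cong refl, subst that, simp add: mult_ac)
    finally show ?thesis by (simp add: dot_def app_def sum_distrib_right)
  qed
  have app_cong: "app P u i = app P v i" if "\<And>j. j \<in> S \<Longrightarrow> u j = v j" for P u v i
    using that by (simp add: app_def)
  \<comment> \<open>Idempotence is carried through the induction because it gives
    \<open>P c = 0\<close>; by symmetry the residual is then orthogonal to the image of
    \<open>P\<close>.\<close>
  have step: "\<exists>P. (\<forall>i j. P i j = P j i) \<and> (\<forall>j\<in>S. \<exists>w\<in>W. \<forall>i\<in>S. P i j = w i) \<and>
      (\<forall>v. \<forall>i\<in>S. app P (app P v) i = app P v i) \<and> (\<forall>w\<in>B. \<forall>i\<in>S. app P w i = w i)"
    if "finite B" "B \<subseteq> W" for B
    using that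
  proof (induction B)
    case empty
    show ?case by (intro exI[of _ "\<lambda>_ _. 0"]) (auto simp: app_def intro: bexI[OF _ zero])
  next
    case (insert b B)
    then have "B \<subseteq> W" by simp
    from insert.IH[OF this] obtain P where P: "\<forall>i j. P i j = P j i" "\<forall>j\<in>S. \<exists>w\<in>W. \<forall>i\<in>S. P i j = w i"
      "\<forall>v. \<forall>i\<in>S. app P (app P v) i = app P v i" "\<forall>w\<in>B. \<forall>i\<in>S. app P w i = w i" by (elim exE conjE)
    have sym: "P i j = P j i" for i j by (rule P(1)[rule_format])
    have col: "\<exists>w\<in>W. \<forall>i\<in>S. P i j = w i" if "j \<in> S" for j by (rule bspec[OF P(2) that])
    have idem: "app P (app P v) i = app P v i" if "i \<in> S" for v i using P(3) that by simp
    have fixB: "app P w i = w i" if "w \<in> B" "i \<in> S" for w i using P(4) that by simp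
    \<comment> \<open>Representatives in \<open>W\<close> of the columns of \<open>P\<close>; with
      them \<open>P b\<close>, and so the residual, agrees on \<open>S\<close> with an element of
      \<open>W\<close>.\<close>
    obtain w where w: "\<And>j. j \<in> S \<Longrightarrow> w j \<in> W" "\<And>j i. j \<in> S \<Longrightarrow> i \<in> S \<Longrightarrow> P i j = w j i"
      using bchoice[of S "\<lambda>j w. w \<in> W \<and> (\<forall>i\<in>S. P i j = w i)"] col by blast
    define c where "c i = b i - app P b i" for i
    have "(\<lambda>i. b i - (\<Sum>j\<in>S. b j * w j i)) \<in> W"
      using insert w(1) by (intro diff_W sum_W scale) auto
    moreover have "c i = b i - (\<Sum>j\<in>S. b j * w j i)" if "i \<in> S" for i
      using that by (simp add: c_def app_def w(2) mult.commute)
    ultimately obtain c' where c': "c' \<in> W" "\<And>i. i \<in> S \<Longrightarrow> c i = c' i" by blast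
    have Pc: "app P c i = 0" if "i \<in> S" for i
    proof -
      have "app P c i = app P b i - app P (app P b) i"
        by (simp add: app_def c_def right_diff_distrib sum_subtractf)
      then show ?thesis using idem[OF that] by simp
    qed
    show ?case
    proof (cases "\<forall>i\<in>S. c i = 0")
      case True
      then have "app P b i = b i" if "i \<in> S" for i using that by (simp add: c_def)
      then show ?thesis using P by (intro exI[of _ P] conjI) auto
    next
      case False
      define n where "n = dot c c"
      have "n > 0"
      proof -
        obtain i where "i \<in> S" "c i \<noteq> 0" using False by blast
        then show ?thesis unfolding n_def dot_def using S
          by (intro sum_pos2[of S i]) (auto simp: zero_less_mult_iff)
      qed
      define Q where "Q i j = P i j + c i * c j / n" for i j
      have lin: "dot u (\<lambda>i. x i + y i * d) = dot u x + dot u y * d"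
        "app P (\<lambda>i. x i + y i * d) k = app P x k + app P y k * d" for u x y d k
        by (simp_all add: dot_def app_def distrib_left sum.distrib sum_distrib_right mult.assoc)
      have Q: "app Q v = (\<lambda>i. app P v i + c i * (dot c v / n))" for v
      proof
        fix i
        have "(\<Sum>j\<in>S. (P i j + c i * c j / n) * v j) = (\<Sum>j\<in>S. P i j * v j) + (\<Sum>j\<in>S. c i * (c j * v j / n))"
          by (simp add: distrib_right sum.distrib mult.assoc)
        then show "app Q v i = app P v i + c i * (dot c v / n)"
          by (simp add: app_def Q_def dot_def sum_distrib_left sum_divide_distrib)
      qed
      have c_app: "dot c (app P v) = 0" for v
        using dot_app[OF sym, where u = c and v = v] Pc by (simp add: dot_def)
      have c_Q: "dot c (app Q v) = dot c v" for v
        unfolding Q lin c_app using \<open>n > 0\<close> by (simp add: n_def)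
      have P_Q: "app P (app Q v) i = app P v i" if i: "i \<in> S" for v i
        unfolding Q lin using idem[OF i] Pc[OF i] by simp
      have idem_Q: "app Q (app Q v) i = app Q v i" if i: "i \<in> S" for v i
        unfolding Q[of "app Q v"] c_Q P_Q[OF i] by (simp add: Q)
      have sym_Q: "Q i j = Q j i" for i j by (simp add: Q_def sym[of i j] mult.commute)
      have colQ: "\<exists>w\<in>W. \<forall>i\<in>S. Q i j = w i" if j: "j \<in> S" for j
        using add[OF w(1)[OF j] scale[OF c'(1), of "c j / n"]] w(2)[OF j] c'(2)
        by (intro bexI[of _ "\<lambda>i. w j i + c j / n * c' i"]) (auto simp: Q_def)
      have b: "app Q b i = b i" for i
      proof -
        have "dot c b = dot c c + dot c (app P b)"
          by (simp add: dot_def c_def sum.distrib[symmetric] algebra_simps)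
        then have "dot c b = n" by (simp add: c_app n_def)
        then show ?thesis using \<open>n > 0\<close> by (simp add: Q c_def)
      qed
      have B: "app Q v i = v i" if "v \<in> B" "i \<in> S" for v i
      proof -
        have "dot c v = dot c (app P v)" using fixB[OF that(1)] by (simp add: dot_def)
        then show ?thesis using fixB[OF that] c_app by (simp add: Q)
      qed
      show ?thesis
        by (intro exI[of _ Q] conjI allI ballI sym_Q idem_Q) (use colQ b B in auto)
    qed
  qed
  define sc where "sc c v = (\<lambda>i. c * v i)" for c :: 'f and v :: "'a \<Rightarrow> 'f"
  interpret F: vector_space sc
    by unfold_locales (auto simp: sc_def algebra_simps fun_eq_iff plus_fun_apply)
  \<comment> \<open>Passage from finite sets of vectors to all of \<open>W\<close>: restricted to
    \<open>S\<close>, functions lie in the span of the finite set \<open>E\<close>, so the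
    restrictions of \<open>W\<close> have a finite basis.\<close>
  define R where "R v i = (if i \<in> S then v i else 0)" for v :: "'a \<Rightarrow> 'f" and i
  define E where "E = (\<lambda>j i. if i = j then 1 else 0 :: 'f) ` S"
  obtain B where B: "B \<subseteq> R ` W" "F.independent B" "R ` W \<subseteq> F.span B"
    by (rule F.maximal_independent_subset)
  have "R v \<in> F.span E" for v
  proof -
    have "R v = (\<Sum>j\<in>S. sc (v j) (\<lambda>i. if i = j then 1 else 0))"
    proof
      have "(\<Sum>j\<in>J. g j) i = (\<Sum>j\<in>J. g j i)" for g :: "'a \<Rightarrow> 'a \<Rightarrow> 'f" and J i
        by (induction J rule: infinite_finite_induct) (auto simp: plus_fun_apply zero_fun_apply)
      then show "R v i = (\<Sum>j\<in>S. sc (v j) (\<lambda>i. if i = j then 1 else 0)) i" for i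
        using S by (simp add: R_def sc_def if_distrib cong: if_cong)
    qed
    moreover have "\<dots> \<in> F.span E"
      by (intro F.span_sum F.span_scale F.span_base) (simp add: E_def)
    ultimately show ?thesis by simp
  qed
  then have "finite B"
    using F.independent_span_bound[of E B] B(1,2) S by (auto simp: E_def)
  then obtain B0 where B0: "finite B0" "B0 \<subseteq> W" "B = R ` B0"
    using B(1) by (meson finite_subset_image)
  obtain P where P: "\<forall>i j. P i j = P j i" "\<forall>j\<in>S. \<exists>w\<in>W. \<forall>i\<in>S. P i j = w i" "\<forall>w\<in>B0. \<forall>i\<in>S. app P w i = w i"
    using step[OF B0(1,2)] by blast
  have span: "\<forall>i\<in>S. app P v i = v i" if "v \<in> F.span B" for v
    using that
  proof (induction rule: F.span_induct_alt)
    case base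
    show ?case by (simp add: app_def zero_fun_apply)
  next
    case (step c x y)
    then obtain z where z: "z \<in> B0" "x = R z" using B0(3) by blast
    show ?case
    proof
      fix i assume i: "i \<in> S"
      have "app P (sc c x + y) i = c * app P x i + app P y i"
        by (simp add: app_def sc_def plus_fun_apply distrib_left sum.distrib mult.left_commute[of _ c] sum_distrib_left)
      also have "\<dots> = c * x i + y i"
        using step.IH P(3) z i app_cong[where u = "R z" and v = z and P = P and i = i] by (simp add: R_def)
      also have "\<dots> = (sc c x + y) i" by (simp add: sc_def plus_fun_apply)
      finally show "app P (sc c x + y) i = (sc c x + y) i" .
    qed
  qed
  show thesis
  proof (rule that[of P])
    show "(\<Sum>j\<in>S. P i j * w j) = w i" if "w \<in> W" "i \<in> S" for w i
    proof -
      have "app P w i = app P (R w) i" by (rule app_cong) (simp only: R_def if_True)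
      also have "\<dots> = R w i" using span[of "R w"] B(3) that by blast
      finally show ?thesis using that by (simp add: R_def app_def)
    qed
    show "P i j = P j i" for i j by (rule P(1)[rule_format])
    show "\<exists>w\<in>W. \<forall>i\<in>S. P i j = w i" if "j \<in> S" for j by (rule bspec[OF P(2) that])
  qed
qed

section \<open>Rational fixed vectors of the tensor powers\<close>

text \<open>The coordinates are rational, but the equations are imposed in the algebra over
  \<open>'k\<close>; the type argument records this dependence.\<close>

definition fixed :: "'k::field_char_0 itself \<Rightarrow> nat \<Rightarrow> ('n::finite list \<Rightarrow> rat) set" where
  "fixed _ k = {v. \<forall>I\<in>words k.
     (\<Sum>J\<in>words k. qperm_scale (of_rat (v J) :: 'k) (qmon I J)) = qperm_scale (of_rat (v I)) 1}"

lemmas qperm_scale_simps = space_smul_simps[OF is_space_qperm, simplified]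

lemma fixed_zero: "(\<lambda>_. 0) \<in> fixed TYPE('k::field_char_0) k"
  by (simp add: fixed_def qperm_scale_simps)

lemma fixed_add: "u \<in> fixed TYPE('k::field_char_0) k \<Longrightarrow> v \<in> fixed TYPE('k) k \<Longrightarrow> (\<lambda>I. u I + v I) \<in> fixed TYPE('k) k"
  by (simp add: fixed_def qperm_scale_simps of_rat_add sum.distrib)

lemma fixed_scale:
  fixes v :: "'n::finite list \<Rightarrow> rat"
  assumes "v \<in> fixed TYPE('k::field_char_0) k"
  shows "(\<lambda>I. c * v I) \<in> fixed TYPE('k) k"
proof -
  have "qperm_scale (of_rat (c * a) :: 'k) x = qperm_scale (of_rat c) (qperm_scale (of_rat a) x)"
    for a and x :: "('k, 'n) qperm_algebra"
    by (simp add: qperm_scale_simps of_rat_mult)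
  then show ?thesis using assms by (simp add: fixed_def flip: qperm_scale_simps(7))
qed

lemma ex_fixed_projection:
  "\<exists>P :: 'n::finite list \<Rightarrow> 'n list \<Rightarrow> rat. (\<forall>I J. P I J = P J I) \<and>
    (\<forall>J\<in>words k. \<exists>w\<in>fixed TYPE('k::field_char_0) k. \<forall>I\<in>words k. P I J = w I) \<and>
    (\<forall>w\<in>fixed TYPE('k) k. \<forall>I\<in>words k. (\<Sum>J\<in>words k. P I J * w J) = w I)"
proof -
  obtain P :: "'n list \<Rightarrow> 'n list \<Rightarrow> rat" where "\<And>I J. P I J = P J I"
    "\<And>J. J \<in> words k \<Longrightarrow> \<exists>w\<in>fixed TYPE('k) k. \<forall>I\<in>words k. P I J = w I"
    "\<And>w I. w \<in> fixed TYPE('k) k \<Longrightarrow> I \<in> words k \<Longrightarrow> (\<Sum>J\<in>words k. P I J * w J) = w I"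
    using ex_orthogonal_projection[OF finite_words fixed_zero fixed_add fixed_scale] by blast
  then show ?thesis by blast
qed

definition fixproj :: "'k::field_char_0 itself \<Rightarrow> nat \<Rightarrow> 'n::finite list \<Rightarrow> 'n list \<Rightarrow> rat" where
  "fixproj _ k = (SOME P. (\<forall>I J. P I J = P J I) \<and>
    (\<forall>J\<in>words k. \<exists>w\<in>fixed TYPE('k) k. \<forall>I\<in>words k. P I J = w I) \<and>
    (\<forall>w\<in>fixed TYPE('k) k. \<forall>I\<in>words k. (\<Sum>J\<in>words k. P I J * w J) = w I))"

lemma fixproj:
  fixes I J :: "'n::finite list"
  shows "fixproj TYPE('k::field_char_0) k I J = fixproj TYPE('k) k J I"
    "J \<in> words k \<Longrightarrow> \<exists>w\<in>fixed TYPE('k) k. \<forall>I\<in>words k. fixproj TYPE('k) k I J = w I"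
    "w \<in> fixed TYPE('k) k \<Longrightarrow> I \<in> words k \<Longrightarrow> (\<Sum>J\<in>words k. fixproj TYPE('k) k I J * w J) = w I"
  using someI_ex[OF ex_fixed_projection[where 'k = 'k and 'n = 'n], of k] unfolding fixproj_def by blast+

text \<open>Morphisms between tensor powers given by 0/1-matrices, encoded as relations; their transposes
  are required to be morphisms as well.\<close>

definition intertwiner :: "'k::field_char_0 itself \<Rightarrow> nat \<Rightarrow> nat \<Rightarrow> ('n::finite list \<Rightarrow> 'n list \<Rightarrow> bool) \<Rightarrow> bool" where
  "intertwiner _ l k R \<longleftrightarrow> (\<forall>I\<in>words l. \<forall>M\<in>words k.
     (\<Sum>M' | M' \<in> words k \<and> R I M'. qmon M' M :: ('k, 'n) qperm_algebra)
       = (\<Sum>I' | I' \<in> words l \<and> R I' M. qmon I I') \<and>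
     (\<Sum>I' | I' \<in> words l \<and> R I' M. qmon I' I :: ('k, 'n) qperm_algebra)
       = (\<Sum>M' | M' \<in> words k \<and> R I M'. qmon M M'))"

lemma intertwiner_transpose:
  "intertwiner TYPE('k::field_char_0) l k R \<Longrightarrow> intertwiner TYPE('k) k l (\<lambda>M I. R I M)"
  unfolding intertwiner_def by blast

text \<open>With \<open>T\<close> the matrix of \<open>R\<close> and \<open>U_k\<close> the tensor
  powers, \<open>U_l T v = T U_k v = T v\<close>.\<close>

lemma intertwiner_fixed:
  assumes R: "intertwiner TYPE('k::field_char_0) l k R" and v: "v \<in> fixed TYPE('k) k"
  shows "(\<lambda>I. \<Sum>M | M \<in> words k \<and> R I M. v M) \<in> fixed TYPE('k) l"
  unfolding fixed_def
proof safe
  fix I :: "'a list" assume I: "I \<in> words l"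
  have s: "qperm_scale (of_rat (sum g A) :: 'k) x = (\<Sum>a\<in>A. qperm_scale (of_rat (g a)) x)"
    for g A and x :: "('k, 'a) qperm_algebra"
    by (simp add: of_rat_sum qperm_scale_simps)
  have "(\<Sum>J\<in>words l. qperm_scale (of_rat (\<Sum>M | M \<in> words k \<and> R J M. v M) :: 'k) (qmon I J))
    = (\<Sum>J\<in>words l. \<Sum>M | M \<in> words k \<and> R J M. qperm_scale (of_rat (v M) :: 'k) (qmon I J))"
    by (simp only: s)
  also have "\<dots> = (\<Sum>M\<in>words k. \<Sum>J | J \<in> words l \<and> R J M. qperm_scale (of_rat (v M) :: 'k) (qmon I J))"
    by (rule sum.swap_restrict) simp_all
  also have "\<dots> = (\<Sum>M\<in>words k. qperm_scale (of_rat (v M)) (\<Sum>M' | M' \<in> words k \<and> R I M'. qmon M' M))"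
    using R I by (intro sum.cong refl) (simp add: intertwiner_def flip: qperm_scale_simps(7))
  also have "\<dots> = (\<Sum>M' | M' \<in> words k \<and> R I M'. \<Sum>M\<in>words k. qperm_scale (of_rat (v M)) (qmon M' M))"
    by (subst sum.swap) (simp add: qperm_scale_simps)
  also have "\<dots> = (\<Sum>M' | M' \<in> words k \<and> R I M'. qperm_scale (of_rat (v M')) 1)"
    using v by (intro sum.cong refl) (simp add: fixed_def)
  also have "\<dots> = qperm_scale (of_rat (\<Sum>M' | M' \<in> words k \<and> R I M'. v M')) 1"
    by (simp only: s)
  finally show "(\<Sum>J\<in>words l. qperm_scale (of_rat (\<Sum>M | M \<in> words k \<and> R J M. v M) :: 'k) (qmon I J))
    = qperm_scale (of_rat (\<Sum>M' | M' \<in> words k \<and> R I M'. v M')) 1" .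
qed

text \<open>If \<open>T\<close> and its transpose preserve the fixed vectors, then \<open>T P = P T P = P T\<close>.\<close>

lemma fixproj_commute:
  fixes R :: "'n::finite list \<Rightarrow> 'n list \<Rightarrow> bool"
  assumes R: "intertwiner TYPE('k::field_char_0) l k R" and I: "I \<in> words l" and M: "M \<in> words k"
  shows "(\<Sum>M' | M' \<in> words k \<and> R I M'. fixproj TYPE('k) k M' M)
    = (\<Sum>I' | I' \<in> words l \<and> R I' M. fixproj TYPE('k) l I I')"
proof -
  let ?P = "fixproj TYPE('k) k :: 'n list \<Rightarrow> 'n list \<Rightarrow> rat" and ?Q = "fixproj TYPE('k) l :: 'n list \<Rightarrow> 'n list \<Rightarrow> rat"
  \<comment> \<open>\<open>1\<close> says \<open>Q T P = T P\<close>, and \<open>2\<close> says the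
    same for the transpose of \<open>T\<close>. Transposing \<open>2\<close> by symmetry of both
    projections gives \<open>Q T P = Q T\<close>.\<close>
  have 1: "(\<Sum>I'\<in>words l. ?Q I I' * (\<Sum>M' | M' \<in> words k \<and> R I' M'. ?P M' M)) = (\<Sum>M' | M' \<in> words k \<and> R I M'. ?P M' M)"
  proof -
    obtain w where w: "w \<in> fixed TYPE('k) k" "\<And>M'. M' \<in> words k \<Longrightarrow> ?P M' M = w M'"
      using fixproj(2)[OF M] by blast
    have "(\<Sum>M' | M' \<in> words k \<and> R I' M'. ?P M' M) = (\<Sum>M' | M' \<in> words k \<and> R I' M'. w M')" for I'
      using w(2) by (intro sum.cong) auto
    then show ?thesis using fixproj(3)[OF intertwiner_fixed[OF R w(1)] I] by simp
  qed
  have 2: "(\<Sum>M'\<in>words k. ?P M M' * (\<Sum>I' | I' \<in> words l \<and> R I' M'. ?Q I' I)) = (\<Sum>I' | I' \<in> words l \<and> R I' M. ?Q I' I)"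
  proof -
    obtain w where w: "w \<in> fixed TYPE('k) l" "\<And>I'. I' \<in> words l \<Longrightarrow> ?Q I' I = w I'"
      using fixproj(2)[OF I] by blast
    have "(\<Sum>I' | I' \<in> words l \<and> R I' M'. ?Q I' I) = (\<Sum>I' | I' \<in> words l \<and> R I' M'. w I')" for M'
      using w(2) by (intro sum.cong) auto
    then show ?thesis using fixproj(3)[OF intertwiner_fixed[OF intertwiner_transpose[OF R] w(1)] M] by simp
  qed
  have "(\<Sum>M' | M' \<in> words k \<and> R I M'. ?P M' M) = (\<Sum>I'\<in>words l. \<Sum>M' | M' \<in> words k \<and> R I' M'. ?Q I I' * ?P M' M)"
    using 1 by (simp add: sum_distrib_left)
  also have "\<dots> = (\<Sum>M'\<in>words k. \<Sum>I' | I' \<in> words l \<and> R I' M'. ?Q I I' * ?P M' M)"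
    by (rule sum.swap_restrict) simp_all
  also have "\<dots> = (\<Sum>M'\<in>words k. ?P M M' * (\<Sum>I' | I' \<in> words l \<and> R I' M'. ?Q I' I))"
    by (simp add: sum_distrib_left fixproj(1)[of _ _ M] fixproj(1)[of _ I] mult.commute)
  also have "\<dots> = (\<Sum>I' | I' \<in> words l \<and> R I' M. ?Q I I')"
    unfolding 2 by (intro sum.cong refl fixproj(1))
  finally show ?thesis .
qed

section \<open>Merging and insertion as intertwiners\<close>

lemma words_split: "I \<in> words (p + Suc q) \<Longrightarrow> \<exists>a i b. I = a @ i # b \<and> length a = p \<and> length b = q"
  by (intro exI[of _ "take p I"] exI[of _ "I ! p"] exI[of _ "drop (Suc p) I"]) (auto simp: id_take_nth_drop[symmetric])

text \<open>As a matrix with rows \<open>I\<close> and columns \<open>M\<close> this is the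
  multiplication of \<open>'k ^ 'n\<close> in the tensor factors \<open>p\<close> and
  \<open>p + 1\<close>, counted from 0, and the identity elsewhere.\<close>

definition merge_rel :: "nat \<Rightarrow> 'n list \<Rightarrow> 'n list \<Rightarrow> bool" where
  "merge_rel p I M \<longleftrightarrow> (\<exists>a i b. length a = p \<and> I = a @ i # b \<and> M = a @ i # i # b)"

text \<open>As a matrix with rows \<open>I\<close> and columns \<open>M\<close> it inserts the unit
  vector, the sum of all basis vectors, at position \<open>p\<close>. The name describes the passage
  from \<open>I\<close> to \<open>M\<close>, that is, the transpose.\<close>

definition delete_rel :: "nat \<Rightarrow> 'n list \<Rightarrow> 'n list \<Rightarrow> bool" where
  "delete_rel p I M \<longleftrightarrow> (\<exists>a i b. length a = p \<and> I = a @ i # b \<and> M = a @ b)"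

lemma merge_rel_iff:
  assumes "length a = p"
  shows "merge_rel p (a @ i # b) M \<longleftrightarrow> M = a @ i # i # b"
    "merge_rel p I (a @ i # j # b) \<longleftrightarrow> i = j \<and> I = a @ i # b"
proof -
  have e: "a @ c = a' @ c' \<longleftrightarrow> a = a' \<and> c = c'" if "length a' = p" for a' c c'
    using assms that by simp
  show "merge_rel p (a @ i # b) M \<longleftrightarrow> M = a @ i # i # b"
    "merge_rel p I (a @ i # j # b) \<longleftrightarrow> i = j \<and> I = a @ i # b"
    unfolding merge_rel_def using assms by (safe, simp_all only: e list.inject, blast+)
qed

lemma delete_rel_iff:
  assumes "length a = p"
  shows "delete_rel p (a @ i # b) M \<longleftrightarrow> M = a @ b"
    "delete_rel p I (a @ b) \<longleftrightarrow> (\<exists>i. I = a @ i # b)"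
proof -
  have e: "a @ c = a' @ c' \<longleftrightarrow> a = a' \<and> c = c'" if "length a' = p" for a' c c'
    using assms that by simp
  show "delete_rel p (a @ i # b) M \<longleftrightarrow> M = a @ b"
    "delete_rel p I (a @ b) \<longleftrightarrow> (\<exists>i. I = a @ i # b)"
    unfolding delete_rel_def using assms by (safe, simp_all only: e list.inject, blast+)
qed

lemma merge_rel_sets:
  fixes a b :: "'n::finite list"
  assumes "length a = p" "length b = q"
  shows "{M. M \<in> words (p + Suc (Suc q)) \<and> merge_rel p (a @ i # b) M} = {a @ i # i # b}"
    "{I. I \<in> words (p + Suc q) \<and> merge_rel p I (a @ i # j # b)} = (if i = j then {a @ i # b} else {})"
  using assms by (auto simp: merge_rel_iff)

lemma delete_rel_sets:
  fixes a b :: "'n::finite list"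
  assumes "length a = p" "length b = q"
  shows "{M. M \<in> words (p + q) \<and> delete_rel p (a @ i # b) M} = {a @ b}"
    "{I. I \<in> words (p + Suc q) \<and> delete_rel p I (a @ b)} = range (\<lambda>i. a @ i # b)"
  using assms by (auto simp: delete_rel_iff)

lemma words_split2:
  assumes "M \<in> words (p + Suc (Suc q))"
  obtains c j j' d where "M = c @ j # j' # d" "length c = p" "length d = q"
  using words_split[OF assms] by (auto simp: length_Suc_conv)

text \<open>The two equations required are the quadratic relations within one row and within one
  column, each placed between two monomials. For \<open>delete_rel\<close> they are the two linear
  relations.\<close>

lemma intertwiner_merge:
  "intertwiner TYPE('k::field_char_0) (p + Suc q) (p + Suc (Suc q)) (merge_rel p :: 'n::finite list \<Rightarrow> _)"
  unfolding intertwiner_def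
proof (intro ballI, goal_cases)
  case (1 I M)
  obtain a i b where I: "I = a @ i # b" "length a = p" "length b = q" using words_split[OF 1(1)] by blast
  obtain c j j' d where M: "M = c @ j # j' # d" "length c = p" "length d = q" using words_split2[OF 1(2)] .
  have "qperm_gen i j * (qperm_gen i j' * x) = (if j = j' then qperm_gen i j * x else (0 :: ('k, 'n) qperm_algebra))"
    "qperm_gen j i * (qperm_gen j' i * x) = (if j = j' then qperm_gen j i * x else (0 :: ('k, 'n) qperm_algebra))" for x
    by (simp_all add: mult.assoc[symmetric] qperm_gen_relations)
  then show ?case
    unfolding I(1) M(1) merge_rel_sets[OF I(2,3)] merge_rel_sets[OF M(2,3)]
    using I(2,3) M(2,3) by (simp add: mon_append)
qed

lemma sum_insert_letter:
  "(\<Sum>x\<in>range (\<lambda>j. c @ j # d). f x) = (\<Sum>j\<in>UNIV. f (c @ j # d))"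
  by (subst sum.reindex) (auto simp: inj_on_def)

lemma intertwiner_delete:
  "intertwiner TYPE('k::field_char_0) (p + Suc q) (p + q) (delete_rel p :: 'n::finite list \<Rightarrow> _)"
  unfolding intertwiner_def
proof (intro ballI, goal_cases)
  case (1 I M)
  obtain a i b where I: "I = a @ i # b" "length a = p" "length b = q" using words_split[OF 1(1)] by blast
  obtain c d where M: "M = c @ d" "length c = p" "length d = q"
    using 1(2) by (intro that[of "take p M" "drop p M"]) auto
  show ?case
    unfolding I(1) M(1) delete_rel_sets[OF I(2,3)] delete_rel_sets[OF M(2,3)] sum_insert_letter
    using I(2,3) M(2,3)
    by (simp add: mon_append qperm_gen_relations flip: sum_distrib_left sum_distrib_right)
qed

text \<open>With \<open>fixproj_delete\<close>, this says that the entries of the projections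
  satisfy the linear relations of the monomials \<open>qmon\<close>, in the row version; symmetry of
  \<open>fixproj\<close> supplies the column version.\<close>

lemma fixproj_merge:
  fixes a b c d :: "'n::finite list"
  assumes "length a = p" "length b = q" "length c = p" "length d = q"
  shows "fixproj TYPE('k::field_char_0) (p + Suc (Suc q)) (a @ i # i # b) (c @ j # j' # d)
    = (if j = j' then fixproj TYPE('k) (p + Suc q) (a @ i # b) (c @ j # d) else 0)"
  using fixproj_commute[OF intertwiner_merge[where 'k = 'k], of "a @ i # b" p q "c @ j # j' # d"] assms
  by (simp add: merge_rel_sets[simplified])

lemma fixproj_delete:
  fixes a b c d :: "'n::finite list"
  assumes "length a = p" "length b = q" "length c = p" "length d = q"
  shows "(\<Sum>j\<in>UNIV. fixproj TYPE('k::field_char_0) (p + Suc q) (a @ i # b) (c @ j # d))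
    = fixproj TYPE('k) (p + q) (a @ b) (c @ d)"
  using fixproj_commute[OF intertwiner_delete[where 'k = 'k], of "a @ i # b" p q "c @ d"] assms
  by (simp add: delete_rel_sets[simplified] sum_insert_letter)

section \<open>The Haar functional\<close>

text \<open>A Haar functional has to send the matrix of a tensor power to a projection onto its
  invariants. Here this formula is taken as the definition on words, and compatibility with the
  relations is \<open>fixproj_merge\<close> and \<open>fixproj_delete\<close> between arbitrary
  words \<open>v\<close> and \<open>w\<close>.\<close>

lemma ex_haar:
  obtains haar :: "('k::field_char_0, 'n::finite) qperm_algebra \<Rightarrow> 'k"
  where "linear_map qperm base_field haar"
    "\<And>I J. length I = length J \<Longrightarrow> haar (qmon I J) = of_rat (fixproj TYPE('k) (length I) I J)"
proof -
  define P where "P ps = (of_rat (fixproj TYPE('k) (length ps) (map fst ps) (map snd ps)) :: 'k)" for ps :: "('n \<times> 'n) list"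
  define f where "f w = (case w of Word ps \<Rightarrow> P ps)" for w
  note sp = is_space_base_field
  let ?E = "lin_ext base_field f"
  have rel: "?E (Poly_Mapping.single v 1 * r * Poly_Mapping.single w 1) = 0" if r: "r \<in> qperm_relations" for r v w
  proof -
    obtain as bs where [simp]: "v = Word as" "w = Word bs" by (cases v; cases w)
    let ?\<phi> = "\<lambda>r. ?E (Poly_Mapping.single v 1 * r * Poly_Mapping.single w 1)"
    have diff: "?\<phi> (p - q) = ?\<phi> p - ?\<phi> q" for p q by (simp add: algebra_simps lin_ext_diff[OF sp])
    have sum: "?\<phi> (\<Sum>i\<in>S. p i) = (\<Sum>i\<in>S. ?\<phi> (p i))" for p :: "'n \<Rightarrow> _" and S
      by (simp add: sum_distrib_left sum_distrib_right lin_ext_sum[OF sp])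
    have one: "?E (Poly_Mapping.single v 1 * Poly_Mapping.single w 1) = P (as @ bs)" by (simp add: mult_single lin_ext_single[OF sp] f_def)
    have gen: "?\<phi> (gen x) = P (as @ x # bs)" for x
      by (simp add: gen_def mult_single lin_ext_single[OF sp] f_def)
    have gen2: "?\<phi> (gen x * gen y) = P (as @ x # y # bs)" for x y
      by (simp add: gen_def mult_single lin_ext_single[OF sp] f_def)
    let ?F = "fixproj TYPE('k)"
    have merge: "P (as @ (i, j) # (i, j') # bs) = (if j = j' then P (as @ (i, j) # bs) else 0)" for i j j'
      using fixproj_merge[of "map fst as" "length as" "map fst bs" "length bs" "map snd as" "map snd bs" i j j', where 'k = 'k]
      by (simp add: P_def)
    have merge': "P (as @ (j, i) # (j', i) # bs) = (if j = j' then P (as @ (j, i) # bs) else 0)" for i j j'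
      using fixproj_merge[of "map snd as" "length as" "map snd bs" "length bs" "map fst as" "map fst bs" i j j', where 'k = 'k]
      by (simp add: P_def fixproj(1)[of _ "map fst as @ _"])
    have delete: "(\<Sum>l\<in>UNIV. P (as @ (i, l) # bs)) = P (as @ bs)" for i
      using fixproj_delete[of "map fst as" "length as" "map fst bs" "length bs" "map snd as" "map snd bs" i, where 'k = 'k]
      by (simp add: P_def flip: of_rat_sum)
    have delete': "(\<Sum>l\<in>UNIV. P (as @ (l, i) # bs)) = P (as @ bs)" for i
      using fixproj_delete[of "map snd as" "length as" "map snd bs" "length bs" "map fst as" "map fst bs" i, where 'k = 'k]
      by (simp add: P_def fixproj(1)[of _ "map fst as @ _"] flip: of_rat_sum)
    show ?thesis
      using r unfolding qperm_relations_def
      by (auto simp: diff sum lin_ext_zero one gen gen2 merge merge' delete delete' simp del: \<open>v = Word as\<close> \<open>w = Word bs\<close>)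
  qed
  obtain haar where haar: "linear_map qperm_space base_field haar" "\<And>p. haar (abs_qperm_algebra p) = ?E p"
    by (rule ex_qperm_linear[OF sp, of f]) (auto intro: lin_ext_ideal[OF sp rel])
  show thesis
  proof
    show "linear_map qperm base_field haar" using haar(1) by (simp add: qperm_space_eq)
    show "haar (qmon I J) = of_rat (fixproj TYPE('k) (length I) I J)" if "length I = length J" for I J
      using that by (simp add: qmon_abs haar(2) lin_ext_single[OF sp] f_def P_def)
  qed
qed

text \<open>An invariant vector of a tensor product of two matrices is the same as a morphism from
  the dual of the second to the first. Multiplying the invariance equation on the right by entries
  of the second power and cancelling with \<open>sum_qmon_left\<close> moves that factor to the
  other side; the antipode is responsible for the reversed words.\<close>

lemma fixed_append:
  assumes w: "w \<in> fixed TYPE('k::field_char_0) (r + s)" and I: "I \<in> words r" and L: "L \<in> words s"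
  shows "(\<Sum>N\<in>words s. qperm_scale (of_rat (w (I @ rev N)) :: 'k) (qmon N L))
    = (\<Sum>M\<in>words r. qperm_scale (of_rat (w (M @ rev L))) (qmon I M))"
proof -
  note alg = is_algebraD(3,4)[OF is_algebra_qperm, simplified]
  have 1: "qperm_scale (of_rat (w (I @ R)) :: 'k) 1
      = (\<Sum>M\<in>words r. \<Sum>M'\<in>words s. qperm_scale (of_rat (w (M @ M'))) (qmon I M * qmon R M'))"
    if "R \<in> words s" for R
  proof -
    have "I @ R \<in> words (r + s)" using I that by simp
    then have "(\<Sum>J\<in>words (r + s). qperm_scale (of_rat (w J) :: 'k) (qmon (I @ R) J)) = qperm_scale (of_rat (w (I @ R))) 1"
      using w by (simp add: fixed_def)
    then show ?thesis using I by (simp add: sum_words_append mon_append cong: sum.cong_simp)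
  qed
  have "(\<Sum>N\<in>words s. qperm_scale (of_rat (w (I @ rev N)) :: 'k) (qmon N L))
      = (\<Sum>N\<in>words s. qperm_scale (of_rat (w (I @ rev N)) :: 'k) 1 * qmon N L)"
    by (simp add: alg)
  also have "\<dots> = (\<Sum>N\<in>words s. \<Sum>M\<in>words r. \<Sum>M'\<in>words s.
      qperm_scale (of_rat (w (M @ M'))) (qmon I M * (qmon (rev N) M' * qmon N L)))"
    by (simp add: 1 sum_distrib_right alg mult.assoc cong: sum.cong_simp)
  also have "\<dots> = (\<Sum>M\<in>words r. \<Sum>M'\<in>words s.
      qperm_scale (of_rat (w (M @ M'))) (qmon I M * (\<Sum>N\<in>words s. qmon (rev N) M' * qmon N L)))"
    by (simp add: sum_distrib_left qperm_scale_simps sum.swap[of _ "words r" "words s"])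
      (subst sum.swap, rule refl)
  also have "\<dots> = (\<Sum>M\<in>words r. \<Sum>M'\<in>words s. if M' = rev L then qperm_scale (of_rat (w (M @ M'))) (qmon I M) else 0)"
  proof (intro sum.cong refl)
    fix M M' :: "'a list" assume "M' \<in> words s"
    then have "(\<Sum>N\<in>words s. qmon (rev N) M' * qmon N L) = (of_bool (rev M' = L) :: ('k, 'a) qperm_algebra)"
      using sum_qmon_left[of "rev M'" L, where 'k = 'k] L by simp
    then show "qperm_scale (of_rat (w (M @ M')) :: 'k) (qmon I M * (\<Sum>N\<in>words s. qmon (rev N) M' * qmon N L))
      = (if M' = rev L then qperm_scale (of_rat (w (M @ M'))) (qmon I M) else 0)"
      by (auto simp: qperm_scale_simps)
  qed
  also have "\<dots> = (\<Sum>M\<in>words r. qperm_scale (of_rat (w (M @ rev L))) (qmon I M))"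
    using L by simp
  finally show ?thesis .
qed

theorem cosemisimple_qperm:
  "cosemisimple TYPE('v::ab_group_add) (qperm :: ('k::field_char_0, ('k, 'n::finite) qperm_algebra) hopf)"
proof -
  let ?Q = "qperm :: ('k, ('k, 'n) qperm_algebra) hopf"
  note sp = is_space_qperm is_space_base_field
  obtain haar :: "('k, 'n) qperm_algebra \<Rightarrow> 'k" where haar: "linear_map ?Q base_field haar"
    and haar_mon: "\<And>I J. length I = length J \<Longrightarrow> haar (qmon I J) = of_rat (fixproj TYPE('k) (length I) I J)"
    using ex_haar[where 'k = 'k and 'n = 'n] by blast
  \<comment> \<open>The cointegral that belongs to a Haar functional. Its normalisation is the
    antipode axiom \<open>y_1 S(y_2)\<close> = \<epsilon>\<open>(y)\<close> together with
    \<open>haar 1 = 1\<close>.\<close>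
  define \<theta> where "\<theta> y x = haar (y * qperm_antipode x)" for y x
  have \<theta>: "bilinear_map ?Q ?Q base_field \<theta>"
    unfolding \<theta>_def using bilinear_comp[OF bilinear_qperm_antipode(2) linear_map_id(1) linear_map_id(1) haar] .
  have \<theta>_mon: "\<theta> (qmon I J) (qmon K L) = of_rat (fixproj TYPE('k) (length I + length K) (I @ rev L) (J @ rev K))"
    if "length I = length J" "length K = length L" for I J K L
    using that haar_mon[of "I @ rev L" "J @ rev K"] by (simp add: \<theta>_def qperm_antipode_mon mon_append)
  \<comment> \<open>In the zeroth tensor power every vector is fixed, so the projection is the
    identity there; this normalises the Haar functional.\<close>
  have "(\<lambda>_. 1) \<in> fixed TYPE('k) 0" by (simp add: fixed_def sum_words_0 del: sum_constant)
  from fixproj(3)[OF this, of "[]"] have "fixproj TYPE('k) 0 [] ([] :: 'n list) = 1"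
    by (simp add: sum_words_0 del: sum_constant)
  then have haar_one: "haar 1 = 1" using haar_mon[of "[]" "[]"] by simp
  have norm: "tensor_lift ?Q ?Q \<theta> (comult ?Q x) = counit ?Q x" for x
  proof -
    have "tensor_lift ?Q ?Q \<theta> (comult ?Q x) = haar (tensor_lift ?Q ?Q (\<lambda>a b. a * qperm_antipode b) (comult ?Q x))"
      unfolding \<theta>_def
      by (rule tensor_lift_linear_comp[OF sp(1,1,1,2) bilinear_qperm_antipode(2) haar, symmetric])
        (use linear_map_in[OF qperm_comult_linear] in simp)
    also have "\<dots> = haar (qperm_scale (qperm_counit x) 1)"
      using hopf_algebra_qperm[where 'k = 'k and 'n = 'n] by (simp add: hopf_algebra_def)
    also have "\<dots> = qperm_counit x"
      using linear_map_scale[OF haar, of 1 "qperm_counit x"] by (simp add: haar_one)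
    finally show ?thesis by simp
  qed
  have coint: "tensor_lift ?Q ?Q (\<lambda>a b. f a * \<theta> b x) (comult ?Q y)
      = \<theta> y (tensor_lift ?Q ?Q (\<lambda>a b. smul ?Q (f b) a) (comult ?Q x))"
    if f: "linear_map ?Q base_field f" for f x y
  proof -
    have b1: "bilinear_map ?Q ?Q base_field (\<lambda>a b. f a * \<theta> b x)" for x
      using f bilinear_left[OF \<theta>, of x] by (auto simp: bilinear_map_def linear_map_def algebra_simps)
    have b2: "bilinear_map ?Q ?Q ?Q (\<lambda>a b. smul ?Q (f b) a)"
      by (intro bilinear_mapI linear_map_smul[OF sp(1) linear_map_id(1)] linear_map_smul_left[OF sp(1) f])
    have in_\<Delta>: "comult ?Q y \<in> carr (tensor ?Q ?Q)" for y
      using linear_map_in[OF qperm_comult_linear] by simp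
    have \<theta>l: "linear_map ?Q base_field (\<lambda>y. \<theta> y x)" and \<theta>r: "linear_map ?Q base_field (\<theta> y)" for x y
      using bilinear_left[OF \<theta>] bilinear_right[OF \<theta>] by simp_all
    have \<Delta>: "linear_map ?Q (tensor ?Q ?Q) (comult ?Q)" using qperm_comult_linear by simp
    show ?thesis
    proof (rule qperm_linear_eqI'[where x = y, OF linear_map_comp[OF \<Delta> tensor_lift_linear[OF sp b1]] \<theta>l])
      fix I J :: "'n list" assume IJ: "length I = length J"
      have lin1: "linear_map ?Q base_field (\<lambda>x. tensor_lift ?Q ?Q (\<lambda>a b. f a * \<theta> b x) (comult ?Q (qmon I J)))"
      proof (rule linear_tensor_lift_param[OF sp(1,1,2,1) b1 _ in_\<Delta>])
        show "linear_map ?Q base_field (\<lambda>x. f a * \<theta> b x)" for a b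
          using linear_map_smul[OF sp(2) \<theta>r[of b], of "f a"] by simp
      qed
      show "tensor_lift ?Q ?Q (\<lambda>a b. f a * \<theta> b x) (comult ?Q (qmon I J))
        = \<theta> (qmon I J) (tensor_lift ?Q ?Q (\<lambda>a b. smul ?Q (f b) a) (comult ?Q x))"
      proof (rule qperm_linear_eqI'[where x = x, OF lin1 linear_map_comp[OF linear_map_comp[OF \<Delta> tensor_lift_linear[OF sp(1,1) b2]] \<theta>r]])
        fix K L :: "'n list" assume KL: "length K = length L"
        let ?r = "length I" and ?s = "length K"
        \<comment> \<open>All values of \<theta> occurring on the two sides are entries in the one
          column of the projection at \<open>J @ rev K\<close>. That column is a fixed vector, so
          the identity on monomials is \<open>fixed_append\<close>.\<close>
        obtain w where w: "w \<in> fixed TYPE('k) (?r + ?s)"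
          "\<And>M. M \<in> words (?r + ?s) \<Longrightarrow> fixproj TYPE('k) (?r + ?s) M (J @ rev K) = w M"
          using fixproj(2)[where 'k = 'k, of "J @ rev K" "?r + ?s"] IJ by auto
        have f_sc: "f (qperm_scale c z) = c * f z" for c z using linear_map_scale[OF f, of z c] by simp
        have f_sum: "f (\<Sum>i\<in>S. g i) = (\<Sum>i\<in>S. f (g i))" for S and g :: "'n list \<Rightarrow> _"
          using linear_map_sum[OF f sp(1)] by simp
        have "tensor_lift ?Q ?Q (\<lambda>a b. f a * \<theta> b (qmon K L)) (comult ?Q (qmon I J))
          = (\<Sum>M\<in>words ?r. f (qmon I M) * \<theta> (qmon M J) (qmon K L))"
          using tensor_lift_sum[OF sp(1,1,2) b1] by (simp add: qperm_comult_mon[OF IJ])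
        also have "\<dots> = (\<Sum>M\<in>words ?r. of_rat (w (M @ rev L)) * f (qmon I M))"
          using IJ KL w(2) by (intro sum.cong refl) (simp add: \<theta>_mon)
        also have "\<dots> = f (\<Sum>M\<in>words ?r. qperm_scale (of_rat (w (M @ rev L))) (qmon I M))"
          by (simp add: f_sum f_sc)
        also have "\<dots> = f (\<Sum>N\<in>words ?s. qperm_scale (of_rat (w (I @ rev N))) (qmon N L))"
          using fixed_append[OF w(1), of I L] KL by simp
        also have "\<dots> = (\<Sum>N\<in>words ?s. f (qmon N L) * \<theta> (qmon I J) (qmon K N))"
          using IJ KL w(2) by (simp add: f_sum f_sc \<theta>_mon mult.commute cong: sum.cong_simp)
        also have "\<dots> = \<theta> (qmon I J) (\<Sum>N\<in>words ?s. qperm_scale (f (qmon N L)) (qmon K N))"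
          using linear_map_scale[OF \<theta>r] by (simp add: linear_map_sum[OF \<theta>r sp(1)])
        also have "(\<Sum>N\<in>words ?s. qperm_scale (f (qmon N L)) (qmon K N))
          = tensor_lift ?Q ?Q (\<lambda>a b. smul ?Q (f b) a) (comult ?Q (qmon K L))"
          by (simp add: qperm_comult_mon[OF KL] tensor_lift_sum[OF sp(1,1,1) b2[simplified]])
        finally show "tensor_lift ?Q ?Q (\<lambda>a b. f a * \<theta> b (qmon K L)) (comult ?Q (qmon I J))
          = \<theta> (qmon I J) (tensor_lift ?Q ?Q (\<lambda>a b. smul ?Q (f b) a) (comult ?Q (qmon K L)))" .
      qed
    qed
  qed
  show ?thesis
    by (rule coseparable_cosemisimple[OF bialgebra_qperm \<theta> coint norm])
qed

section \<open>Finite-dimensional comodules as matrices\<close>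

lemma diag_simps [simp]: "carr diag_algebra = UNIV" "smul diag_algebra = (*s)"
  by (simp_all add: diag_algebra_def)

lemma is_algebra_diag: "is_algebra diag_algebra"
proof -
  have "vector_space ((*s) :: 'a \<Rightarrow> 'a ^ 'b \<Rightarrow> 'a ^ 'b)"
    by unfold_locales (simp_all add: vec_eq_iff algebra_simps)
  then show ?thesis
    by (simp add: is_algebra_def is_space_def module.subspace_UNIV module_iff_vector_space)
      (simp add: vec_eq_iff mult_ac)
qed

lemma is_space_diag: "is_space diag_algebra"
  by (rule is_algebraD(1)[OF is_algebra_diag])

lemma axis_expansion: "v = (\<Sum>i\<in>UNIV. (v $ i) *s axis i 1)" for v :: "'k::field ^ 'n"
  by (simp add: vec_eq_iff axis_def if_distrib cong: if_cong)

lemma axis_mult: "axis i 1 * axis j 1 = (if i = j then axis i 1 else (0 :: 'k::field ^ 'n))"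
  by (auto simp: vec_eq_iff axis_def)

lemma one_axis: "(1 :: 'k::field ^ 'n) = (\<Sum>i\<in>UNIV. axis i 1)"
  by (simp add: vec_eq_iff axis_def)

lemma linear_coord: "linear_map diag_algebra base_field (\<lambda>v. v $ i)"
  by (simp add: linear_map_def)

lemma coord_bilinear:
  "is_space W \<Longrightarrow> bilinear_map diag_algebra W W (\<lambda>v h. smul W (v $ k) h)"
  by (intro bilinear_mapI linear_map_smul[OF _ linear_map_id(1)] linear_map_smul_left linear_coord)

lemma tensor_diag_expansion:
  fixes W :: "('k::field, 'w::ab_group_add, 'm) vspace_scheme" and t :: "('k, 'k ^ 'n, 'w) tensors"
  assumes W: "is_space W" and t: "t \<in> carr (tensor diag_algebra W)"
  shows "t = (\<Sum>k\<in>UNIV. tens diag_algebra W (axis k 1) (tensor_lift diag_algebra W (\<lambda>v h. smul W (v $ k) h) t))"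
proof (rule tensor_eqI[OF is_space_diag W linear_map_id(1) _ _ t])
  show "linear_map (tensor diag_algebra W) (tensor diag_algebra W)
    (\<lambda>t. \<Sum>k\<in>UNIV. tens diag_algebra W (axis k (1::'k) :: 'k ^ 'n) (tensor_lift diag_algebra W (\<lambda>v h. smul W (v $ k) h) t))"
    by (intro linear_map_sum_fun is_space_tensor linear_map_comp[OF tensor_lift_linear[OF is_space_diag W coord_bilinear[OF W]]
          linear_tens_right[OF is_space_diag W]]) simp
  fix v :: "'k ^ 'n" and w assume w: "w \<in> carr W"
  have lift: "tensor_lift diag_algebra W (\<lambda>v h. smul W (v $ k) h) (tens diag_algebra W v w) = smul W (v $ k) w" for k
    using w by (simp add: tensor_lift_tens[OF W coord_bilinear[OF W]])
  have "tens diag_algebra W v w = tens diag_algebra W (\<Sum>k\<in>UNIV. (v $ k) *s axis k 1) w"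
    by (simp flip: axis_expansion)
  also have "\<dots> = (\<Sum>k\<in>UNIV. tens diag_algebra W ((v $ k) *s axis k 1) w)"
    using w by (intro tens_sum_left[OF is_space_diag W]) simp_all
  also have "\<dots> = (\<Sum>k\<in>UNIV. tens diag_algebra W (axis k 1) (smul W (v $ k) w))"
    using w by (simp add: tens_scale_left[OF is_space_diag W, simplified] tens_scale_right[OF is_space_diag W])
  finally show "tens diag_algebra W v w = (\<Sum>k\<in>UNIV. tens diag_algebra W (axis k 1)
      (tensor_lift diag_algebra W (\<lambda>v h. smul W (v $ k) h) (tens diag_algebra W v w)))"
    unfolding lift .
qed

lemma tensor_diag_unique:
  fixes W :: "('k::field, 'w::ab_group_add, 'm) vspace_scheme"
  assumes W: "is_space W" and "\<And>k. a k \<in> carr W" "\<And>k. b k \<in> carr W"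
    and eq: "(\<Sum>k\<in>UNIV. tens diag_algebra W (axis k 1 :: 'k ^ 'n) (a k)) = (\<Sum>k\<in>UNIV. tens diag_algebra W (axis k 1) (b k))"
  shows "a = b"
proof
  fix k
  have "tensor_lift diag_algebra W (\<lambda>v h. smul W (v $ k) h) (\<Sum>j\<in>UNIV. tens diag_algebra W (axis j 1 :: 'k ^ 'n) (c j)) = c k"
    if c: "\<And>k. c k \<in> carr W" for c
  proof -
    have "smul W (axis j (1::'k) $ k) (c j) = (if j = k then c j else 0)" for j :: 'n
      by (simp add: axis_def space_smul_simps[OF W])
    then show ?thesis
      using c by (simp add: tensor_lift_sum[OF is_space_diag W W coord_bilinear[OF W]])
  qed
  from this[of a] this[of b] show "a k = b k" using assms(2,3) by (simp add: eq)
qed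

text \<open>The comodule structure with matrix \<open>x\<close> on a space identified with \<open>'k ^ 'n\<close> via
  mutually inverse maps \<open>\<iota>\<close> and \<open>\<kappa>\<close>.\<close>

definition matrix_coaction ::
  "('k::field, 'h::ring_1) hopf \<Rightarrow> ('k, 'v::ab_group_add, 'm) vspace_scheme \<Rightarrow> ('k ^ 'n \<Rightarrow> 'v) \<Rightarrow> ('v \<Rightarrow> 'k ^ 'n)
     \<Rightarrow> ('n::finite \<Rightarrow> 'n \<Rightarrow> 'h) \<Rightarrow> 'v \<Rightarrow> ('k, 'v, 'h) tensors" where
  "matrix_coaction H V \<iota> \<kappa> x v =
     (\<Sum>k\<in>UNIV. tens V H (\<iota> (axis k 1)) (\<Sum>i\<in>UNIV. smul H (\<kappa> v $ i) (x k i)))"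

lemma linear_matrix_row:
  assumes H: "is_algebra H" and \<kappa>: "linear_map V diag_algebra \<kappa>"
  shows "linear_map V H (\<lambda>v. \<Sum>i\<in>UNIV. smul H (\<kappa> v $ i) (x i))"
proof -
  note sp = is_algebraD(1)[OF H]
  show ?thesis
    by (intro linear_map_sum_fun[OF sp] linear_map_smul_left[OF sp] linear_map_comp[OF \<kappa> linear_coord])
      (simp add: is_algebraD(2)[OF H])
qed

lemma matrix_row_axis:
  assumes H: "is_space H"
  shows "(\<Sum>j\<in>UNIV. smul H (axis i 1 $ j) (y j)) = y i"
proof -
  have "smul H (axis i 1 $ j) (y j) = (if j = i then y j else 0)" for j
    by (simp add: axis_def space_smul_simps[OF H])
  then show ?thesis by simp
qed

lemma matrix_comodule:
  assumes H: "bialgebra H" and x: "comult_matrix H x" and V: "is_space V"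
    and \<iota>: "linear_map diag_algebra V \<iota>" and \<kappa>: "linear_map V diag_algebra \<kappa>"
    and inv: "\<And>v. v \<in> carr V \<Longrightarrow> \<iota> (\<kappa> v) = v" "\<And>u. \<kappa> (\<iota> u) = u"
  shows "comodule H V (matrix_coaction H V \<iota> \<kappa> x)"
proof -
  note Hs = bialgebraD[OF H] and alg = is_algebraD(2)[OF bialgebraD(1)[OF H]]
  note sp = V Hs(4) is_space_tensor
  let ?\<rho> = "matrix_coaction H V \<iota> \<kappa> x"
  define c where "c k v = (\<Sum>i\<in>UNIV. smul H (\<kappa> v $ i) (x k i))" for k v
  have c: "linear_map V H (c k)" for k
    unfolding c_def by (rule linear_matrix_row[OF Hs(1) \<kappa>])
  have c_axis: "c k (\<iota> (axis i 1)) = x k i" for k i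
    unfolding c_def inv(2) by (rule matrix_row_axis[OF Hs(4)])
  have \<rho>: "?\<rho> v = (\<Sum>k\<in>UNIV. tens V H (\<iota> (axis k 1)) (c k v))" for v
    by (simp add: matrix_coaction_def c_def)
  have \<iota>_in: "\<iota> u \<in> carr V" for u using linear_map_in[OF \<iota>] by simp
  have lin: "linear_map V (tensor V H) ?\<rho>"
    unfolding \<rho> by (intro linear_map_sum_fun sp linear_map_comp[OF c linear_tens_right] \<iota>_in)
  have \<Delta>c: "comult H (c k v) = (\<Sum>l\<in>UNIV. tens H H (x k l) (c l v))" for k v
  proof -
    have "comult H (c k v) = (\<Sum>i\<in>UNIV. tscale (\<kappa> v $ i) (\<Sum>l\<in>UNIV. tens H H (x k l) (x l i)))"
      using x by (simp add: c_def alg comult_matrix_def linear_map_sum[OF Hs(5,4)] linear_map_scale[OF Hs(5)])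
    also have "\<dots> = (\<Sum>l\<in>UNIV. \<Sum>i\<in>UNIV. tens H H (x k l) (smul H (\<kappa> v $ i) (x l i)))"
      by (subst sum.swap) (simp add: tens_scale_right[OF sp(2,2)] alg space_smul_simps(7)[OF is_space_tensor, simplified])
    finally show ?thesis by (simp add: c_def tens_sum_right[OF sp(2,2)] alg)
  qed
  have \<epsilon>c: "counit H (c k v) = \<kappa> v $ k" for k v
  proof -
    have "counit H (c k v) = (\<Sum>i\<in>UNIV. \<kappa> v $ i * of_bool (k = i))"
      using x by (simp add: c_def alg comult_matrix_def linear_map_sum[OF Hs(6,4)] linear_map_scale[OF Hs(6)])
    then show ?thesis by (simp add: of_bool_def if_distrib cong: if_cong)
  qed
  have "tensor_assoc V H H (tensor_map V H (tensor V H) H ?\<rho> id (?\<rho> v))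
      = tensor_map V H V (tensor H H) id (comult H) (?\<rho> v)" for v
  proof -
    have e_\<rho>: "?\<rho> (\<iota> (axis k 1)) = (\<Sum>l\<in>UNIV. tens V H (\<iota> (axis l 1)) (x l k))" for k
      by (simp add: \<rho> c_axis)
    show ?thesis
      unfolding coassoc_expansion[OF V Hs(4) alg lin Hs(5) \<iota>_in \<rho> e_\<rho>] \<Delta>c ..
  qed
  moreover have "tensor_lift V H (\<lambda>v h. smul V (counit H h) v) (?\<rho> v) = v" if v: "v \<in> carr V" for v
  proof -
    have b: "bilinear_map V H V (\<lambda>v h. smul V (counit H h) v)"
      by (intro bilinear_mapI linear_map_smul[OF V linear_map_id(1)] linear_map_smul_left[OF V Hs(6)])
    have "tensor_lift V H (\<lambda>v h. smul V (counit H h) v) (?\<rho> v) = (\<Sum>k\<in>UNIV. smul V (\<kappa> v $ k) (\<iota> (axis k 1)))"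
      unfolding \<rho> by (subst tensor_lift_sum[OF sp(1,2,1) b]) (simp_all add: \<iota>_in alg \<epsilon>c)
    also have "\<dots> = \<iota> (\<Sum>k\<in>UNIV. (\<kappa> v $ k) *s axis k 1)"
      using linear_map_scale[OF \<iota>] by (simp add: linear_map_sum[OF \<iota> is_space_diag])
    finally show ?thesis using inv(1)[OF v] by (simp flip: axis_expansion)
  qed
  ultimately show ?thesis using V lin by (simp add: comodule_def)
qed

abbreviation "std_coaction H \<equiv> matrix_coaction H diag_algebra (\<lambda>u. u) (\<lambda>u. u)"

text \<open>The matrix consists of the coefficients of \<beta>\<open>(e_i)\<close> along the basis.
  Comparing coefficients in the coassociativity and counit axioms at \<open>e_i\<close> gives the
  two conditions of \<open>comult_matrix\<close>.\<close>

lemma comodule_matrix: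
  fixes \<beta> :: "'k::field ^ 'n \<Rightarrow> ('k, 'k ^ 'n, 'h::ring_1) tensors"
  assumes H: "bialgebra H" and \<beta>: "comodule H diag_algebra \<beta>"
  obtains x where "comult_matrix H x" "\<beta> = std_coaction H x"
proof -
  let ?D = "diag_algebra :: ('k, 'k ^ 'n) vspace"
  note Hs = bialgebraD[OF H] and alg = is_algebraD(2)[OF bialgebraD(1)[OF H]]
  note sp = is_space_diag[where 'b = 'n and 'a = 'k] Hs(4) is_space_tensor
  have \<beta>_lin: "linear_map ?D (tensor ?D H) \<beta>" using \<beta> by (simp add: comodule_def)
  define c where "c k v = tensor_lift ?D H (\<lambda>v h. smul H (v $ k) h) (\<beta> v)" for k v
  have c: "linear_map ?D H (c k)" for k
    unfolding c_def by (rule linear_map_comp[OF \<beta>_lin tensor_lift_linear[OF sp(1,2) coord_bilinear[OF sp(2)]]])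
  define x where "x k i = c k (axis i 1)" for k i
  have c_x: "c k v = (\<Sum>i\<in>UNIV. smul H (v $ i) (x k i))" for k v
  proof -
    have "c k v = c k (\<Sum>i\<in>UNIV. (v $ i) *s axis i 1)" by (simp flip: axis_expansion)
    then show ?thesis using linear_map_scale[OF c] by (simp add: linear_map_sum[OF c sp(1)] x_def)
  qed
  have \<beta>_c: "\<beta> v = (\<Sum>k\<in>UNIV. tens ?D H (axis k 1) (c k v))" for v
    unfolding c_def by (rule tensor_diag_expansion[OF sp(2) linear_map_in[OF \<beta>_lin]]) simp
  have "comult H (x k i) = (\<Sum>l\<in>UNIV. tens H H (x k l) (x l i))" for k i
  proof -
    let ?v = "axis i 1 :: 'k ^ 'n"
    have e_\<beta>: "\<beta> (axis k 1) = (\<Sum>l\<in>UNIV. tens ?D H (axis l 1) (x l k))" for k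
      by (simp add: \<beta>_c x_def)
    note expansion = coassoc_expansion[OF sp(1,2) alg \<beta>_lin Hs(5) _ e_\<beta>[of i] e_\<beta>]
    have "(\<Sum>l\<in>UNIV. tens ?D (tensor H H) (axis l 1) (comult H (x l i)))
      = (\<Sum>l\<in>UNIV. tens ?D (tensor H H) (axis l 1) (\<Sum>k\<in>UNIV. tens H H (x l k) (x k i)))"
      using \<beta> expansion by (simp add: comodule_def)
    then have "(\<lambda>l. comult H (x l i)) = (\<lambda>l. \<Sum>k\<in>UNIV. tens H H (x l k) (x k i))"
      by (rule tensor_diag_unique[OF is_space_tensor, rotated -1])
        (use linear_map_in[OF Hs(5)] in \<open>simp_all add: alg space_sum[OF sp(3)] tens_in[OF sp(2,2)]\<close>)
    then show ?thesis by (rule fun_cong)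
  qed
  moreover have "counit H (x k i) = of_bool (k = i)" for k i
  proof -
    have b: "bilinear_map ?D H ?D (\<lambda>v h. smul ?D (counit H h) v)"
      by (intro bilinear_mapI linear_map_smul[OF sp(1) linear_map_id(1)] linear_map_smul_left[OF sp(1) Hs(6)])
    have "axis i 1 = tensor_lift ?D H (\<lambda>v h. smul ?D (counit H h) v) (\<beta> (axis i 1))"
      using \<beta> by (simp add: comodule_def)
    also have "\<dots> = (\<Sum>k\<in>UNIV. counit H (x k i) *s axis k 1)"
      unfolding \<beta>_c by (subst tensor_lift_sum[OF sp(1,2,1) b]) (simp_all add: alg x_def)
    finally have "axis i 1 $ k = (\<Sum>k\<in>UNIV. counit H (x k i) *s (axis k 1 :: 'k ^ 'n)) $ k" by simp
    moreover have "(counit H (x j i) *s (axis j 1 :: 'k ^ 'n)) $ k = (if j = k then counit H (x j i) else 0)" for j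
      by (simp add: axis_def)
    ultimately show ?thesis by (simp add: axis_def of_bool_def split: if_splits)
  qed
  ultimately have "comult_matrix H x" by (simp add: comult_matrix_def)
  moreover have "\<beta> = std_coaction H x"
    by (simp add: fun_eq_iff[of \<beta>] matrix_coaction_def \<beta>_c c_x del: fun_eq_iff)
  ultimately show thesis by (rule that)
qed

text \<open>One half of the defining relations; applied to the transpose of \<open>x\<close> it is
  the other half.\<close>

definition row_relations :: "('n::finite \<Rightarrow> 'n \<Rightarrow> 'h::ring_1) \<Rightarrow> bool" where
  "row_relations x \<longleftrightarrow> (\<forall>k i j. x k i * x k j = (if i = j then x k i else 0)) \<and> (\<forall>k. (\<Sum>i\<in>UNIV. x k i) = 1)"

text \<open>The coefficient of the coaction at \<open>e_k\<close> is the linear map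
  \<open>c k\<close> that sends \<open>e_i\<close> to \<open>x k i\<close>. As the
  \<open>e_k\<close> are orthogonal idempotents with sum 1, the coaction is a unital algebra map
  exactly when each \<open>c k\<close> is one.\<close>

lemma algebra_map_std_coaction_iff:
  fixes x :: "'n::finite \<Rightarrow> 'n \<Rightarrow> 'h::ring_1" and H :: "('k::field, 'h) hopf"
  assumes H: "is_algebra H"
  shows "algebra_map_tensor diag_algebra diag_algebra H (std_coaction H x) \<longleftrightarrow> row_relations x"
proof -
  let ?D = "diag_algebra :: ('k, 'k ^ 'n) vspace"
  note Hs = is_algebraD[OF H]
  note sp = is_space_diag[where 'b = 'n and 'a = 'k] Hs(1) is_space_tensor
  define c where "c k v = (\<Sum>i\<in>UNIV. smul H (v $ i) (x k i))" for k and v :: "'k ^ 'n"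
  have \<rho>: "std_coaction H x v = (\<Sum>k\<in>UNIV. tens ?D H (axis k 1) (c k v))" for v
    by (simp add: matrix_coaction_def c_def)
  have c_axis: "c k (axis i 1) = x k i" for k i
    unfolding c_def by (rule matrix_row_axis[OF Hs(1)])
  have c_lin: "linear_map ?D H (c k)" for k
    unfolding c_def by (rule linear_matrix_row[OF H linear_map_id(1)])
  have lin: "linear_map ?D (tensor ?D H) (std_coaction H x)"
    unfolding \<rho> by (intro linear_map_sum_fun sp linear_map_comp[OF c_lin linear_tens_right]) simp
  have d: "tens ?D H (if a then v else 0) h = (if a then tens ?D H v h else 0)" for a v h
    by (simp add: tens_zero_left[OF sp(1,2)] Hs(2))
  have mult: "tensor_mult ?D H (std_coaction H x v) (std_coaction H x w)
      = (\<Sum>k\<in>UNIV. tens ?D H (axis k 1) (c k v * c k w))" for v w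
    unfolding \<rho> tensor_mult_sum[OF is_algebra_diag H] by (simp add: axis_mult d)
  have one: "tens ?D H 1 1 = (\<Sum>k\<in>UNIV. tens ?D H (axis k 1) 1)"
    unfolding one_axis by (rule tens_sum_left[OF sp(1,2)]) (simp_all add: Hs(2))
  have uniq: "(\<Sum>k\<in>UNIV. tens ?D H (axis k 1) (a k)) = (\<Sum>k\<in>UNIV. tens ?D H (axis k 1) (b k)) \<longleftrightarrow> (\<forall>k. a k = b k)" for a b
    using tensor_diag_unique[OF sp(2), of a b] by (auto simp: Hs(2))
  have "algebra_map_tensor ?D ?D H (std_coaction H x) \<longleftrightarrow>
      (\<forall>k. c k 1 = 1) \<and> (\<forall>v w k. c k (v * w) = c k v * c k w)"
    using lin unfolding algebra_map_tensor_def mult one unfolding \<rho> uniq by blast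
  also have "\<dots> \<longleftrightarrow> row_relations x"
  proof
    assume *: "(\<forall>k. c k 1 = 1) \<and> (\<forall>v w k. c k (v * w) = c k v * c k w)"
    have "x k i * x k j = (if i = j then x k i else 0)" for k i j
    proof -
      have "x k i * x k j = c k (axis i 1 * axis j 1)" using * by (simp add: c_axis)
      then show ?thesis using linear_map_zero[OF c_lin sp(1)] by (simp add: axis_mult c_axis)
    qed
    moreover have "(\<Sum>i\<in>UNIV. x k i) = 1" for k
      using * linear_map_sum[OF c_lin sp(1), of UNIV "\<lambda>i. axis i 1" k] by (simp add: c_axis flip: one_axis)
    ultimately show "row_relations x" by (simp add: row_relations_def)
  next
    assume *: "row_relations x"
    have "c k v * c k w = c k (v * w)" for k v w
    proof -
      have "smul H a (x k i) * smul H b (x k j) = (if i = j then smul H (a * b) (x k i) else 0)" for a b i j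
        using * by (simp add: Hs space_smul_simps[OF sp(2)] row_relations_def mult.commute)
      then show ?thesis by (simp add: c_def sum_product)
    qed
    moreover have "c k 1 = 1" for k
      using * by (simp add: c_def space_smul_simps[OF sp(2)] row_relations_def)
    ultimately show "(\<forall>k. c k 1 = 1) \<and> (\<forall>v w k. c k (v * w) = c k v * c k w)" by simp
  qed
  finally show ?thesis .
qed

lemma comult_matrix_qperm: "comult_matrix qperm qperm_gen"
  by (simp add: comult_matrix_def qperm_comult_spec qperm_counit_spec)

lemma qperm_coaction_eq: "qperm_coaction = std_coaction qperm qperm_gen"
proof
  fix v :: "'k::field ^ 'n"
  note sp = is_space_diag is_space_qperm
  have "qperm_coaction v = (\<Sum>i\<in>UNIV. \<Sum>k\<in>UNIV. tens diag_algebra qperm (axis k 1) (qperm_scale (v $ i) (qperm_gen k i)))"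
    by (simp add: qperm_coaction_def tens_scale_right[OF sp, simplified] space_smul_simps(7)[OF is_space_tensor, simplified])
  also have "\<dots> = std_coaction qperm qperm_gen v"
    by (subst sum.swap) (simp add: matrix_coaction_def tens_sum_right[OF sp])
  finally show "qperm_coaction v = std_coaction qperm qperm_gen v" .
qed

lemma coaction_qperm: "coaction qperm diag_algebra qperm_coaction"
  unfolding coaction_def qperm_coaction_eq algebra_map_std_coaction_iff[OF is_algebra_qperm]
  by (intro conjI matrix_comodule bialgebra_qperm comult_matrix_qperm is_space_diag linear_map_id)
    (simp_all add: row_relations_def qperm_gen_relations)

section \<open>Invariant functionals from semisimplicity\<close>

context right_comodule
begin

text \<open>In a direct sum a nonzero vector has a nonzero component. If \<open>w\<close> lay in the
  span of the others for every \<open>N\<close>, its component in each summand of a finite subfamily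
  would vanish, and stripping these summands off one by one would give \<open>w = 0\<close>.\<close>

lemma ex_avoiding_summand:
  assumes w: "w \<in> module.span (smul V) (\<Union>\<S>)" "w \<noteq> 0"
    and indep: "\<And>N. N \<in> \<S> \<Longrightarrow> N \<inter> module.span (smul V) (\<Union>(\<S> - {N})) = {0}"
    and sub: "\<And>N. N \<in> \<S> \<Longrightarrow> module.subspace (smul V) N"
  obtains N where "N \<in> \<S>" "w \<notin> module.span (smul V) (\<Union>(\<S> - {N}))"
proof -
  interpret V: vector_space "smul V" using spV by (rule space_vs)
  have "\<exists>N\<in>\<S>. w \<notin> V.span (\<Union>(\<S> - {N}))"
  proof (rule ccontr)
    assume "\<not> ?thesis"
    then have all: "w \<in> V.span (\<Union>(\<S> - {N}))" if "N \<in> \<S>" for N using that by blast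
    have zero: "w = 0" if "finite F" "F \<subseteq> \<S>" "w \<in> V.span (\<Union>F)" for F
      using that
    proof (induction F)
      case (insert N F)
      have N: "N \<in> \<S>" using insert.prems by simp
      obtain m n where mn: "w = m + n" "m \<in> V.span (\<Union>F)" "n \<in> V.span N"
        using insert.prems(2) by (auto simp: V.span_Un Un_commute[of N])
      have n: "n \<in> N" using mn(3) V.span_minimal[OF subset_refl sub[OF N]] by blast
      have "\<Union>F \<subseteq> \<Union>(\<S> - {N})" using insert.prems(1) insert.hyps(2) by blast
      then have "m \<in> V.span (\<Union>(\<S> - {N}))" using mn(2) V.span_mono by blast
      then have "w - m \<in> V.span (\<Union>(\<S> - {N}))" using all[OF N] by (simp add: V.span_diff)
      then have "n = 0" using indep[OF N] n mn(1) by auto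
      then show ?case using insert.IH insert.prems mn by simp
    qed simp
    obtain t r where t: "finite t" "t \<subseteq> \<Union>\<S>" "w = (\<Sum>a\<in>t. smul V (r a) a)"
      using w(1) by (auto simp: V.span_explicit)
    obtain F where F: "finite F" "F \<subseteq> \<S>" "t \<subseteq> \<Union>F"
      using finite_subset_Union[OF t(1,2)] by blast
    have "w \<in> V.span (\<Union>F)" unfolding t(3) using F(3)
      by (intro V.span_sum V.span_scale V.span_base) blast
    then show False using zero[OF F(1,2)] w(2) by blast
  qed
  then show thesis using that by blast
qed

text \<open>The condition \<open>inv\<close> expresses \<rho>\<open>(w) = w\<close> \<otimes>
  \<open>1\<close>. A nonzero component \<open>a\<close> of \<open>w\<close> in a simple summand
  \<open>N\<close> is invariant too, so it spans \<open>N\<close> by simplicity. The coordinate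
  along \<open>a\<close> that vanishes on the remaining summands is the required functional.\<close>

lemma ex_invariant_functional:
  assumes ss: "semisimple_comodule H V \<rho>" and w: "w \<in> carr V" "w \<noteq> 0"
    and inv: "\<And>f. dual f \<Longrightarrow> act H V \<rho> f w = smul V (f 1) w"
  obtains \<psi> where "linear_map V base_field \<psi>" "\<psi> w \<noteq> 0"
    "\<And>f v. dual f \<Longrightarrow> v \<in> carr V \<Longrightarrow> \<psi> (act H V \<rho> f v) = f 1 * \<psi> v"
proof -
  interpret V: vector_space "smul V" using spV by (rule space_vs)
  obtain \<S> where simple: "\<forall>N\<in>\<S>. simple_subcomodule H V \<rho> N" and span: "V.span (\<Union>\<S>) = carr V"
    and indep: "\<forall>N\<in>\<S>. N \<inter> V.span (\<Union>(\<S> - {N})) = {0}"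
    using ss unfolding semisimple_comodule_def by (elim exE conjE)
  have st: "stable N" if "N \<in> \<S>" for N
    using simple that by (simp add: simple_subcomodule_def subcomodule_iff_stable)
  obtain N where N: "N \<in> \<S>" "w \<notin> V.span (\<Union>(\<S> - {N}))"
  proof (rule ex_avoiding_summand[of w \<S>])
    show "w \<in> V.span (\<Union>\<S>)" "w \<noteq> 0" using w span by simp_all
    show "N \<inter> V.span (\<Union>(\<S> - {N})) = {0}" if "N \<in> \<S>" for N using indep that by blast
    show "V.subspace N" if "N \<in> \<S>" for N using st[OF that] by (simp add: stable_def)
  qed
  define C where "C = V.span (\<Union>(\<S> - {N}))"
  have C: "stable C" unfolding C_def by (rule stable_span_Union) (use st in blast)
  have Nst: "stable N" by (rule st[OF N(1)])
  have subN: "V.subspace N" "N \<subseteq> carr V" and actN: "\<And>f x. dual f \<Longrightarrow> x \<in> N \<Longrightarrow> act H V \<rho> f x \<in> N"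
    and subC: "V.subspace C" "C \<subseteq> carr V" and actC: "\<And>f x. dual f \<Longrightarrow> x \<in> C \<Longrightarrow> act H V \<rho> f x \<in> C"
    using Nst C by (auto simp: stable_def)
  have NC: "x = 0" if "x \<in> N" "x \<in> C" for x using that bspec[OF indep N(1)] by (auto simp: C_def)
  have decomp: "\<exists>n\<in>N. \<exists>c\<in>C. v = n + c" if v: "v \<in> carr V" for v
  proof -
    have "\<Union>\<S> = N \<union> \<Union>(\<S> - {N})" using N(1) by blast
    then have "v \<in> V.span (N \<union> \<Union>(\<S> - {N}))" using v span by simp
    then obtain n c where "v = n + c" "n \<in> V.span N" "c \<in> C"
      unfolding V.span_Un C_def by blast
    moreover have "V.span N \<subseteq> N" by (rule V.span_minimal[OF subset_refl subN(1)])
    ultimately show ?thesis by blast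
  qed
  obtain a c where a: "a \<in> N" and c: "c \<in> C" and w_eq: "w = a + c" using decomp[OF w(1)] by blast
  have aV: "a \<in> carr V" and cV: "c \<in> carr V" using a c subN subC by auto
  have "a \<noteq> 0" using N(2) c w_eq by (auto simp: C_def)
  have act_a: "act H V \<rho> f a = smul V (f 1) a" if f: "dual f" for f
  proof -
    have "act H V \<rho> f a + act H V \<rho> f c = smul V (f 1) a + smul V (f 1) c"
      using inv[OF f] linear_map_add[OF act_linear[OF f] aV cV] by (simp add: w_eq V.scale_right_distrib)
    \<comment> \<open>The left side lies in \<open>N\<close> and the right side in \<open>C\<close>,
      so both are zero.\<close>
    then have "act H V \<rho> f a - smul V (f 1) a = smul V (f 1) c - act H V \<rho> f c" by (simp add: algebra_simps)
    moreover have "act H V \<rho> f a - smul V (f 1) a \<in> N"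
      using actN[OF f a] a subN(1) by (simp add: V.subspace_diff V.subspace_scale)
    moreover have "smul V (f 1) c - act H V \<rho> f c \<in> C"
      using actC[OF f c] c subC(1) by (simp add: V.subspace_diff V.subspace_scale)
    ultimately show ?thesis using NC[of "act H V \<rho> f a - smul V (f 1) a"] by simp
  qed
  have "stable (V.span {a})"
  proof -
    have "V.span {a} \<subseteq> carr V" using aV space_subspace[OF spV] by (intro V.span_minimal) auto
    moreover have "act H V \<rho> f x \<in> V.span {a}" if "dual f" "x \<in> V.span {a}" for f x
      using that linear_map_scale[OF act_linear[OF that(1)] aV] act_a[OF that(1)]
      by (auto simp: V.span_singleton)
    ultimately show ?thesis by (simp add: stable_def)
  qed
  moreover have "V.span {a} \<subseteq> N" using a subN(1) by (intro V.span_minimal) auto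
  moreover have "V.span {a} \<noteq> {0}" using \<open>a \<noteq> 0\<close> V.span_base[of a "{a}"] by auto
  ultimately have N_eq: "N = V.span {a}"
    using simple N(1) unfolding simple_subcomodule_def subcomodule_iff_stable by blast
  obtain B where B: "B \<subseteq> C" "V.independent B" "C \<subseteq> V.span B"
    by (rule V.maximal_independent_subset)
  have CB: "C = V.span B" using B(3) V.span_minimal[OF B(1) subC(1)] by (rule equalityI)
  have "a \<notin> V.span B" using NC[OF a] \<open>a \<noteq> 0\<close> CB by blast
  then have "V.independent (insert a B)" using B(2) by (simp add: V.independent_insert)
  then obtain \<psi> where \<psi>: "linear_map V base_field \<psi>" "\<And>b. b \<in> insert a B \<Longrightarrow> \<psi> b = (if b = a then 1 else 0)"
    using dual_functional[OF spV, of "insert a B" a] by blast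
  have "a \<notin> B" using \<open>a \<notin> V.span B\<close> V.span_base by blast
  have \<psi>C: "\<psi> v = 0" if "v \<in> C" for v
  proof -
    have "v \<in> V.span B" using that CB by simp
    then have "v \<in> carr V \<and> \<psi> v = 0"
    proof (induction rule: V.span_induct_alt)
      case base
      then show ?case using linear_map_zero[OF \<psi>(1) spV] space_zero[OF spV] by simp
    next
      case (step k x y)
      have x: "x \<in> carr V" "\<psi> x = 0" using step(1) B(1) subC(2) \<psi>(2)[of x] \<open>a \<notin> B\<close> by auto
      then show ?case
        using step.IH linear_map_add[OF \<psi>(1) space_scale[OF spV x(1), of k]] linear_map_scale[OF \<psi>(1) x(1), of k]
        by (simp add: space_add[OF spV] space_scale[OF spV])
    qed
    then show ?thesis by simp
  qed
  have \<psi>a: "\<psi> a = 1" using \<psi>(2) by simp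
  show thesis
  proof (rule that[OF \<psi>(1)])
    show "\<psi> w \<noteq> 0" using linear_map_add[OF \<psi>(1) aV cV] by (simp add: w_eq \<psi>a \<psi>C[OF c])
    fix f v assume f: "dual f" and v: "v \<in> carr V"
    obtain n d where nd: "n \<in> N" "d \<in> C" "v = n + d" using decomp[OF v] by blast
    obtain r where r: "n = smul V r a" using nd(1) by (auto simp: N_eq V.span_singleton)
    have nV: "n \<in> carr V" and dV: "d \<in> carr V" using nd subN subC by auto
    have act_n: "act H V \<rho> f n = smul V (f 1) n"
      using linear_map_scale[OF act_linear[OF f] aV] act_a[OF f] by (simp add: r mult.commute)
    have "\<psi> (act H V \<rho> f v) = \<psi> (smul V (f 1) n) + \<psi> (act H V \<rho> f d)"
      using linear_map_add[OF act_linear[OF f] nV dV] linear_map_add[OF \<psi>(1), of "smul V (f 1) n" "act H V \<rho> f d"]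
        act_in[OF f dV] space_scale[OF spV nV] by (simp add: nd(3) act_n)
    also have "\<dots> = f 1 * \<psi> n"
      using linear_map_scale[OF \<psi>(1) nV] \<psi>C[OF actC[OF f nd(2)]] by simp
    also have "\<dots> = f 1 * \<psi> v"
      using linear_map_add[OF \<psi>(1) nV dV] \<psi>C[OF nd(2)] by (simp add: nd(3))
    finally show "\<psi> (act H V \<rho> f v) = f 1 * \<psi> v" .
  qed
qed

end

lemma dual_eqI:
  fixes H :: "('k::field, 'h::ab_group_add, 'm) vspace_scheme"
  assumes H: "is_space H" and eq: "\<And>f. linear_map H base_field f \<Longrightarrow> f x = f y" and xy: "x \<in> carr H" "y \<in> carr H"
  shows "x = y"
proof (rule ccontr)
  assume "x \<noteq> y"
  then have "x - y \<noteq> 0" by simp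
  then obtain g where g: "Vector_Spaces.linear (smul H) ((*) :: 'k \<Rightarrow> _) g" "g (x - y) \<noteq> 0"
    using linear_functional_separates[OF space_vs[OF H]] by blast
  interpret g: Vector_Spaces.linear "smul H" "(*)" g by (rule g(1))
  have "linear_map H base_field g" by (simp add: linear_map_def g.add g.scale)
  then show False using eq g(2) by (simp add: g.diff)
qed

text \<open>The comodule \<open>'k ^ 'n\<close> is transported into the type \<open>nat \<Rightarrow> 'h\<close> over which the
  semisimplicity hypothesis ranges.\<close>

lemma ex_invariant_vector:
  fixes H :: "('k::field, 'h::ring_1) hopf" and x :: "'n::finite \<Rightarrow> 'n \<Rightarrow> 'h" and w :: "'k ^ 'n"
  assumes H: "bialgebra H" and css: "cosemisimple TYPE(nat \<Rightarrow> 'h) H" and x: "comult_matrix H x"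
    and w: "w \<noteq> 0" "\<And>k. (\<Sum>i\<in>UNIV. smul H (w $ i) (x k i)) = smul H (w $ k) 1"
  obtains \<phi> where "\<And>i. (\<Sum>k\<in>UNIV. smul H (\<phi> k) (x k i)) = smul H (\<phi> i) 1" "(\<Sum>i\<in>UNIV. \<phi> i * w $ i) \<noteq> 0"
proof -
  note Hs = bialgebraD[OF H] and alg = is_algebraD(2)[OF bialgebraD(1)[OF H]]
  note sH = space_smul_simps[OF Hs(4)]
  obtain e :: "'n \<Rightarrow> nat" where e: "inj e"
    using finite_imp_inj_to_nat_seg[of "UNIV :: 'n set"] by auto
  define sc where "sc c g = (\<lambda>m. smul H c (g m))" for c and g :: "nat \<Rightarrow> 'h"
  \<comment> \<open>The coordinate \<open>u $ i\<close> is stored at position \<open>e i\<close> as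
    a multiple of the unit of \<open>H\<close>; since \<open>1\<close> is nonzero in
    \<open>H\<close>, this embedding is injective.\<close>
  define \<iota> where "\<iota> u m = (if m \<in> range e then smul H (u $ inv e m) 1 else 0)" for u :: "'k ^ 'n" and m
  define V where "V = \<lparr>carr = range \<iota>, smul = sc\<rparr>"
  have vs: "vector_space sc"
    by unfold_locales (auto simp: sc_def fun_eq_iff sH plus_fun_apply)
  have \<iota>_add: "\<iota> (u + v) = \<iota> u + \<iota> v" and \<iota>_scale: "\<iota> (c *s u) = sc c (\<iota> u)" for u v c
    by (auto simp: \<iota>_def sc_def fun_eq_iff sH plus_fun_apply)
  have V: "is_space V"
  proof -
    interpret S: vector_space sc by (rule vs)
    have "S.subspace (range \<iota>)"
    proof (rule S.subspaceI)
      show "0 \<in> range \<iota>" using \<iota>_scale[of 0 0] by (metis S.scale_zero_left rangeI)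
      show "g + h \<in> range \<iota>" if gh: "g \<in> range \<iota>" "h \<in> range \<iota>" for g h
      proof -
        obtain u v where "g = \<iota> u" "h = \<iota> v" using gh by blast
        then have "g + h = \<iota> (u + v)" by (simp only: \<iota>_add)
        then show ?thesis by blast
      qed
      show "sc c g \<in> range \<iota>" if g: "g \<in> range \<iota>" for c g
      proof -
        obtain u where "g = \<iota> u" using g by blast
        then have "sc c g = \<iota> (c *s u)" by (simp only: \<iota>_scale)
        then show ?thesis by blast
      qed
    qed
    then show ?thesis using vs by (simp add: is_space_def V_def)
  qed
  have "inj \<iota>"
  proof (rule injI)
    fix u v assume eq: "\<iota> u = \<iota> v"
    have "u $ i = v $ i" for i
    proof -
      have "smul H (u $ i) 1 = smul H (v $ i) 1" using fun_cong[OF eq, of "e i"] e by (simp add: \<iota>_def)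
      then have "smul H (u $ i - v $ i) 1 = 0"
        using sH(2)[of "u $ i - v $ i" "v $ i" 1] by simp
      then show ?thesis by (simp add: space_smul_eq_0[OF Hs(4)])
    qed
    then show "u = v" by (simp add: vec_eq_iff)
  qed
  define \<kappa> where "\<kappa> = inv \<iota>"
  have \<kappa>: "\<kappa> (\<iota> u) = u" for u using \<open>inj \<iota>\<close> by (simp add: \<kappa>_def)
  have \<iota>\<kappa>: "\<iota> (\<kappa> v) = v" if "v \<in> carr V" for v using that \<kappa> by (auto simp: V_def)
  have \<iota>_lin: "linear_map diag_algebra V \<iota>" by (simp add: linear_map_def V_def \<iota>_add \<iota>_scale)
  have \<kappa>_lin: "linear_map V diag_algebra \<kappa>"
  proof (rule linear_mapI)
    fix g h :: "nat \<Rightarrow> 'h" and c assume "g \<in> carr V"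
    then obtain u where u: "g = \<iota> u" by (auto simp: V_def)
    show "\<kappa> g \<in> carr diag_algebra" by simp
    have "\<kappa> (smul V c g) = \<kappa> (\<iota> (c *s u))" by (simp only: u \<iota>_scale) (simp add: V_def)
    then show "\<kappa> (smul V c g) = smul diag_algebra c (\<kappa> g)" by (simp add: \<kappa> u)
    assume "h \<in> carr V"
    then obtain v where v: "h = \<iota> v" by (auto simp: V_def)
    have "\<kappa> (g + h) = \<kappa> (\<iota> (u + v))" by (simp only: u v \<iota>_add)
    then show "\<kappa> (g + h) = \<kappa> g + \<kappa> h" by (simp only: \<kappa> u v)
  qed
  define \<rho> where "\<rho> = matrix_coaction H V \<iota> \<kappa> x"
  have com: "comodule H V \<rho>"
    unfolding \<rho>_def by (rule matrix_comodule[OF H x V \<iota>_lin \<kappa>_lin]) (simp_all add: \<iota>\<kappa> \<kappa>)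
  interpret right_comodule H V \<rho> by unfold_locales (rule H, rule com)
  have \<iota>_in: "\<iota> u \<in> carr V" for u by (simp add: V_def)
  have act: "act H V \<rho> f (\<iota> u) = (\<Sum>k\<in>UNIV. smul V (f (\<Sum>i\<in>UNIV. smul H (u $ i) (x k i))) (\<iota> (axis k 1)))"
    if "dual f" for f u
    unfolding act_def \<rho>_def matrix_coaction_def \<kappa>
    by (rule tensor_lift_sum[OF spV spH spV act_bilinear[OF that]]) (simp_all add: \<iota>_in)
  have expand: "\<iota> u = (\<Sum>k\<in>UNIV. smul V (u $ k) (\<iota> (axis k 1)))" for u
  proof -
    have "\<iota> u = \<iota> (\<Sum>k\<in>UNIV. (u $ k) *s axis k 1)" by (simp flip: axis_expansion)
    also have "\<dots> = (\<Sum>k\<in>UNIV. smul V (u $ k) (\<iota> (axis k 1)))"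
      using linear_map_scale[OF \<iota>_lin] by (simp add: linear_map_sum[OF \<iota>_lin is_space_diag])
    finally show ?thesis .
  qed
  have ss: "semisimple_comodule H V \<rho>" using css com by (simp add: cosemisimple_def)
  have "\<iota> w \<noteq> 0" using w(1) \<open>inj \<iota>\<close> linear_map_zero[OF \<iota>_lin is_space_diag] by (metis injD)
  moreover have "act H V \<rho> f (\<iota> w) = smul V (f 1) (\<iota> w)" if f: "dual f" for f
  proof -
    have "act H V \<rho> f (\<iota> w) = (\<Sum>k\<in>UNIV. smul V (f 1) (smul V (w $ k) (\<iota> (axis k 1))))"
      using linear_map_scale[OF f, of 1] by (simp add: act[OF f] w(2) space_smul_simps[OF V] mult.commute)
    then show ?thesis unfolding expand[of w] by (simp add: space_smul_simps[OF V])
  qed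
  ultimately obtain \<psi> where \<psi>: "linear_map V base_field \<psi>" "\<psi> (\<iota> w) \<noteq> 0"
    "\<And>f v. dual f \<Longrightarrow> v \<in> carr V \<Longrightarrow> \<psi> (act H V \<rho> f v) = f 1 * \<psi> v"
    using ex_invariant_functional[OF ss \<iota>_in] by blast
  have \<psi>_sum: "\<psi> (\<Sum>k\<in>UNIV. smul V (c k) (\<iota> (axis k 1))) = (\<Sum>k\<in>UNIV. c k * \<psi> (\<iota> (axis k 1)))" for c :: "'n \<Rightarrow> 'k"
    using linear_map_scale[OF \<psi>(1) \<iota>_in] by (simp add: linear_map_sum[OF \<psi>(1) V] space_scale[OF V] \<iota>_in)
  show thesis
  proof (rule that[of "\<lambda>k. \<psi> (\<iota> (axis k 1))"])
    fix i
    let ?\<phi> = "\<lambda>k. \<psi> (\<iota> (axis k 1))"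
    show "(\<Sum>k\<in>UNIV. smul H (?\<phi> k) (x k i)) = smul H (?\<phi> i) 1"
    \<comment> \<open>Invariance of \<psi> is known in terms of the action of functionals, so the
      equation in \<open>H\<close> is tested against all of them.\<close>
    proof (rule dual_eqI[OF spH])
      fix f assume f: "dual f"
      have "f (\<Sum>k\<in>UNIV. smul H (?\<phi> k) (x k i)) = (\<Sum>k\<in>UNIV. f (x k i) * ?\<phi> k)"
        using linear_map_scale[OF f] by (simp add: linear_map_sum[OF f spH] mult.commute)
      also have "\<dots> = \<psi> (act H V \<rho> f (\<iota> (axis i 1)))"
        by (simp add: act[OF f] matrix_row_axis[OF spH] \<psi>_sum)
      also have "\<dots> = f (smul H (?\<phi> i) 1)"
        using \<psi>(3)[OF f \<iota>_in] linear_map_scale[OF f] by (simp add: mult.commute)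
      finally show "f (\<Sum>k\<in>UNIV. smul H (?\<phi> k) (x k i)) = f (smul H (?\<phi> i) 1)" .
    qed simp_all
  next
    show "(\<Sum>i\<in>UNIV. \<psi> (\<iota> (axis i 1)) * w $ i) \<noteq> 0"
      using \<psi>(2) \<psi>_sum[of "\<lambda>k. w $ k"] by (simp add: expand[symmetric] mult.commute)
  qed
qed

section \<open>Universality\<close>

text \<open>Let \<open>y = S(x)\<close> be the inverse matrix. An invariant functional \<open>\<phi>\<close> satisfies
  \<open>\<phi>\<^sub>l x\<^sub>l\<^sub>i = \<phi>\<^sub>i y\<^sub>i\<^sub>l\<close>, and \<open>x\<^sub>l\<^sub>i y\<^sub>i\<^sub>l = x\<^sub>l\<^sub>i\<close>; hence
  \<open>y\<close> is the transpose of \<open>x\<close> as soon as every index \<open>i\<close> admits a \<open>\<phi>\<close>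
  with \<open>\<phi>\<^sub>i \<noteq> 0\<close>. The indices without such a \<open>\<phi>\<close> span a direct factor of
  the comodule algebra; a nonempty factor would have an invariant unit and therefore,
  by cosemisimplicity, an invariant functional that does not vanish on it.\<close>

lemma column_relations:
  fixes H :: "('k::field, 'h::ring_1) hopf" and x :: "'n::finite \<Rightarrow> 'n \<Rightarrow> 'h"
  assumes H: "hopf_algebra H" and css: "cosemisimple TYPE(nat \<Rightarrow> 'h) H" and x: "comult_matrix H x"
    and row: "row_relations x"
  shows "row_relations (\<lambda>i k. x k i)"
proof -
  have bi: "bialgebra H" using H by (simp add: hopf_algebra_def)
  note Hs = bialgebraD[OF bi] and alg = is_algebraD[OF bialgebraD(1)[OF bi]]
  note sH = space_smul_simps[OF Hs(4)]
  have S: "linear_map H H (antipode H)" using H by (simp add: hopf_algebra_def)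
  have xx: "x k i * x k j = (if i = j then x k i else 0)" and x_sum: "(\<Sum>i\<in>UNIV. x k i) = 1" for k i j
    using row by (simp_all add: row_relations_def)
  define y where "y i j = antipode H (x i j)" for i j
  have y_zero: "y i j = 0" if "x i j = 0" for i j
    using that linear_map_zero[OF S Hs(4)] by (simp add: y_def)
  have bl: "bilinear_map H H H (\<lambda>a b. antipode H a * b)" and br: "bilinear_map H H H (\<lambda>a b. a * antipode H b)"
    using bilinear_comp[OF bilinear_mult[OF Hs(1)] S linear_map_id(1) linear_map_id(1)]
      bilinear_comp[OF bilinear_mult[OF Hs(1)] linear_map_id(1) S linear_map_id(1)] by simp_all
  have yx: "(\<Sum>k\<in>UNIV. y i k * x k j) = of_bool (i = j)" for i j
  proof -
    have "(\<Sum>k\<in>UNIV. y i k * x k j) = tensor_lift H H (\<lambda>a b. antipode H a * b) (comult H (x i j))"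
      using x by (simp add: comult_matrix_def tensor_lift_sum[OF Hs(4,4,4) bl] alg y_def)
    also have "\<dots> = smul H (counit H (x i j)) 1" using H by (simp add: hopf_algebra_def)
    finally show ?thesis using x by (simp add: comult_matrix_def sH)
  qed
  have xy: "(\<Sum>k\<in>UNIV. x i k * y k j) = of_bool (i = j)" for i j
  proof -
    have "(\<Sum>k\<in>UNIV. x i k * y k j) = tensor_lift H H (\<lambda>a b. a * antipode H b) (comult H (x i j))"
      using x by (simp add: comult_matrix_def tensor_lift_sum[OF Hs(4,4,4) br] alg y_def)
    also have "\<dots> = smul H (counit H (x i j)) 1" using H by (simp add: hopf_algebra_def)
    finally show ?thesis using x by (simp add: comult_matrix_def sH)
  qed
  \<comment> \<open>Multiplying \<open>xy\<close> on the left by \<open>x i l\<close> keeps the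
    single term with index \<open>l\<close>, by orthogonality within a row.\<close>
  have x_y: "x i l * y l k = (if i = k then x i l else 0)" for i l k
  proof -
    have "x i l * (\<Sum>j\<in>UNIV. x i j * y j k) = (\<Sum>j\<in>UNIV. if l = j then x i l * y j k else 0)"
      unfolding sum_distrib_left by (intro sum.cong refl) (simp add: xx flip: mult.assoc)
    then show ?thesis by (cases "i = k") (simp_all add: xy)
  qed
  define E where "E = {\<phi> :: 'n \<Rightarrow> 'k. \<forall>i. (\<Sum>k\<in>UNIV. smul H (\<phi> k) (x k i)) = smul H (\<phi> i) 1}"
  have E: "smul H (\<phi> l) (x l i) = smul H (\<phi> i) (y i l)" if \<phi>: "\<phi> \<in> E" for \<phi> i l
  proof -
    \<comment> \<open>The invariance equation multiplied into the algebra \<open>'k ^ 'n\<close>: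
      orthogonality within each row gives the invariance of \<phi> again for \<open>i = j\<close>
      and zero otherwise. Summing against \<open>y j l\<close> then isolates the term with index
      \<open>l\<close>.\<close>
    have 1: "(\<Sum>k\<in>UNIV. smul H (\<phi> k) (x k i) * x k j) = (if i = j then smul H (\<phi> i) 1 else 0)" for j
    proof (cases "i = j")
      case True
      then show ?thesis using \<phi> by (simp add: alg xx E_def)
    qed (simp add: alg xx sH)
    have "(\<Sum>j\<in>UNIV. (\<Sum>k\<in>UNIV. smul H (\<phi> k) (x k i) * x k j) * y j l)
        = (\<Sum>k\<in>UNIV. smul H (\<phi> k) (x k i) * (\<Sum>j\<in>UNIV. x k j * y j l))"
      unfolding sum_distrib_left sum_distrib_right by (subst sum.swap) (simp add: mult.assoc)
    also have "\<dots> = (\<Sum>k\<in>UNIV. if k = l then smul H (\<phi> k) (x k i) else 0)"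
      unfolding xy by (intro sum.cong refl) simp
    finally have "(\<Sum>k\<in>UNIV. if k = l then smul H (\<phi> k) (x k i) else 0)
        = (\<Sum>j\<in>UNIV. (if i = j then smul H (\<phi> i) 1 else 0) * y j l)" unfolding 1 by simp
    also have "\<dots> = (\<Sum>j\<in>UNIV. if i = j then smul H (\<phi> i) (y j l) else 0)"
      by (intro sum.cong refl) (simp add: alg)
    finally show ?thesis by simp
  qed
  have ex_E: "\<exists>\<phi>\<in>E. \<phi> i \<noteq> 0" for i
  proof (rule ccontr)
    assume none: "\<not> ?thesis"
    define J where "J = {i. \<forall>\<phi>\<in>E. \<phi> i = 0}"
    have "i \<in> J" using none by (auto simp: J_def)
    have z: "x l j = 0" if j: "j \<in> J" and l: "l \<notin> J" for l j
    proof -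
      obtain \<phi> where \<phi>: "\<phi> \<in> E" "\<phi> l \<noteq> 0" using l by (auto simp: J_def)
      moreover have "\<phi> j = 0" using j \<phi>(1) by (simp add: J_def)
      ultimately have "smul H (\<phi> l) (x l j) = 0" using E[OF \<phi>(1), of l j] by (simp add: sH)
      then show ?thesis using \<phi>(2) by (simp add: space_smul_eq_0[OF Hs(4)])
    qed
    \<comment> \<open>The antipode carries the vanishing to the other off-diagonal block:
      \<open>x j k = 0\<close> gives \<open>y j k = 0\<close>, while
      \<open>x k j * y j k = x k j\<close>.\<close>
    have z': "x k j = 0" if "k \<in> J" "j \<notin> J" for k j
      using x_y[of k j k] y_zero[OF z[OF that]] by simp
    \<comment> \<open>The unit of the factor spanned by the \<open>e_j\<close> with
      \<open>j \<in> J\<close>. It is invariant because \<open>x\<close> is block diagonal and its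
      rows sum to 1. An invariant functional lies in \<open>E\<close>, hence vanishes on
      \<open>J\<close>, and cannot pair nontrivially with \<open>w\<close>.\<close>
    define w :: "'k ^ 'n" where "w = (\<chi> i. of_bool (i \<in> J))"
    have "w \<noteq> 0" using \<open>i \<in> J\<close> by (auto simp: w_def vec_eq_iff)
    moreover have "(\<Sum>j\<in>UNIV. smul H (w $ j) (x k j)) = smul H (w $ k) 1" for k
    proof (cases "k \<in> J")
      case True
      then have "smul H (w $ j) (x k j) = x k j" for j using z' by (cases "j \<in> J") (auto simp: w_def sH)
      then show ?thesis using True x_sum by (simp add: w_def sH)
    next
      case False
      then have "smul H (w $ j) (x k j) = 0" for j using z by (cases "j \<in> J") (auto simp: w_def sH)
      then show ?thesis using False by (simp add: w_def sH)
    qed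
    ultimately obtain \<phi> where \<phi>: "\<And>i. (\<Sum>k\<in>UNIV. smul H (\<phi> k) (x k i)) = smul H (\<phi> i) 1"
      "(\<Sum>i\<in>UNIV. \<phi> i * w $ i) \<noteq> 0"
      using ex_invariant_vector[OF bi css x] by blast
    have "\<phi> \<in> E" using \<phi>(1) by (simp add: E_def)
    then have "\<phi> i * w $ i = 0" for i by (cases "i \<in> J") (auto simp: J_def w_def)
    then have "(\<Sum>i\<in>UNIV. \<phi> i * w $ i) = 0" by (intro sum.neutral) blast
    then show False using \<phi>(2) by contradiction
  qed
  have y: "y i l = x l i" for i l
  proof -
    obtain \<phi> where \<phi>: "\<phi> \<in> E" "\<phi> i \<noteq> 0" using ex_E by blast
    have e: "smul H (\<phi> l) (x l i) = smul H (\<phi> i) (y i l)" by (rule E[OF \<phi>(1)])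
    \<comment> \<open>On the left \<open>x l i\<close> is idempotent, on the right
      \<open>x l i * y i l = x l i\<close>; so the coefficient \<phi>\<open>l\<close> can be
      replaced by \<phi>\<open>i\<close>, which is nonzero and cancels.\<close>
    have "x l i * smul H (\<phi> l) (x l i) = x l i * smul H (\<phi> i) (y i l)" by (simp only: e)
    then have "smul H (\<phi> l) (x l i) = smul H (\<phi> i) (x l i)" by (simp add: alg xx x_y)
    then have "smul H (\<phi> i) (y i l - x l i) = 0" by (simp add: sH e)
    then show ?thesis using \<phi>(2) by (simp add: space_smul_eq_0[OF Hs(4)])
  qed
  show ?thesis
    unfolding row_relations_def
  \<comment> \<open>With \<open>y\<close> the transpose of \<open>x\<close>, orthogonality within a
    column is \<open>x_y\<close>, and a column sum is a diagonal entry of \<open>yx\<close>, the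
    entries of \<open>x\<close> being idempotent.\<close>
  proof (intro conjI allI)
    show "x i k * x j k = (if i = j then x i k else 0)" for k i j
      using x_y[of i k j] by (simp add: y)
    show "(\<Sum>i\<in>UNIV. x i k) = 1" for k
      using yx[of k k] by (simp add: y xx)
  qed
qed

theorem universal_qperm:
  fixes H :: "('k::field_char_0, 'h::ring_1) hopf" and \<beta> :: "'k ^ 'n::finite \<Rightarrow> ('k, 'k ^ 'n, 'h) tensors"
  assumes H: "hopf_algebra H" and css: "cosemisimple TYPE(nat \<Rightarrow> 'h) H" and \<beta>: "coaction H diag_algebra \<beta>"
  shows "\<exists>!f :: ('k, 'n) qperm_algebra \<Rightarrow> 'h. bialgebra_map qperm H f \<and>
    tensor_map diag_algebra qperm diag_algebra H id f \<circ> qperm_coaction = \<beta>"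
proof -
  let ?D = "diag_algebra :: ('k, 'k ^ 'n) vspace" and ?Q = "qperm :: ('k, ('k, 'n) qperm_algebra) hopf"
  have bi: "bialgebra H" using H by (simp add: hopf_algebra_def)
  note Hs = bialgebraD[OF bi] and alg = is_algebraD(2)[OF bialgebraD(1)[OF bi]]
  note sp = is_space_diag[where 'b = 'n and 'a = 'k] is_space_qperm Hs(4)
  obtain x where x: "comult_matrix H x" and \<beta>_eq: "\<beta> = std_coaction H x"
    using comodule_matrix[OF bi] \<beta> unfolding coaction_def by blast
  have row: "row_relations x"
    using \<beta> algebra_map_std_coaction_iff[OF Hs(1), of x] by (simp add: coaction_def \<beta>_eq)
  have col: "row_relations (\<lambda>i k. x k i)" by (rule column_relations[OF H css x row])
  have \<alpha>: "(tensor_map ?D ?Q ?D H id f \<circ> qperm_coaction) v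
      = (\<Sum>k\<in>UNIV. tens ?D H (axis k 1) (\<Sum>i\<in>UNIV. smul H (v $ i) (f (qperm_gen k i))))"
    if f: "linear_map ?Q H f" for f v
  proof -
    have "f (\<Sum>i\<in>UNIV. qperm_scale (v $ i) (qperm_gen k i)) = (\<Sum>i\<in>UNIV. smul H (v $ i) (f (qperm_gen k i)))" for k
      using linear_map_scale[OF f] by (simp add: linear_map_sum[OF f sp(2)])
    then show ?thesis
      unfolding qperm_coaction_eq matrix_coaction_def comp_def
      by (subst tensor_map_sum[OF sp(1,2,1,3) linear_map_id(2) f]) simp_all
  qed
  have "algebra_on H (*) 1" by (rule algebra_on_algebra[OF Hs(1)])
  then obtain F where F: "linear_map ?Q H F" "F 1 = 1" "\<And>a b. F (a * b) = F a * F b" "\<And>i j. F (qperm_gen i j) = x i j"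
    using ex_qperm_hom[of H "(*)" 1 x] row col by (auto simp: row_relations_def alg qperm_space_eq)
  have F_mon: "F (qmon I J) = mon x I J" if "length I = length J" for I J
    using that by (induction I J rule: list_induct2) (simp_all add: F)
  have "comult H (F z) = tensor_map ?Q ?Q H H F F (comult ?Q z)" for z
  proof (rule qperm_linear_eqI'[where x = z, OF linear_map_comp[OF F(1) Hs(5)]])
    show "linear_map ?Q (tensor H H) (\<lambda>z. tensor_map ?Q ?Q H H F F (comult ?Q z))"
      using linear_map_comp[OF qperm_comult_linear tensor_map_linear[OF sp(2,3,3) F(1,1)]] by simp
    fix I J :: "'n list" assume l: "length I = length J"
    have "comult H (F (qmon I J)) = (\<Sum>L\<in>words (length I). tens H H (mon x I L) (mon x L J))"
      unfolding F_mon[OF l] by (rule comult_mon[OF Hs(1,2) _ l]) (use x in \<open>simp add: comult_matrix_def\<close>)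
    also have "\<dots> = tensor_map ?Q ?Q H H F F (comult ?Q (qmon I J))"
      by (simp add: qperm_comult_mon[OF l] tensor_map_sum[OF sp(2,2,3,3) F(1,1)] F_mon l cong: sum.cong_simp)
    finally show "comult H (F (qmon I J)) = tensor_map ?Q ?Q H H F F (comult ?Q (qmon I J))" .
  qed
  moreover have "counit H (F z) = counit ?Q z" for z
  proof (rule qperm_linear_eqI'[where x = z, OF linear_map_comp[OF F(1) Hs(6)]])
    show "linear_map ?Q base_field (counit ?Q)" using qperm_counit_linear by simp
    fix I J :: "'n list" assume l: "length I = length J"
    show "counit H (F (qmon I J)) = counit ?Q (qmon I J)"
      using x counit_mon[OF Hs(3) _ l] by (simp add: F_mon[OF l] qperm_counit_mon[OF l] comult_matrix_def)
  qed
  ultimately have F_bi: "bialgebra_map ?Q H F" using F by (simp add: bialgebra_map_def algebra_map_def)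
  have F_eq: "tensor_map ?D ?Q ?D H id F \<circ> qperm_coaction = \<beta>"
    by (rule ext) (simp only: \<alpha>[OF F(1)] F(4) \<beta>_eq matrix_coaction_def)
  show ?thesis
  proof (rule ex1I[of _ F], rule conjI[OF F_bi F_eq])
    fix f assume f: "bialgebra_map ?Q H f \<and> tensor_map ?D ?Q ?D H id f \<circ> qperm_coaction = \<beta>"
    then have f_alg: "linear_map ?Q H f" "f 1 = 1" "\<And>a b. f (a * b) = f a * f b"
      by (auto simp: bialgebra_map_def algebra_map_def)
    \<comment> \<open>The condition on the coactions, evaluated at \<open>e_i\<close> and compared
      along the basis, prescribes the values on the generators.\<close>
    have "f (qperm_gen k i) = F (qperm_gen k i)" for k i
    proof -
      have "(\<Sum>k\<in>UNIV. tens ?D H (axis k 1) (f (qperm_gen k i))) = (\<Sum>k\<in>UNIV. tens ?D H (axis k 1) (F (qperm_gen k i)))"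
        using f F_eq \<alpha>[OF f_alg(1), of "axis i 1"] \<alpha>[OF F(1), of "axis i 1"]
        by (simp add: matrix_row_axis[OF sp(3)])
      then have "(\<lambda>k. f (qperm_gen k i)) = (\<lambda>k. F (qperm_gen k i))"
        by (intro tensor_diag_unique[OF sp(3)]) (simp_all add: alg)
      then show ?thesis by (rule fun_cong)
    qed
    then show "f = F"
      using qperm_hom_unique[of H f 1 "(*)" F] f_alg F by (simp add: qperm_space_eq)
  qed
qed

theorem theorem3p9:
  shows "hopf_algebra (qperm :: ('k::field_char_0, ('k, 'n::finite) qperm_algebra) hopf)
    \<and> coaction qperm diag_algebra
        (qperm_coaction :: 'k ^ 'n \<Rightarrow> ('k, 'k ^ 'n, ('k, 'n) qperm_algebra) tensors)
    \<and> cosemisimple TYPE('v::ab_group_add)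
        (qperm :: ('k, ('k, 'n) qperm_algebra) hopf)
    \<and> (\<forall>(H :: ('k, 'h::ring_1) hopf) (\<beta> :: 'k ^ 'n \<Rightarrow> ('k, 'k ^ 'n, 'h) tensors).
         hopf_algebra H \<longrightarrow> cosemisimple TYPE(nat \<Rightarrow> 'h) H \<longrightarrow> coaction H diag_algebra \<beta> \<longrightarrow>
         (\<exists>!f :: ('k, 'n) qperm_algebra \<Rightarrow> 'h.
            bialgebra_map qperm H f \<and>
            tensor_map diag_algebra qperm diag_algebra H id f \<circ> qperm_coaction = \<beta>))"
  by (intro conjI allI impI hopf_algebra_qperm coaction_qperm cosemisimple_qperm universal_qperm)

end
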